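(* Let $(X,d,\mathfrak m)$ be a metric measure space with $p$-independent weak upper gradients in the strong sense, and let $(L^0(T^*X),\mathrm d)$ be its universal cotangent module and universal differential. Let $f\in\bigcup_{p\in(1,\infty)}S^p_{loc}(X)$ be such that for some $\bar p\in(1,\infty)$ we have $|\mathrm df|\in L^{\bar p}_{loc}(\mathfrak m)$. Then $f\in S^{\bar p}_{loc}(X)$.
   Context: Metric measure space $(X,d,\mathfrak m)$: $(X,d)$ is a complete and separable metric space and $\mathfrak m\neq 0$ is a non-negative Borel measure, finite on bounded sets. $p$ and $q$ always denote conjugate exponents. $L^p_{loc}(\mathfrak m)$: functions whose restriction to bounded sets is in $L^p$. $\mathrm{Lip}_{bs}(X)$: Lipschitz functions with bounded support. $C([0,1],X)$ carries the sup distance; $e_t(\gamma):=\gamma_t$; $|\dot\gamma_t|$ is the metric speed of $\gamma\in AC^q([0,1],X)$ ($q$-absolutely continuous curves). $q$-test plan ($q\in(1,\infty)$): a Borel probability $\pi$ on $C([0,1],X)$ such that for some $C>0$, $(e_t)_\sharp\pi\le C\mathfrak m$ for every $t\in[0,1]$, and $\int\int_0^1|\dot\gamma_t|^q\,dt\,d\pi<\infty$ (inner integral $+\infty$ if $\gamma\notin AC^q$). $S^p(X)$, $p\in(1,\infty)$: Borel $f:X\to\mathbb R$ for which there is $0\le G\in L^p(\mathfrak m)$ ($p$-weak upper gradient) with $\int|f(\gamma_1)-f(\gamma_0)|\,d\pi\le\int\int_0^1G(\gamma_t)|\dot\gamma_t|\,dt\,d\pi$ for every $q$-test plan $\pi$;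 $|Df|_p$ is the $\mathfrak m$-a.e. minimal such $G$. $W^{1,p}(X):=L^p(\mathfrak m)\cap S^p(X)$ with norm $(\|f\|_{L^p}^p+\||Df|_p\|_{L^p}^p)^{1/p}$. $S^p_{loc}(X)$: real valued Borel $f$ for which there is $0\le G\in L^p_{loc}(\mathfrak m)$ such that for every $k>0$, $\eta\in\mathrm{Lip}_{bs}(X)$, with $f^k:=k\wedge(f\vee -k)$, one has $\eta f^k\in S^p(X)$ and $|D(\eta f^k)|_p\le|\eta|G$ $\mathfrak m$-a.e. on $\{\eta=1\}$; then $|Df|_p:=|D(\eta f^k)|_p$ $\mathfrak m$-a.e. on $\{\eta=1\}\cap\{|f|<k\}$. $p$-independent weak upper gradients in the strong sense: for any $p_1,p_2\in(1,\infty)$, (a) $W^{1,p_1}(X)\cap W^{1,p_2}(X)$ is dense in both $W^{1,p_1}(X)$ and $W^{1,p_2}(X)$; (b) $|Df|_{p_1}=|Df|_{p_2}$ $\mathfrak m$-a.e. for every $f\in W^{1,p_1}(X)\cap W^{1,p_2}(X)$; (c) any $f\in W^{1,p_1}(X)$ with $f,|Df|_{p_1}\in L^{p_2}(\mathfrak m)$ belongs to $W^{1,p_2}(X)$. $L^0(\mathfrak m)$: Borel functions up to $\mathfrak m$-a.e. equality, with the topology of local convergence in measure. $L^0(\mathfrak m)$-normed module: a topological space $(\mathscr M,\tau)$ with a bilinear product $\cdot:L^0(\mathfrak m)\times\mathscr M\to\mathscr M$ satisfying $g\cdot(f\cdot v)=(fg)\cdot v$ and $\hat 1\cdot v=v$,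 and a pointwise norm $|\cdot|:\mathscr M\to L^0(\mathfrak m)$ with $|v|\ge0$, $|f\cdot v|=|f||v|$ $\mathfrak m$-a.e., such that $d_{\mathscr M}(v,w):=\int|v-w|\wedge1\,d\mathfrak m'$ ($\mathfrak m'$ a fixed finite Borel measure with $\mathfrak m\ll\mathfrak m'\ll\mathfrak m$) is a complete distance inducing $\tau$. A set generates $\mathscr M$ if simple $L^0$-linear combinations of its elements are $d_{\mathscr M}$-dense. Universal cotangent module and differential: the couple $(L^0(T^*X),\mathrm d)$, existing and unique up to unique module isomorphism on spaces satisfying (a),(b) above, where $L^0(T^*X)$ is an $L^0(\mathfrak m)$-normed module and $\mathrm d:\bigcup_{p\in(1,\infty)}S^p_{loc}(X)\to L^0(T^*X)$ is such that for every $p\in(1,\infty)$: $\mathrm d$ is linear on $S^p_{loc}(X)$; $|\mathrm df|=|Df|_p$ $\mathfrak m$-a.e. for all $f\in S^p_{loc}(X)$; $\{\mathrm df:f\in W^{1,p}(X)\}$ generates $L^0(T^*X)$. *)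

theory Defs
  imports "HOL-Analysis.Analysis"
begin

text \<open>
  The complete separable metric space \<open>X\<close> is a type of class \<^class>\<open>polish_space\<close>. Elements of
  \<open>L\<^sup>0\<close> and \<open>L\<^sup>p\<close>, weak gradients included, are Borel representatives, compared up to
  equality almost everywhere. Functions in the Sobolev classes are Borel functions, as in the
  definition of these classes.
\<close>

definition metric_measure_space :: "'a::polish_space measure \<Rightarrow> bool" where
  "metric_measure_space m \<longleftrightarrow>
     sets m = sets borel \<and> emeasure m UNIV \<noteq> 0 \<and>
     (\<forall>B\<in>sets borel. bounded B \<longrightarrow> emeasure m B < \<infinity>)"

definition Lp :: "'a measure \<Rightarrow> real \<Rightarrow> ('a \<Rightarrow> real) set" where
  "Lp m p = {f \<in> borel_measurable m. integrable m (\<lambda>x. \<bar>f x\<bar> powr p)}"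

definition Lp_loc :: "'a::metric_space measure \<Rightarrow> real \<Rightarrow> ('a \<Rightarrow> real) set" where
  "Lp_loc m p = {f \<in> borel_measurable m.
     \<forall>B\<in>sets m. bounded B \<longrightarrow> (\<lambda>x. indicator B x * f x) \<in> Lp m p}"

definition Lip_bs :: "('a::metric_space \<Rightarrow> real) set" where
  "Lip_bs = {\<eta>. (\<exists>L. L-lipschitz_on UNIV \<eta>) \<and> bounded (closure {x. \<eta> x \<noteq> 0})}"


subsection \<open>Curves and test plans\<close>

text \<open>\<open>C([0,1],X)\<close> with the sup distance; its elements are extensional on \<open>[0,1]\<close>.\<close>

definition curves :: "(real \<Rightarrow> 'a::metric_space) metric" where
  "curves = cfunspace (top_of_set {0..1}) euclidean_metric"

definition borel_curves :: "(real \<Rightarrow> 'a::metric_space) measure" where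
  "borel_curves = sigma (mspace curves) {U. openin (mtopology_of curves) U}"

definition AC :: "real \<Rightarrow> (real \<Rightarrow> 'a::metric_space) set" where
  "AC q = {\<gamma> \<in> mspace curves. \<exists>g\<in>borel_measurable borel.
     (\<forall>r. 0 \<le> g r) \<and>
     (\<integral>\<^sup>+r\<in>{0..1}. ennreal (g r powr q) \<partial>lborel) < \<infinity> \<and>
     (\<forall>s t. 0 \<le> s \<longrightarrow> s < t \<longrightarrow> t \<le> 1 \<longrightarrow>
        ennreal (dist (\<gamma> s) (\<gamma> t)) \<le> (\<integral>\<^sup>+r\<in>{s..t}. ennreal (g r) \<partial>lborel))}"

text \<open>For absolutely continuous curves the limit exists at almost every \<open>t\<close>; the value \<open>0\<close>
  at the remaining times is irrelevant.\<close>

definition metric_speed :: "(real \<Rightarrow> 'a::metric_space) \<Rightarrow> real \<Rightarrow> real" where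
  "metric_speed \<gamma> t =
     (if \<exists>l. ((\<lambda>s. dist (\<gamma> s) (\<gamma> t) / \<bar>s - t\<bar>) \<longlongrightarrow> l) (at t within {0..1})
      then Lim (at t within {0..1}) (\<lambda>s. dist (\<gamma> s) (\<gamma> t) / \<bar>s - t\<bar>) else 0)"

definition energy :: "real \<Rightarrow> (real \<Rightarrow> 'a::metric_space) \<Rightarrow> ennreal" where
  "energy q \<gamma> = (if \<gamma> \<in> AC q then \<integral>\<^sup>+t\<in>{0..1}. ennreal (metric_speed \<gamma> t powr q) \<partial>lborel else \<infinity>)"

definition test_plan :: "'a::polish_space measure \<Rightarrow> real \<Rightarrow> (real \<Rightarrow> 'a) measure \<Rightarrow> bool" where
  "test_plan m q \<pi> \<longleftrightarrow>
     sets \<pi> = sets borel_curves \<and> emeasure \<pi> (space \<pi>) = 1 \<and>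
     (\<exists>C>0. \<forall>t\<in>{0..1}. \<forall>A\<in>sets borel.
        emeasure (distr \<pi> borel (\<lambda>\<gamma>. \<gamma> t)) A \<le> ennreal C * emeasure m A) \<and>
     (\<integral>\<^sup>+\<gamma>. energy q \<gamma> \<partial>\<pi>) < \<infinity>"


subsection \<open>Sobolev classes\<close>

definition conj_exp :: "real \<Rightarrow> real" where
  "conj_exp p = p / (p - 1)"

definition weak_upper_gradient ::
  "'a::polish_space measure \<Rightarrow> real \<Rightarrow> ('a \<Rightarrow> real) \<Rightarrow> ('a \<Rightarrow> real) \<Rightarrow> bool" where
  "weak_upper_gradient m p f G \<longleftrightarrow>
     G \<in> Lp m p \<and> (AE x in m. 0 \<le> G x) \<and>
     (\<forall>\<pi>. test_plan m (conj_exp p) \<pi> \<longrightarrow>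
        (\<integral>\<^sup>+\<gamma>. ennreal \<bar>f (\<gamma> 1) - f (\<gamma> 0)\<bar> \<partial>\<pi>) \<le>
        (\<integral>\<^sup>+\<gamma>. (\<integral>\<^sup>+t\<in>{0..1}. ennreal (G (\<gamma> t) * metric_speed \<gamma> t) \<partial>lborel) \<partial>\<pi>))"

definition Sp :: "'a::polish_space measure \<Rightarrow> real \<Rightarrow> ('a \<Rightarrow> real) set" where
  "Sp m p = {f \<in> borel_measurable borel. \<exists>G. weak_upper_gradient m p f G}"

text \<open>\<open>|Df|\<^sub>p\<close> for \<open>f \<in> S\<^sup>p(X)\<close>: a representative of the minimal weak upper gradient.\<close>

definition wgrad :: "'a::polish_space measure \<Rightarrow> real \<Rightarrow> ('a \<Rightarrow> real) \<Rightarrow> 'a \<Rightarrow> real" where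
  "wgrad m p f = (SOME G. weak_upper_gradient m p f G \<and>
     (\<forall>G'. weak_upper_gradient m p f G' \<longrightarrow> (AE x in m. G x \<le> G' x)))"

definition W1p :: "'a::polish_space measure \<Rightarrow> real \<Rightarrow> ('a \<Rightarrow> real) set" where
  "W1p m p = Lp m p \<inter> Sp m p"

definition W1p_norm :: "'a::polish_space measure \<Rightarrow> real \<Rightarrow> ('a \<Rightarrow> real) \<Rightarrow> real" where
  "W1p_norm m p f =
     ((\<integral>x. \<bar>f x\<bar> powr p \<partial>m) + (\<integral>x. \<bar>wgrad m p f x\<bar> powr p \<partial>m)) powr (1 / p)"

definition W1p_dense :: "'a::polish_space measure \<Rightarrow> real \<Rightarrow> ('a \<Rightarrow> real) set \<Rightarrow> bool" where
  "W1p_dense m p D \<longleftrightarrow>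
     (\<forall>f\<in>W1p m p. \<forall>\<epsilon>>0. \<exists>g\<in>D \<inter> W1p m p. W1p_norm m p (\<lambda>x. f x - g x) < \<epsilon>)"

definition trunc :: "real \<Rightarrow> ('a \<Rightarrow> real) \<Rightarrow> 'a \<Rightarrow> real" where
  "trunc k f x = min k (max (f x) (- k))"

definition Sp_loc :: "'a::polish_space measure \<Rightarrow> real \<Rightarrow> ('a \<Rightarrow> real) set" where
  "Sp_loc m p = {f \<in> borel_measurable borel. \<exists>G\<in>Lp_loc m p. (AE x in m. 0 \<le> G x) \<and>
     (\<forall>k>0. \<forall>\<eta>\<in>Lip_bs.
        (\<lambda>x. \<eta> x * trunc k f x) \<in> Sp m p \<and>
        (AE x in m. \<eta> x = 1 \<longrightarrow> wgrad m p (\<lambda>x. \<eta> x * trunc k f x) x \<le> \<bar>\<eta> x\<bar> * G x))}"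

text \<open>\<open>|Df|\<^sub>p\<close> for \<open>f \<in> S\<^sup>p\<^sub>l\<^sub>o\<^sub>c(X)\<close>, obtained by gluing.\<close>

definition wgrad_loc :: "'a::polish_space measure \<Rightarrow> real \<Rightarrow> ('a \<Rightarrow> real) \<Rightarrow> 'a \<Rightarrow> real" where
  "wgrad_loc m p f = (SOME H. H \<in> borel_measurable borel \<and>
     (\<forall>k>0. \<forall>\<eta>\<in>Lip_bs. AE x in m.
        \<eta> x = 1 \<and> \<bar>f x\<bar> < k \<longrightarrow> H x = wgrad m p (\<lambda>x. \<eta> x * trunc k f x) x))"

definition p_independent_strong :: "'a::polish_space measure \<Rightarrow> bool" where
  "p_independent_strong m \<longleftrightarrow> (\<forall>p1>1. \<forall>p2>1.
     W1p_dense m p1 (W1p m p1 \<inter> W1p m p2) \<and> W1p_dense m p2 (W1p m p1 \<inter> W1p m p2) \<and>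
     (\<forall>f\<in>W1p m p1 \<inter> W1p m p2. AE x in m. wgrad m p1 f x = wgrad m p2 f x) \<and>
     (\<forall>f\<in>W1p m p1. f \<in> Lp m p2 \<longrightarrow> wgrad m p1 f \<in> Lp m p2 \<longrightarrow> f \<in> W1p m p2))"


subsection \<open>Normed modules and the universal cotangent module\<close>

definition module_dist :: "'a measure \<Rightarrow> ('v \<Rightarrow> 'a \<Rightarrow> real) \<Rightarrow> 'v::ab_group_add \<Rightarrow> 'v \<Rightarrow> real" where
  "module_dist m' nrm v w = (\<integral>x. min (nrm (v - w) x) 1 \<partial>m')"

text \<open>The module is the type \<open>'v\<close> with its class topology. The product \<open>smul\<close> acts on Borel
  representatives and is invariant under equality almost everywhere, hence it is a product with
  elements of \<open>L\<^sup>0\<close>; \<open>nrm v\<close> is a representative of the pointwise norm of \<open>v\<close>.\<close>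

locale L0_normed_module =
  fixes m m' :: "'a::polish_space measure"
    and smul :: "('a \<Rightarrow> real) \<Rightarrow> 'v::{real_vector, topological_space} \<Rightarrow> 'v"
    and nrm :: "'v \<Rightarrow> 'a \<Rightarrow> real"
  assumes sets_m': "sets m' = sets borel"
    and finite_m': "finite_measure m'"
    and ac: "absolutely_continuous m m'" "absolutely_continuous m' m"
    and smul_cong: "\<lbrakk>f \<in> borel_measurable borel; g \<in> borel_measurable borel;
          AE x in m. f x = g x\<rbrakk> \<Longrightarrow> smul f v = smul g v"
    and smul_add_left: "\<lbrakk>f \<in> borel_measurable borel; g \<in> borel_measurable borel\<rbrakk> \<Longrightarrow>
          smul (\<lambda>x. f x + g x) v = smul f v + smul g v"
    and smul_scale_left: "f \<in> borel_measurable borel \<Longrightarrow> smul (\<lambda>x. c * f x) v = c *\<^sub>R smul f v"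
    and smul_add_right: "f \<in> borel_measurable borel \<Longrightarrow> smul f (v + w) = smul f v + smul f w"
    and smul_scale_right: "f \<in> borel_measurable borel \<Longrightarrow> smul f (c *\<^sub>R v) = c *\<^sub>R smul f v"
    and smul_assoc: "\<lbrakk>f \<in> borel_measurable borel; g \<in> borel_measurable borel\<rbrakk> \<Longrightarrow>
          smul g (smul f v) = smul (\<lambda>x. f x * g x) v"
    and smul_one: "smul (\<lambda>_. 1) v = v"
    and nrm_borel: "nrm v \<in> borel_measurable borel"
    and nrm_nonneg: "AE x in m. 0 \<le> nrm v x"
    and nrm_smul: "f \<in> borel_measurable borel \<Longrightarrow> AE x in m. nrm (smul f v) x = \<bar>f x\<bar> * nrm v x"
    and metric: "Metric_space UNIV (module_dist m' nrm)"
    and complete: "Metric_space.mcomplete UNIV (module_dist m' nrm)"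
    and induces_topology: "Metric_space.mtopology UNIV (module_dist m' nrm) = (euclidean :: 'v topology)"

definition L0_span :: "(('a::topological_space \<Rightarrow> real) \<Rightarrow> 'v \<Rightarrow> 'v::ab_group_add) \<Rightarrow> 'v set \<Rightarrow> 'v set" where
  "L0_span smul V = {\<Sum>i<n. smul (g i) (v i) | (n::nat) g v.
     \<forall>i<n. g i \<in> borel_measurable borel \<and> v i \<in> V}"

definition generates ::
  "'a::topological_space measure \<Rightarrow> (('a \<Rightarrow> real) \<Rightarrow> 'v \<Rightarrow> 'v::ab_group_add) \<Rightarrow> ('v \<Rightarrow> 'a \<Rightarrow> real) \<Rightarrow> 'v set \<Rightarrow> bool" where
  "generates m' smul nrm V \<longleftrightarrow>
     (\<forall>v. \<forall>\<epsilon>>0. \<exists>w\<in>L0_span smul V. module_dist m' nrm v w < \<epsilon>)"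

text \<open>The differential \<open>d\<close> is only constrained on the union of the classes \<open>S\<^sup>p\<^sub>l\<^sub>o\<^sub>c(X)\<close>,
  \<open>1 < p < \<infinity>\<close>; its values elsewhere are irrelevant.\<close>

locale universal_cotangent_module = L0_normed_module m m' smul nrm
  for m m' :: "'a::polish_space measure"
    and smul :: "('a \<Rightarrow> real) \<Rightarrow> 'v::{real_vector, topological_space} \<Rightarrow> 'v"
    and nrm :: "'v \<Rightarrow> 'a \<Rightarrow> real" +
  fixes d :: "('a \<Rightarrow> real) \<Rightarrow> 'v"
  assumes d_add: "\<lbrakk>1 < p; f \<in> Sp_loc m p; g \<in> Sp_loc m p\<rbrakk> \<Longrightarrow> d (\<lambda>x. f x + g x) = d f + d g"
    and d_scale: "\<lbrakk>1 < p; f \<in> Sp_loc m p\<rbrakk> \<Longrightarrow> d (\<lambda>x. c * f x) = c *\<^sub>R d f"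
    and nrm_d: "\<lbrakk>1 < p; f \<in> Sp_loc m p\<rbrakk> \<Longrightarrow> AE x in m. nrm (d f) x = wgrad_loc m p f x"
    and d_generates: "1 < p \<Longrightarrow> generates m' smul nrm (d ` W1p m p)"

end

theory Submission
  imports Defs
begin

text \<open>
  The truncated and localised function \<open>h = \<eta> f\<^sup>k\<close> is bounded with bounded support, so
  it lies in \<open>W\<^sup>1\<^sup>,\<^sup>p\<close> and in every Lebesgue class. If \<open>|Dh|\<^sub>p\<close> is integrable with the new
  exponent, \<open>p\<close>-independence transfers \<open>h\<close> and its gradient to the new exponent. By a coarse Leibniz
  rule and locality \<open>|Dh|\<^sub>p\<close> vanishes off the bounded set \<open>{\<eta> \<noteq> 0}\<close> and is there at most
  \<open>k Lip(\<eta>) + sup |\<eta>| |df|\<close>, which is integrable with the new exponent by assumption.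

  Weak gradients are handled one curve at a time. Conditioning a test plan on a Borel set
  of curves and restricting it to a subinterval gives a test plan again, so the integrated inequality
  holds along almost every curve between almost all pairs of times. On a single curve, two bounds for the
  increments of a function can be combined on an arbitrary Borel set of times, because the admissible
  sets form a \<open>\<sigma>\<close>-algebra containing the half-lines with rational endpoint; this gives the lattice property and
  hence minimal weak upper gradients. A bound for the increments may also be set to zero where the function vanishes,
  which gives locality. That Lipschitz functions have bounded weak gradients rests on
  \<open>d(\<gamma>\<^sub>s, \<gamma>\<^sub>t) \<le> \<integral> |\<gamma>'|\<close> along absolutely continuous curves, obtained from Vitali coverings.
\<close>

subsection \<open>Increment bounds on the real line\<close>

text \<open>Membership in \<open>Sp_loc m pbar\<close> makes two separate demands. For
  \<open>\<eta> f^k\<close> to lie in \<open>Sp m pbar\<close> any crude gradient bound in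
  \<open>Lp m pbar\<close> suffices, so the Leibniz rule may lose constants. The sharp bound by |df|
  on \<open>\<eta> = 1\<close> does not come from a Leibniz rule at all: there the gradient is the
  glued one where |f| < k, and it vanishes on the levels k and -k of the product; this is proved for
  the old exponent and carried over by the equality of gradients. \<open>wgrad\<close> and
  \<open>wgrad_loc\<close> are choices, hence carry no information until a minimal weak upper
  gradient and a gluing are shown to exist. All that is given is an integrated inequality between
  the times 0 and 1. Since a Sobolev function need not be continuous along curves, no absolutely
  continuous representative is built; increments are compared only between times of a set
  \<open>D\<close>. Almost every curve has a set of good times of full measure in [0,1] that
  contains all rationals of [0,1], 0 and 1 among them.\<close>

definition increment_bound :: "real set \<Rightarrow> (real \<Rightarrow> 'b::metric_space) \<Rightarrow> (real \<Rightarrow> ennreal) \<Rightarrow> bool" where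
  "increment_bound D u g \<longleftrightarrow> (\<forall>s\<in>D. \<forall>t\<in>D. s < t \<longrightarrow>
     ennreal (dist (u s) (u t)) \<le> (set_nn_integral lborel {s..t} g))"

lemma set_nn_integral_mono_set:
  "A \<subseteq> B \<Longrightarrow> (\<integral>\<^sup>+r\<in>A. g r \<partial>M) \<le> (\<integral>\<^sup>+r\<in>B. (g r::ennreal) \<partial>M)"
  by (intro nn_integral_mono) (auto split: split_indicator)

lemma set_nn_integral_split:
  fixes g :: "real \<Rightarrow> ennreal"
  assumes [measurable]: "g \<in> borel_measurable borel" and "a \<le> b" "b \<le> c"
  shows "(set_nn_integral lborel {a..b} g) + (set_nn_integral lborel {b..c} g) = (set_nn_integral lborel {a..c} g)"
proof -
  have "(set_nn_integral lborel {a..b} g) + (set_nn_integral lborel {b..c} g)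
      = (\<integral>\<^sup>+r. g r * indicator {a..b} r + g r * indicator {b..c} r \<partial>lborel)"
    by (rule nn_integral_add[symmetric]) auto
  also have "\<dots> = (set_nn_integral lborel {a..c} g)"
  proof (rule nn_integral_cong_AE)
    show "AE r in lborel. g r * indicator {a..b} r + g r * indicator {b..c} r = g r * indicator {a..c} r"
      using AE_lborel_singleton[of b]
    proof eventually_elim
      case (elim r)
      then show ?case using assms(2,3) by (auto split: split_indicator)
    qed
  qed
  finally show ?thesis .
qed

text \<open>Dominated convergence on each \<open>{s..t}\<close>. It closes the class of admissible
  time sets under countable unions and lets a decreasing sequence of bounds pass to its
  infimum.\<close>

lemma increment_bound_limit:
  assumes B: "\<And>n. increment_bound D u (g n)" and D: "D \<subseteq> {0..1}"
    and [measurable]: "\<And>n. g n \<in> borel_measurable borel" "w \<in> borel_measurable borel"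
      "h \<in> borel_measurable borel"
    and w: "\<And>n r. g n r \<le> w r" "(set_nn_integral lborel {0..1} w) < \<infinity>"
    and lim: "\<And>r. (\<lambda>n. g n r) \<longlonglongrightarrow> h r"
  shows "increment_bound D u h"
  unfolding increment_bound_def
proof (intro ballI impI)
  fix s t assume st: "s \<in> D" "t \<in> D" "s < t"
  then have sub: "{s..t} \<subseteq> {0..1}" using D by auto
  have "(\<lambda>n. \<integral>\<^sup>+r\<in>{s..t}. g n r \<partial>lborel) \<longlonglongrightarrow> (set_nn_integral lborel {s..t} h)"
  proof (rule nn_integral_dominated_convergence[where w="\<lambda>r. w r * indicator {0..1} r"])
    show "AE r in lborel. g n r * indicator {s..t} r \<le> w r * indicator {0..1} r" for n
      using w(1) sub by (auto split: split_indicator)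
    show "AE r in lborel. (\<lambda>n. g n r * indicator {s..t} r) \<longlonglongrightarrow> h r * indicator {s..t} r"
      using lim by (auto split: split_indicator)
  qed (use w in auto)
  then show "ennreal (dist (u s) (u t)) \<le> (set_nn_integral lborel {s..t} h)"
    by (rule Lim_bounded2[where N=0]) (use B st in \<open>auto simp: increment_bound_def\<close>)
qed

text \<open>Rational endpoints serve the induction that uses these generators: an interval is cut at
  the endpoint \<open>q\<close>, so \<open>q\<close> must be a time at which increments are
  controlled. Density of the rationals recovers the open half-lines.\<close>

lemma borel_eq_atMost_Rats: "(borel :: real measure) = sigma UNIV ((\<lambda>q. {..q}) ` \<rat>)"
proof (rule borel_eq_sigmaI1[OF borel_Ioi])
  fix X :: "real set" assume "X \<in> range greaterThan"
  then obtain a where X: "X = {a<..}" by auto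
  have "X = (\<Union>q\<in>\<rat> \<inter> {a<..}. UNIV - {..q})"
    unfolding X
  proof safe
    fix x assume "a < x"
    then obtain q where "q \<in> \<rat>" "a < q" "q < x" using Rats_dense_in_real by blast
    then show "x \<in> (\<Union>q\<in>\<rat> \<inter> {a<..}. UNIV - {..q})" by force
  qed auto
  also have "\<dots> \<in> sets (sigma UNIV ((\<lambda>q. {..q}) ` \<rat>))"
    by (intro sets.countable_UN'' sets.Diff countable_Int1 countable_rat)
      (auto simp: sets.top[of "sigma UNIV ((\<lambda>q. {..q}) ` \<rat>)", simplified])
  finally show "X \<in> sets (sigma UNIV ((\<lambda>q. {..q}) ` \<rat>))" .
qed auto

text \<open>Induction over the sigma-algebra generated by rational half-lines. For
  \<open>{..q}\<close> the increment is cut at \<open>q\<close>, which lies in \<open>D\<close>, and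
  each piece uses its own bound; complements exchange the two bounds; countable unions are limits of
  finite ones, dominated by the sum of the bounds.\<close>

lemma increment_bound_piecewise:
  assumes D: "D \<subseteq> {0..1}" "\<rat> \<inter> {0..1} \<subseteq> D"
    and E: "E \<in> sets borel"
    and g1[measurable]: "g1 \<in> borel_measurable borel" and f1: "(set_nn_integral lborel {0..1} g1) < \<infinity>" 
    and g2[measurable]: "g2 \<in> borel_measurable borel" and f2: "(set_nn_integral lborel {0..1} g2) < \<infinity>"
    and B1: "increment_bound D u g1" and B2: "increment_bound D u g2"
  shows "increment_bound D u (\<lambda>r. if r \<in> E then g1 r else g2 r)"
proof -
  \<comment> \<open>\<open>ok\<close> carries measurability and finite integrals along, since each
    intermediate bound is fed back into the induction hypothesis.\<close>
  define ok where "ok g \<longleftrightarrow> g \<in> borel_measurable borel \<and> (set_nn_integral lborel {0..1} g) < \<infinity> \<and>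
    increment_bound D u g" for g :: "real \<Rightarrow> ennreal"
  have dom: "(\<integral>\<^sup>+r\<in>{0..1}. a r + b r \<partial>lborel) < \<infinity>" if "ok a" "ok b" for a b
  proof -
    have [measurable]: "a \<in> borel_measurable borel" "b \<in> borel_measurable borel"
      using that by (auto simp: ok_def)
    have "(\<integral>\<^sup>+r\<in>{0..1}. a r + b r \<partial>lborel) = (set_nn_integral lborel {0..1} a) + (set_nn_integral lborel {0..1} b)"
      by (simp add: distrib_right nn_integral_add)
    then show ?thesis using that by (auto simp: ok_def)
  qed
  have fin: "(\<integral>\<^sup>+r\<in>{0..1}. (if r \<in> A then a r else b r) \<partial>lborel) < \<infinity>" if "ok a" "ok b" for a b A
    by (rule le_less_trans[OF _ dom[OF that]])
      (intro nn_integral_mono, auto split: split_indicator simp: add_increasing add_increasing2)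
  \<comment> \<open>Both bounds are quantified inside the induction: complements swap them and
    finite unions replace the second one.\<close>
  have "\<forall>a b. ok a \<longrightarrow> ok b \<longrightarrow> ok (\<lambda>r. if r \<in> E then a r else b r)"
  proof -
    have "E \<in> sigma_sets UNIV ((\<lambda>q. {..q}) ` (\<rat>::real set))"
      using E by (subst (asm) borel_eq_atMost_Rats) simp
    then show ?thesis
    proof induction
      case (Basic A)
      then obtain q where q: "q \<in> \<rat>" "A = {..q}" by auto
      show ?case
      proof (intro allI impI)
        fix a b assume ab: "ok a" "ok b"
        let ?h = "\<lambda>r. if r \<in> A then a r else b r"
        have [measurable]: "a \<in> borel_measurable borel" "b \<in> borel_measurable borel"
          using ab by (auto simp: ok_def)
        have hm[measurable]: "?h \<in> borel_measurable borel" by (simp add: q)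
        have "increment_bound D u ?h"
          unfolding increment_bound_def
        proof (intro ballI impI)
          fix s t assume st: "s \<in> D" "t \<in> D" "s < t"
          have inc: "ennreal (dist (u x) (u y)) \<le> (set_nn_integral lborel {x..y} a)"
               "ennreal (dist (u x) (u y)) \<le> (set_nn_integral lborel {x..y} b)"
               if "x \<in> D" "y \<in> D" "x \<le> y" for x y
            using ab that by (cases "x = y"; auto simp: ok_def increment_bound_def)+
          have A1: "(set_nn_integral lborel {x..y} a) = (set_nn_integral lborel {x..y} ?h)" if "y \<le> q" for x y
            by (intro nn_integral_cong) (use that q in \<open>auto split: split_indicator\<close>)
          \<comment> \<open>At \<open>q\<close> itself the spliced function takes the value of
            \<open>a\<close>, hence only almost everywhere equality to the right of
            \<open>q\<close>.\<close>
          have A2: "(set_nn_integral lborel {x..y} b) = (set_nn_integral lborel {x..y} ?h)" if "q \<le> x" for x y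
            by (intro nn_integral_cong_AE, use AE_lborel_singleton[of q] in eventually_elim)
              (use that q in \<open>auto split: split_indicator\<close>)
          consider "q \<le> s" | "t \<le> q" | "s \<le> q" "q \<le> t" by linarith
          then show "ennreal (dist (u s) (u t)) \<le> (set_nn_integral lborel {s..t} ?h)"
          proof cases
            case 1
            then show ?thesis using inc(2)[of s t] st A2[of s t] by simp
          next
            case 2
            then show ?thesis using inc(1)[of s t] st A1[of t s] by simp
          next
            case 3
            then have qD: "q \<in> D" using D q st by (meson IntI atLeastAtMost_iff in_mono order_trans)
            have "ennreal (dist (u s) (u t)) \<le> ennreal (dist (u s) (u q)) + ennreal (dist (u q) (u t))"
              by (simp add: dist_triangle flip: ennreal_plus)
            also have "\<dots> \<le> (set_nn_integral lborel {s..q} ?h) + (set_nn_integral lborel {q..t} ?h)"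
              using inc(1)[of s q] inc(2)[of q t] 3 st qD A1[of q s] A2[of q t] by (intro add_mono) auto
            also have "\<dots> = (set_nn_integral lborel {s..t} ?h)"
              using 3 by (intro set_nn_integral_split) auto
            finally show ?thesis .
          qed
        qed
        then show "ok ?h" using ab fin hm by (auto simp: ok_def)
      qed
    next
      case Empty
      then show ?case by (simp add: ok_def)
    next
      case (Compl A)
      show ?case
      proof (intro allI impI)
        fix a b assume "ok a" "ok b"
        then have "ok (\<lambda>r. if r \<in> A then b r else a r)" using Compl by blast
        moreover have "(\<lambda>r. if r \<in> A then b r else a r) = (\<lambda>r. if r \<in> UNIV - A then a r else b r)"
          by auto
        ultimately show "ok (\<lambda>r. if r \<in> UNIV - A then a r else b r)" by simp
      qed
    next
      case (Union A)
      show ?case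
      proof (intro allI impI)
        fix a b assume ab: "ok a" "ok b"
        let ?h = "\<lambda>r. if r \<in> (\<Union>i. A i) then a r else b r"
        let ?g = "\<lambda>n r. if r \<in> (\<Union>i<n. A i) then a r else b r"
        have okg: "ok (?g n)" for n
        proof (induction n)
          case 0
          then show ?case using ab by simp
        next
          case (Suc n)
          have "?g (Suc n) = (\<lambda>r. if r \<in> A n then a r else ?g n r)"
            by (auto simp: lessThan_Suc)
          moreover have "ok (\<lambda>r. if r \<in> A n then a r else ?g n r)"
            using Union(2)[of n] ab(1) Suc.IH by (elim allE impE)
          ultimately show ?case by (simp only:)
        qed
        have A: "A i \<in> sets borel" for i
          using Union(1)[of i] by (subst borel_eq_atMost_Rats) simp
        have [measurable]: "a \<in> borel_measurable borel" "b \<in> borel_measurable borel"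
          using ab by (auto simp: ok_def)
        have hm: "?h \<in> borel_measurable borel"
          by (rule measurable_If_set) (use A in auto)
        have "increment_bound D u ?h"
        proof (rule increment_bound_limit[OF _ D(1), of u ?g "\<lambda>r. a r + b r"])
          show "increment_bound D u (?g n)" "?g n \<in> borel_measurable borel" for n
            using okg[of n] by (auto simp: ok_def)
          show "?g n r \<le> a r + b r" for n r
            by (simp add: add_increasing add_increasing2)
          show "(\<integral>\<^sup>+ r\<in>{0..1}. (a r + b r)\<partial>lborel) < \<infinity>" using dom ab by blast
          show "(\<lambda>n. ?g n r) \<longlonglongrightarrow> ?h r" for r
          proof (cases "r \<in> (\<Union>i. A i)")
            case True
            then obtain i where "r \<in> A i" by auto
            then have mem: "r \<in> (\<Union>i<n. A i)" if "i < n" for n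
              using that by blast
            have "?g n r = ?h r" if "Suc i \<le> n" for n
              using mem[of n] that True by (simp only: if_True Suc_le_eq)
            then show ?thesis by (intro tendsto_eventually eventually_sequentiallyI)
          next
            case False
            then show ?thesis by simp
          qed
        qed (use hm in auto)
        then show "ok ?h" using hm fin[OF ab, of "\<Union>i. A i"] unfolding ok_def by blast
      qed
    qed
  qed
  then show ?thesis using assms by (auto simp: ok_def)
qed

text \<open>Away from the two limit endpoints the indicators are eventually constant, so dominated
  convergence applies. It is used where an extremal time is only a limit of admissible ones.\<close>

lemma tendsto_set_nn_integral_Icc:
  fixes c :: "real \<Rightarrow> ennreal"
  assumes [measurable]: "c \<in> borel_measurable borel" and fin: "(set_nn_integral lborel {p..q} c) < \<infinity>"
    and x: "x \<longlonglongrightarrow> x'" "\<And>n::nat. p \<le> x n" and y: "y \<longlonglongrightarrow> y'" "\<And>n. y n \<le> q"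
  shows "(\<lambda>n. \<integral>\<^sup>+r\<in>{x n..y n}. c r \<partial>lborel) \<longlonglongrightarrow> (set_nn_integral lborel {x'..y'} c)"
proof (rule nn_integral_dominated_convergence[where w="\<lambda>r. c r * indicator {p..q} r"])
  show "AE r in lborel. c r * indicator {x n..y n} r \<le> c r * indicator {p..q} r" for n
    using x(2)[of n] y(2)[of n] by (auto split: split_indicator intro!: AE_I2)
  show "AE r in lborel. (\<lambda>n. c r * indicator {x n..y n} r) \<longlonglongrightarrow> c r * indicator {x'..y'} r"
    using AE_lborel_singleton[of x'] AE_lborel_singleton[of y']
  proof eventually_elim
    case (elim r)
    have "\<forall>\<^sub>F n in sequentially. indicator {x n..y n} r = (indicator {x'..y'} r :: ennreal)"
    proof (cases "x' < r \<and> r < y'")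
      case True
      then have "\<forall>\<^sub>F n in sequentially. x n < r \<and> r < y n"
        using order_tendstoD[OF x(1)] order_tendstoD[OF y(1)] by (intro eventually_conj) auto
      then show ?thesis by eventually_elim (use True in auto)
    next
      case False
      then consider "r < x'" | "y' < r" using elim by fastforce
      then show ?thesis
      proof cases
        case 1
        then have "\<forall>\<^sub>F n in sequentially. r < x n" using order_tendstoD[OF x(1)] by auto
        then show ?thesis by eventually_elim (use 1 in auto)
      next
        case 2
        then have "\<forall>\<^sub>F n in sequentially. y n < r" using order_tendstoD[OF y(1)] by auto
        then show ?thesis by eventually_elim (use 2 in auto)
      qed
    qed
    then have "\<forall>\<^sub>F n in sequentially. c r * indicator {x n..y n} r = c r * indicator {x'..y'} r"
      by eventually_elim simp
    then show ?case by (rule tendsto_eventually)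
  qed
qed (use fin in auto)

text \<open>Only the stretches before the first zero and after the last one count: with
  \<open>l\<close> and \<open>r\<close> the infimum and supremum of the zeros in \<open>T\<close>,
  |w a| is at most the integral over \<open>{a..l}\<close> and |w b| at most the one over
  \<open>{r..b}\<close>, and almost no zero lies in either stretch. As \<open>w\<close> is not
  assumed continuous, \<open>l\<close> and \<open>r\<close> need not be zeros and are reached by
  sequences of zeros.\<close>

lemma increment_bound_off_zeros:
  fixes w :: "real \<Rightarrow> real"
  assumes B: "increment_bound T w c" and c[measurable]: "c \<in> borel_measurable borel"
    and fin: "(set_nn_integral lborel {0..1} c) < \<infinity>"
    and T: "T \<subseteq> {0..1}" "AE r in lborel. r \<in> {0..1} \<longrightarrow> r \<in> T"
  shows "increment_bound T w (\<lambda>r. if w r = 0 then 0 else c r)"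
  unfolding increment_bound_def
proof (intro ballI impI)
  fix a b assume ab: "a \<in> T" "b \<in> T" "a < b"
  then have ab01: "0 \<le> a" "b \<le> 1" using T by auto
  let ?h = "\<lambda>r. if w r = 0 then 0 else c r"
  have inc: "ennreal (dist (w x) (w y)) \<le> (set_nn_integral lborel {x..y} c)" 
    if "x \<in> T" "y \<in> T" "x \<le> y" for x y
    using B that by (cases "x = y"; auto simp: increment_bound_def)
  define Z where "Z = {t \<in> T \<inter> {a..b}. w t = 0}"
  show "ennreal (dist (w a) (w b)) \<le> (set_nn_integral lborel {a..b} ?h)"
  proof (cases "Z = {}")
    case True
    \<comment> \<open>Without zeros in \<open>T\<close> the two integrands agree on
      \<open>{a..b}\<close> up to the null set of times outside \<open>T\<close>.\<close>
    have "(set_nn_integral lborel {a..b} c) = (set_nn_integral lborel {a..b} ?h)"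
      by (intro nn_integral_cong_AE, use T(2) in eventually_elim)
        (use True ab01 in \<open>auto simp: Z_def split: split_indicator\<close>)
    then show ?thesis using inc ab by fastforce
  next
    case False
    have bdd: "bdd_below Z" "bdd_above Z" by (auto simp: Z_def bdd_below_def bdd_above_def)
    define l r where "l = Inf Z" and "r = Sup Z"
    have "l \<le> r" unfolding l_def r_def using False bdd by (metis cInf_lower cSup_upper ex_in_conv order_trans)
    have "l \<in> closure Z" "r \<in> closure Z"
      unfolding l_def r_def using closure_contains_Inf closure_contains_Sup False bdd by auto
    then obtain x y where x: "\<And>n. x n \<in> Z" "x \<longlonglongrightarrow> l" and y: "\<And>n. y n \<in> Z" "y \<longlonglongrightarrow> r"
      by (auto simp: closure_sequential)
    have Z: "z \<in> T" "a \<le> z" "z \<le> b" "w z = 0" if "z \<in> Z" for z using that by (auto simp: Z_def)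
    have alb: "a \<le> l" "r \<le> b" unfolding l_def r_def 
      using False Z by (auto intro!: cInf_greatest cSup_least)
    have "ennreal \<bar>w a\<bar> \<le> (set_nn_integral lborel {a..l} c)"
    proof (rule Lim_bounded2)
      show "(\<lambda>n. \<integral>\<^sup>+r\<in>{a..x n}. c r \<partial>lborel) \<longlonglongrightarrow> (set_nn_integral lborel {a..l} c)"
        by (rule tendsto_set_nn_integral_Icc[OF c fin tendsto_const _ x(2)])
          (use ab01 Z x(1) order_trans in \<open>blast+\<close>)
      show "\<forall>n\<ge>0. ennreal \<bar>w a\<bar> \<le> (set_nn_integral lborel {a..x n} c)"
        using inc[OF ab(1) Z(1)[OF x(1)] Z(2)[OF x(1)]] Z(4)[OF x(1)] by (auto simp: dist_real_def)
    qed
    moreover have "ennreal \<bar>w b\<bar> \<le> (set_nn_integral lborel {r..b} c)"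
    proof (rule Lim_bounded2)
      show "(\<lambda>n. \<integral>\<^sup>+r\<in>{y n..b}. c r \<partial>lborel) \<longlonglongrightarrow> (set_nn_integral lborel {r..b} c)"
        by (rule tendsto_set_nn_integral_Icc[OF c fin y(2) _ tendsto_const])
          (use ab01 Z y(1) order_trans in \<open>blast+\<close>)
      show "\<forall>n\<ge>0. ennreal \<bar>w b\<bar> \<le> (set_nn_integral lborel {y n..b} c)"
        using inc[OF Z(1)[OF y(1)] ab(2) Z(3)[OF y(1)]] Z(4)[OF y(1)] by (auto simp: dist_real_def)
    qed
    ultimately have "ennreal \<bar>w a\<bar> + ennreal \<bar>w b\<bar> \<le> (set_nn_integral lborel {a..l} c) + (set_nn_integral lborel {r..b} c)"
      by (rule add_mono)
    moreover have "ennreal (dist (w a) (w b)) \<le> ennreal \<bar>w a\<bar> + ennreal \<bar>w b\<bar>"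
      by (simp add: dist_real_def flip: ennreal_plus)
    moreover have "(set_nn_integral lborel {a..l} c) + (set_nn_integral lborel {r..b} c)
        = (\<integral>\<^sup>+x. c x * indicator {a..l} x + c x * indicator {r..b} x \<partial>lborel)"
      by (rule nn_integral_add[symmetric]) auto
    moreover have "\<dots> \<le> (set_nn_integral lborel {a..b} ?h)"
    proof (rule nn_integral_mono_AE)
      \<comment> \<open>Almost every zero in \<open>{a..b}\<close> lies in \<open>Z\<close>, hence
        between \<open>l\<close> and \<open>r\<close>, where the left side vanishes except at these
        two points.\<close>
      show "AE x in lborel. c x * indicator {a..l} x + c x * indicator {r..b} x \<le> ?h x * indicator {a..b} x"
        using T(2) AE_lborel_singleton[of l] AE_lborel_singleton[of r]
      proof eventually_elim
        case (elim t)
        show ?case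
        proof (cases "t \<in> {a..b}")
          case True
          then have "t \<in> T" using elim ab01 by auto
          show ?thesis
          proof (cases "w t = 0")
            case True
            then have "t \<in> Z" using \<open>t \<in> T\<close> \<open>t \<in> {a..b}\<close> by (auto simp: Z_def)
            then have "l \<le> t" "t \<le> r" unfolding l_def r_def using bdd cInf_lower cSup_upper by auto
            then show ?thesis using elim by (auto split: split_indicator)
          next
            case False
            then show ?thesis using True \<open>l \<le> r\<close> elim by (auto split: split_indicator)
          qed
        next
          case False
          then show ?thesis using alb \<open>l \<le> r\<close> by (auto split: split_indicator)
        qed
      qed
    qed
    ultimately show ?thesis by order
  qed
qed

section \<open>Vitali coverings of sets of times, and chains of short intervals\<close>

lemma Vitali_intervals:
  fixes E :: "real set" and P :: "real \<Rightarrow> real \<Rightarrow> bool"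
  assumes U: "open U" "E \<subseteq> U"
    and P: "\<And>t \<delta>. t \<in> E \<Longrightarrow> 0 < \<delta> \<Longrightarrow> \<exists>x y. x < y \<and> t \<in> {x..y} \<and> y - x < \<delta> \<and> P x y"
  obtains C where "countable C" "\<And>x y. (x, y) \<in> C \<Longrightarrow> x < y \<and> P x y \<and> {x..y} \<subseteq> U"
    "disjoint_family_on (\<lambda>(x, y). {x..y}) C" "negligible (E - (\<Union>(x, y)\<in>C. {x..y}))"
proof -
  define K where "K = {(x, y). x < y \<and> P x y \<and> {x..y} \<subseteq> U}"
  define ctr rad where "ctr = (\<lambda>(x, y). (x + y) / 2 :: real)" and "rad = (\<lambda>(x, y). (y - x) / 2 :: real)"
  \<comment> \<open>On the line a closed interval is the closed ball about its midpoint, so the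
    covering theorem for balls applies to pairs of endpoints.\<close>
  have cb: "cball (ctr i) (rad i) = (case i of (x, y) \<Rightarrow> {x..y})" for i
    by (auto simp: cball_eq_atLeastAtMost ctr_def rad_def field_simps split: prod.split)
  obtain C where C: "countable C" "C \<subseteq> K"
     "pairwise (\<lambda>i j. disjnt (cball (ctr i) (rad i)) (cball (ctr j) (rad j))) C"
     "negligible (E - (\<Union>i \<in> C. cball (ctr i) (rad i)))"
  proof (rule Vitali_covering_theorem_cballs[of K rad E ctr])
    show "0 < rad i" if "i \<in> K" for i using that by (auto simp: K_def rad_def)
    fix t and d :: real assume t: "t \<in> E" and d: "0 < d"
    then obtain e where e: "e > 0" "ball t e \<subseteq> U" using U by (meson open_contains_ball subsetD)
    \<comment> \<open>Intervals through \<open>t\<close> that are shorter than \<open>e\<close> stay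
      in \<open>U\<close>; this is why the fineness is lowered to \<open>min d e\<close>.\<close>
    then obtain x y where xy: "x < y" "t \<in> {x..y}" "y - x < min d e" "P x y"
      using P[OF t, of "min d e"] d by auto
    then have "{x..y} \<subseteq> ball t e" by (auto simp: dist_real_def)
    then have "(x, y) \<in> K" using xy e by (auto simp: K_def)
    then show "\<exists>i. i \<in> K \<and> t \<in> cball (ctr i) (rad i) \<and> rad i < d"
      using xy by (intro exI[of _ "(x, y)"]) (simp only: cb, auto simp: rad_def)
  qed blast
  show ?thesis
  proof (rule that)
    show "disjoint_family_on (\<lambda>(x, y). {x..y}) C"
      using C(3) unfolding cb by (auto simp: disjoint_family_on_def pairwise_def disjnt_def)
  qed (use C in \<open>auto simp: cb K_def\<close>)
qed

text \<open>Induction on the number of intervals: any chosen \<open>(x, y)\<close> separates the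
  remaining ones into those left of \<open>x\<close> and those right of \<open>y\<close>, and the
  triangle inequality runs through a, x, y, b. The bound \<open>g\<close> is charged only on the
  gaps, so the increments over the intervals can be estimated by other means.\<close>

lemma dist_le_finite_intervals:
  fixes u :: "real \<Rightarrow> 'b::metric_space"
  assumes "finite C" "a \<le> b"
    and B: "increment_bound {a..b} u g" and g[measurable]: "g \<in> borel_measurable borel"
    and C: "\<And>x y. (x, y) \<in> C \<Longrightarrow> x < y \<and> a \<le> x \<and> y \<le> b" "disjoint_family_on (\<lambda>(x, y). {x..y}) C"
  shows "ennreal (dist (u a) (u b)) \<le>
    (\<Sum>(x, y)\<in>C. ennreal (dist (u x) (u y))) + (\<integral>\<^sup>+r\<in>{a<..<b} - (\<Union>(x, y)\<in>C. {x..y}). g r \<partial>lborel)"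
  using assms
proof (induction "card C" arbitrary: C a b rule: less_induct)
  case less
  show ?case
  proof (cases "C = {}")
    case True
    have "ennreal (dist (u a) (u b)) \<le> (set_nn_integral lborel {a..b} g)"
      using less.prems(2,3) by (cases "a = b") (auto simp: increment_bound_def)
    also have "\<dots> = (set_nn_integral lborel {a<..<b} g)"
      by (intro nn_integral_cong_AE, use AE_lborel_singleton[of a] AE_lborel_singleton[of b] in eventually_elim)
        (auto split: split_indicator)
    finally show ?thesis by (simp add: True)
  next
    case False
    then obtain x y where xy: "(x, y) \<in> C" by auto
    define C1 C2 where "C1 = {(x', y') \<in> C. y' < x}" and "C2 = {(x', y') \<in> C. y < x'}"
    have dj: "{x'..y'} \<inter> {x..y} = {}" if "(x', y') \<in> C" "(x', y') \<noteq> (x, y)" for x' y'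
      using less.prems(6) xy that unfolding disjoint_family_on_def by fastforce
    have C_eq: "C = insert (x, y) (C1 \<union> C2)"
    proof (intro equalityI subsetI)
      fix z assume z: "z \<in> C"
      obtain x' y' where zz: "z = (x', y')" by fastforce
      have "y' < x \<or> y < x'" if "z \<noteq> (x, y)"
        using dj[of x' y'] that z less.prems(5)[of x y] less.prems(5)[of x' y'] xy unfolding zz
        by (smt (verit, best) atLeastAtMost_iff disjoint_iff)
      then show "z \<in> insert (x, y) (C1 \<union> C2)" using z by (auto simp: zz C1_def C2_def)
    qed (use xy in \<open>auto simp: C1_def C2_def\<close>)
    have sub: "C1 \<subseteq> C" "C2 \<subseteq> C" by (auto simp: C1_def C2_def)
    have "x < y" "a \<le> x" "y \<le> b" using less.prems(5)[OF xy] by auto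
    then have nin: "(x, y) \<notin> C1" "(x, y) \<notin> C2" "C1 \<inter> C2 = {}"
      using less.prems(5) by (fastforce simp: C1_def C2_def)+
    have fin: "finite C1" "finite C2" using less.prems(1) sub finite_subset by auto
    have card: "card C1 < card C" "card C2 < card C"
      using less.prems(1) sub nin xy by (metis psubsetI psubset_card_mono)+
    let ?I = "\<lambda>C. \<Union>(x, y)\<in>C. {x..y::real}" and ?S = "\<lambda>C. \<Sum>(x, y)\<in>C. ennreal (dist (u x) (u y))"
    define A A1 A2 where "A = {a<..<b} - ?I C" and "A1 = {a<..<x} - ?I C1" and "A2 = {y<..<b} - ?I C2"
    have ms: "?I F \<in> sets borel" if "finite F" for F
      by (rule sets.finite_UN[OF that]) (simp split: prod.split)
    have [measurable]: "A \<in> sets borel" "A1 \<in> sets borel" "A2 \<in> sets borel"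
      unfolding A_def A1_def A2_def using fin less.prems(1) by (auto intro!: sets.Diff ms)
    have IC: "?I C = {x..y} \<union> ?I C1 \<union> ?I C2" unfolding C_eq by auto
    have I1: "r < x" if "r \<in> ?I C1" for r using that by (auto simp: C1_def)
    have I2: "y < r" if "r \<in> ?I C2" for r using that by (auto simp: C2_def)
    have AA: "A1 \<subseteq> A" "A2 \<subseteq> A" "A1 \<inter> A2 = {}"
      unfolding A_def A1_def A2_def IC using I1 I2 \<open>x < y\<close> \<open>a \<le> x\<close> \<open>y \<le> b\<close>
      by (auto simp del: UN_iff) (use I1 I2 in force)+
    have 1: "ennreal (dist (u a) (u x)) \<le> ?S C1 + (set_nn_integral lborel A1 g)"
      unfolding A_def A1_def A2_def
    proof (rule less.hyps[OF card(1) fin(1) \<open>a \<le> x\<close>])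
      show "increment_bound {a..x} u g" using less.prems(3) \<open>x < y\<close> \<open>y \<le> b\<close> by (auto simp: increment_bound_def)
      show "disjoint_family_on (\<lambda>(x, y). {x..y}) C1"
        using less.prems(6) sub by (meson disjoint_family_on_mono)
    qed (use less.prems(5) in \<open>auto simp: C1_def\<close>)
    have 2: "ennreal (dist (u y) (u b)) \<le> ?S C2 + (set_nn_integral lborel A2 g)"
      unfolding A_def A1_def A2_def
    proof (rule less.hyps[OF card(2) fin(2) \<open>y \<le> b\<close>])
      show "increment_bound {y..b} u g" using less.prems(3) \<open>x < y\<close> \<open>a \<le> x\<close> by (auto simp: increment_bound_def)
      show "disjoint_family_on (\<lambda>(x, y). {x..y}) C2"
        using less.prems(6) sub by (meson disjoint_family_on_mono)
    qed (use less.prems(5) in \<open>auto simp: C2_def\<close>)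
    have 3: "(set_nn_integral lborel A1 g) + (set_nn_integral lborel A2 g) \<le> (set_nn_integral lborel A g)"
    proof -
      have "(set_nn_integral lborel A1 g) + (set_nn_integral lborel A2 g)
        = (\<integral>\<^sup>+r. g r * indicator A1 r + g r * indicator A2 r \<partial>lborel)"
        by (rule nn_integral_add[symmetric]) measurable
      also have "\<dots> \<le> (set_nn_integral lborel A g)"
        using AA by (intro nn_integral_mono) (auto split: split_indicator)
      finally show ?thesis .
    qed
    have "dist (u a) (u b) \<le> dist (u a) (u x) + dist (u x) (u y) + dist (u y) (u b)"
      by (meson add_le_cancel_right dist_triangle dist_triangle_le order_trans)
    then have "ennreal (dist (u a) (u b)) \<le> ennreal (dist (u a) (u x)) + ennreal (dist (u x) (u y)) + ennreal (dist (u y) (u b))"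
      by (simp flip: ennreal_plus)
    also have "\<dots> \<le> (?S C1 + (set_nn_integral lborel A1 g)) + ennreal (dist (u x) (u y)) +
        (?S C2 + (set_nn_integral lborel A2 g))"
      using 1 2 by (intro add_mono) auto
    also have "\<dots> = ?S C + ((set_nn_integral lborel A1 g) + (set_nn_integral lborel A2 g))"
    proof -
      have "?S C = ennreal (dist (u x) (u y)) + (?S C1 + ?S C2)"
        unfolding C_eq using fin nin by (subst sum.insert) (auto simp: sum.union_disjoint)
      then show ?thesis by (simp add: ac_simps)
    qed
    also have "\<dots> \<le> ?S C + (set_nn_integral lborel A g)" using 3 by (intro add_left_mono)
    finally show ?thesis by (simp add: A_def)
  qed
qed

subsection \<open>Metric speed of absolutely continuous curves\<close>

text \<open>Only rational times enter the difference quotients, so that the lower and upper speed are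
  jointly measurable in curve and time.\<close>

definition near :: "real \<Rightarrow> nat \<Rightarrow> real set" where
  "near t n = {s \<in> \<rat> \<inter> {0..1}. 0 < \<bar>s - t\<bar> \<and> \<bar>s - t\<bar> < 1 / real (Suc n)}"

definition lower_speed :: "(real \<Rightarrow> 'b::metric_space) \<Rightarrow> real \<Rightarrow> ennreal" where
  "lower_speed u t = (SUP n. INF s\<in>near t n. ennreal (dist (u s) (u t) / \<bar>s - t\<bar>))"

definition upper_speed :: "(real \<Rightarrow> 'b::metric_space) \<Rightarrow> real \<Rightarrow> ennreal" where
  "upper_speed u t = (INF n. SUP s\<in>near t n. ennreal (dist (u s) (u t) / \<bar>s - t\<bar>))"

lemma near_small: 
  assumes "s \<in> near t n" "1 / real (Suc n) < \<delta>"
  shows "\<exists>x y. x < y \<and> t \<in> {x..y} \<and> y - x < \<delta> \<and> y - x = \<bar>s - t\<bar> \<and> dist (u x) (u y) = dist (u s) (u t)"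
  using assms by (intro exI[of _ "min s t"] exI[of _ "max s t"])
    (auto simp: near_def min_def max_def dist_commute)

text \<open>Supplies the fine cover that the Vitali theorem asks for: the lower speed is a supremum
  over the scales \<open>n\<close>, so a strict upper bound holds at every scale and hence for
  arbitrarily short intervals with endpoint \<open>t\<close>.\<close>

lemma lower_speed_less_intervals:
  assumes "lower_speed u t < ennreal \<alpha>" "0 < \<delta>"
  shows "\<exists>x y. x < y \<and> t \<in> {x..y} \<and> y - x < \<delta> \<and> dist (u x) (u y) \<le> \<alpha> * (y - x)"
proof -
  obtain n where n: "1 / real (Suc n) < \<delta>" using nat_approx_posE assms(2) by blast
  have "(INF s\<in>near t n. ennreal (dist (u s) (u t) / \<bar>s - t\<bar>)) < ennreal \<alpha>"
    using assms(1) unfolding lower_speed_def by (meson SUP_upper UNIV_I le_less_trans)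
  then obtain s where s: "s \<in> near t n" "ennreal (dist (u s) (u t) / \<bar>s - t\<bar>) < ennreal \<alpha>"
    by (auto simp: INF_less_iff)
  then have "dist (u s) (u t) / \<bar>s - t\<bar> < \<alpha>" by (simp add: ennreal_less_iff)
  then have "dist (u s) (u t) \<le> \<alpha> * \<bar>s - t\<bar>" using s(1) by (auto simp: near_def field_simps)
  then show ?thesis using near_small[OF s(1) n, of u] by metis
qed

lemma upper_speed_greater_intervals:
  assumes "ennreal \<beta> < upper_speed u t" "0 < \<delta>" "0 \<le> \<beta>"
  shows "\<exists>x y. x < y \<and> t \<in> {x..y} \<and> y - x < \<delta> \<and> \<beta> * (y - x) \<le> dist (u x) (u y)"
proof -
  obtain n where n: "1 / real (Suc n) < \<delta>" using nat_approx_posE assms(2) by blast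
  have "ennreal \<beta> < (SUP s\<in>near t n. ennreal (dist (u s) (u t) / \<bar>s - t\<bar>))"
    using assms(1) unfolding upper_speed_def by (meson INF_lower UNIV_I less_le_trans)
  then obtain s where s: "s \<in> near t n" "ennreal \<beta> < ennreal (dist (u s) (u t) / \<bar>s - t\<bar>)"
    by (auto simp: less_SUP_iff)
  then have "\<beta> < dist (u s) (u t) / \<bar>s - t\<bar>" using assms(3) by (simp add: ennreal_less_iff)
  then have "\<beta> * \<bar>s - t\<bar> \<le> dist (u s) (u t)" using s(1) by (auto simp: near_def field_simps)
  then show ?thesis using near_small[OF s(1) n, of u] by metis
qed

lemma AE_mem_of_negligible_diff:
  assumes "negligible (E - A)" "E \<in> sets borel" "A \<in> sets borel"
  shows "AE r in lborel. r \<in> E \<longrightarrow> r \<in> A"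
proof -
  have "E - A \<in> null_sets lborel"
    using assms by (auto simp: negligible_iff_null_sets null_sets_completion_iff)
  then have "AE r in lborel. r \<notin> E - A" by (rule AE_not_in)
  then show ?thesis by eventually_elim auto
qed

text \<open>Vitali intervals inside an open set \<open>U\<close> slightly larger than
  \<open>F\<close> have increments at most \<alpha> times their length, so in total at most \<alpha>
  times the measure of \<open>U\<close>, while \<open>g\<close> is charged only outside them.
  Exhausting the countable family and shrinking \<open>U\<close> replaces \<open>g\<close> by
  \<alpha> on \<open>E\<close>.\<close>

lemma increment_bound_lower_speed_step:
  fixes u :: "real \<Rightarrow> 'b::metric_space"
  assumes B: "increment_bound {0..1} u g" and g[measurable]: "g \<in> borel_measurable borel"
    and fin: "(set_nn_integral lborel {0..1} g) < \<infinity>"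
    and E[measurable]: "E \<in> sets borel" and \<alpha>: "0 \<le> \<alpha>"
    and E_less: "\<And>t. t \<in> E \<Longrightarrow> lower_speed u t < ennreal \<alpha>"
  shows "increment_bound {0..1} u (\<lambda>r. if r \<in> E then ennreal \<alpha> else g r)"
  unfolding increment_bound_def
proof (intro ballI impI)
  fix a b :: real assume ab: "a \<in> {0..1}" "b \<in> {0..1}" "a < b"
  let ?R = "\<lambda>S. set_nn_integral lborel ({a<..<b} - S) g"
  define F where "F = E \<inter> {a<..<b}"
  have F[measurable]: "F \<in> sets borel" by (simp add: F_def)
  have est: "ennreal (dist (u a) (u b)) \<le>
    ennreal \<alpha> * (emeasure lborel F + ennreal e) + ?R F" if e: "0 < e" for e
  proof -
    obtain U' where U': "open U'" "F \<subseteq> U'" "emeasure lborel (U' - F) < e"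
      using outer_regular_lborel[OF F e] by blast
    define U where "U = U' \<inter> {a<..<b}"
    have U: "open U" "F \<subseteq> U" and [measurable]: "U \<in> sets borel" 
      using U' by (auto simp: U_def F_def)
    have "emeasure lborel U \<le> emeasure lborel (F \<union> (U' - F))"
      by (rule emeasure_mono) (use U' in \<open>auto simp: U_def\<close>)
    also have "\<dots> \<le> emeasure lborel F + emeasure lborel (U' - F)"
      by (rule emeasure_subadditive) (use U' in auto)
    finally have mU: "emeasure lborel U \<le> emeasure lborel F + ennreal e"
      using U'(3) by (meson add_left_mono less_imp_le order_trans)
    obtain C where C: "countable C" "\<And>x y. (x, y) \<in> C \<Longrightarrow> x < y \<and> dist (u x) (u y) \<le> \<alpha> * (y - x) \<and> {x..y} \<subseteq> U"
      "disjoint_family_on (\<lambda>(x, y). {x..y}) C" "negligible (F - (\<Union>(x, y)\<in>C. {x..y}))"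
    proof (rule Vitali_intervals[OF U, where P="\<lambda>x y. dist (u x) (u y) \<le> \<alpha> * (y - x)"])
      show "\<exists>x y. x < y \<and> t \<in> {x..y} \<and> y - x < \<delta> \<and> dist (u x) (u y) \<le> \<alpha> * (y - x)" 
        if "t \<in> F" "0 < \<delta>" for t \<delta>
        using lower_speed_less_intervals[OF E_less] that by (auto simp: F_def)
    qed blast
    let ?I = "\<lambda>C. \<Union>(x, y)\<in>C. {x..y::real}"
    have msI: "?I C' \<in> sets borel" if "C' \<subseteq> C" for C'
      by (rule sets.countable_UN'') (use C(1) that countable_subset in \<open>auto split: prod.split\<close>)
    have fin_est: "ennreal (dist (u a) (u b)) \<le>
       ennreal \<alpha> * emeasure lborel U + ?R (?I C')"
      if C': "finite C'" "C' \<subseteq> C" for C'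
    proof -
      have "ennreal (dist (u a) (u b)) \<le>
        (\<Sum>(x, y)\<in>C'. ennreal (dist (u x) (u y))) + ?R (?I C')"
      proof (rule dist_le_finite_intervals[OF C'(1) less_imp_le[OF ab(3)] _ g])
        show "increment_bound {a..b} u g" using B ab by (auto simp: increment_bound_def)
        show "disjoint_family_on (\<lambda>(x, y). {x..y}) C'" using C(3) C'(2) by (rule disjoint_family_on_mono[rotated])
        show "x < y \<and> a \<le> x \<and> y \<le> b" if "(x, y) \<in> C'" for x y
        proof -
          have "x < y" "{x..y} \<subseteq> {a<..<b}" using C(2)[of x y] C'(2) that by (auto simp: U_def)
          then have "x < y" "x \<in> {a<..<b}" "y \<in> {a<..<b}"
            by (metis atLeastAtMost_iff less_imp_le order_refl subsetD)+
          then show ?thesis by auto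
        qed
      qed
      moreover have "(\<Sum>(x, y)\<in>C'. ennreal (dist (u x) (u y))) \<le> ennreal \<alpha> * emeasure lborel U"
      proof -
        have "(\<Sum>(x, y)\<in>C'. ennreal (dist (u x) (u y))) \<le> (\<Sum>i\<in>C'. ennreal \<alpha> * emeasure lborel (case i of (x, y) \<Rightarrow> {x..y}))"
        proof (rule sum_mono)
          fix i assume "i \<in> C'"
          then obtain x y where i: "i = (x, y)" "x < y" "dist (u x) (u y) \<le> \<alpha> * (y - x)"
            using C(2) C'(2) by (metis subsetD surj_pair)
          then show "(case i of (x, y) \<Rightarrow> ennreal (dist (u x) (u y))) \<le> ennreal \<alpha> * emeasure lborel (case i of (x, y) \<Rightarrow> {x..y})"
            using \<alpha> by (simp flip: ennreal_mult)
        qed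
        also have "\<dots> = ennreal \<alpha> * emeasure lborel (?I C')"
        proof -
          have "(\<Sum>i\<in>C'. emeasure lborel (case i of (x, y) \<Rightarrow> {x..y})) = emeasure lborel (?I C')"
            by (rule sum_emeasure) (use C'(1) disjoint_family_on_mono[OF C'(2) C(3)] in \<open>auto split: prod.split\<close>)
          then show ?thesis by (simp add: sum_distrib_left[symmetric])
        qed
        also have "\<dots> \<le> ennreal \<alpha> * emeasure lborel U"
        proof (intro mult_left_mono emeasure_mono)
          show "?I C' \<subseteq> U" using C(2) C'(2) by blast
        qed auto
        finally show ?thesis .
      qed
      ultimately show ?thesis by (meson add_right_mono order_trans)
    qed
    \<comment> \<open>The intersection with \<open>C\<close> covers the case of an empty
      \<open>C\<close>, in which \<open>from_nat_into\<close> returns an arbitrary pair.\<close>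
    define Cn where "Cn n = C \<inter> from_nat_into C ` {..<n}" for n
    have Cn: "finite (Cn n)" "Cn n \<subseteq> C" for n by (auto simp: Cn_def)
    have lim: "(\<lambda>n. \<integral>\<^sup>+r\<in>{a<..<b} - ?I (Cn n). g r \<partial>lborel) \<longlonglongrightarrow> ?R (?I C)"
    proof (rule nn_integral_dominated_convergence[where w="\<lambda>r. g r * indicator {0..1} r"])
      show "AE r in lborel. g r * indicator ({a<..<b} - ?I (Cn n)) r \<le> g r * indicator {0..1} r" for n
        using ab by (auto split: split_indicator)
      show "AE r in lborel. (\<lambda>n. g r * indicator ({a<..<b} - ?I (Cn n)) r) \<longlonglongrightarrow> g r * indicator ({a<..<b} - ?I C) r"
      proof (rule AE_I2)
        fix r
        show "(\<lambda>n. g r * indicator ({a<..<b} - ?I (Cn n)) r) \<longlonglongrightarrow> g r * indicator ({a<..<b} - ?I C) r"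
        proof (cases "r \<in> ?I C")
          case True
          then obtain i where i: "i \<in> C" "r \<in> (case i of (x, y) \<Rightarrow> {x..y})" by blast
          then obtain k where k: "i = from_nat_into C k" using C(1) by (metis from_nat_into_surj)
          have "i \<in> Cn n" if "Suc k \<le> n" for n using that i k by (auto simp: Cn_def)
          then have mem: "r \<in> ?I (Cn n)" if "Suc k \<le> n" for n using that i(2) by blast
          have "g r * indicator ({a<..<b} - ?I (Cn n)) r = g r * indicator ({a<..<b} - ?I C) r" if "Suc k \<le> n" for n
            using True mem[OF that] by (simp only: indicator_def Diff_iff not_True_eq_False simp_thms if_False)
          then show ?thesis by (intro tendsto_eventually eventually_sequentiallyI)
        next
          case False
          moreover from False have "r \<notin> ?I (Cn n)" for n using Cn by blast
          ultimately show ?thesis by (simp only: indicator_def Diff_iff) simp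
        qed
      qed
    qed (use fin msI[OF Cn(2)] msI[of C] g in \<open>auto intro!: borel_measurable_times_ennreal borel_measurable_indicator sets.Diff\<close>)
    have "ennreal (dist (u a) (u b)) \<le> ennreal \<alpha> * emeasure lborel U + ?R (?I C)"
      by (rule Lim_bounded2[OF tendsto_add[OF tendsto_const lim], of 0]) (use fin_est Cn in auto)
    also have "\<dots> \<le> ennreal \<alpha> * (emeasure lborel F + ennreal e) + ?R F"
    proof (intro add_mono mult_left_mono mU)
      show "?R (?I C) \<le> ?R F"
        by (intro nn_integral_mono_AE, use AE_mem_of_negligible_diff[OF C(4) F msI[OF order_refl]] in eventually_elim)
          (simp only: indicator_def, auto)
    qed auto
    finally show ?thesis .
  qed
  have finF: "emeasure lborel F < \<infinity>"
    by (rule le_less_trans[OF emeasure_mono[of F "{a<..<b}"]]) (use ab in \<open>auto simp: F_def\<close>)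
  have "ennreal (dist (u a) (u b)) \<le> ennreal \<alpha> * emeasure lborel F + ?R F"
  proof (rule ennreal_le_epsilon)
    fix e :: real assume e: "0 < e"
    \<comment> \<open>Dividing by \<open>\<alpha> + 1\<close> instead of \<open>\<alpha>\<close>
      also covers \<open>\<alpha> = 0\<close>.\<close>
    have "ennreal \<alpha> * ennreal (e / (\<alpha> + 1)) \<le> ennreal e"
      using \<alpha> e by (simp add: field_simps flip: ennreal_mult)
    then have "ennreal \<alpha> * (emeasure lborel F + ennreal (e / (\<alpha> + 1))) \<le> ennreal \<alpha> * emeasure lborel F + ennreal e"
      by (simp add: distrib_left)
    then have "ennreal \<alpha> * (emeasure lborel F + ennreal (e / (\<alpha> + 1))) + ?R F
      \<le> ennreal \<alpha> * emeasure lborel F + ennreal e + ?R F"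
      by (rule add_right_mono)
    moreover have "ennreal (dist (u a) (u b)) \<le>
      ennreal \<alpha> * (emeasure lborel F + ennreal (e / (\<alpha> + 1))) + ?R F"
      by (rule est) (use \<alpha> e in auto)
    ultimately have "ennreal (dist (u a) (u b)) \<le> ennreal \<alpha> * emeasure lborel F + ennreal e + ?R F"
      by order
    then show "ennreal (dist (u a) (u b)) \<le>
      ennreal \<alpha> * emeasure lborel F + ?R F + ennreal e"
      by (simp only: ac_simps)
  qed
  also have "\<dots> = (\<integral>\<^sup>+r. ennreal \<alpha> * indicator F r + g r * indicator ({a<..<b} - F) r \<partial>lborel)"
    by (subst nn_integral_add) (auto simp: nn_integral_cmult_indicator)
  also have "\<dots> \<le> (\<integral>\<^sup>+r\<in>{a..b}. (if r \<in> E then ennreal \<alpha> else g r) \<partial>lborel)"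
    by (intro nn_integral_mono) (auto simp: F_def split: split_indicator)
  finally show "ennreal (dist (u a) (u b)) \<le> (\<integral>\<^sup>+r\<in>{a..b}. (if r \<in> E then ennreal \<alpha> else g r) \<partial>lborel)" .
qed

lemma increment_bound_mono_AE:
  assumes "increment_bound D u g" "D \<subseteq> {0..1}" "AE r in lborel. r \<in> {0..1} \<longrightarrow> g r \<le> h r"
  shows "increment_bound D u h"
  unfolding increment_bound_def
proof (intro ballI impI)
  fix s t assume st: "s \<in> D" "t \<in> D" "s < t"
  then have "ennreal (dist (u s) (u t)) \<le> (set_nn_integral lborel {s..t} g)"
    using assms(1) by (auto simp: increment_bound_def)
  also have "\<dots> \<le> (set_nn_integral lborel {s..t} h)"
    by (intro nn_integral_mono_AE, use assms(3) in eventually_elim)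
      (use st assms(2) in \<open>auto split: split_indicator\<close>)
  finally show "ennreal (dist (u s) (u t)) \<le> (set_nn_integral lborel {s..t} h)" .
qed

text \<open>The bound is lowered through all nonnegative rationals in turn: stage \<open>n\<close>
  puts the value \<open>\<alpha> n\<close> where the lower speed is below it. The infimum of the
  stages lies below both \<open>g\<close> and the lower speed, since a rational strictly between the
  lower speed and the infimum would have been applied at its own stage.\<close>

lemma increment_bound_lower_speed:
  fixes u :: "real \<Rightarrow> 'b::metric_space"
  assumes B: "increment_bound {0..1} u g" and g[measurable]: "g \<in> borel_measurable borel"
    and fin: "(set_nn_integral lborel {0..1} g) < \<infinity>"
    and [measurable]: "lower_speed u \<in> borel_measurable borel"
  shows "increment_bound {0..1} u (\<lambda>r. min (g r) (lower_speed u r))"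
proof -
  define A where "A = {x \<in> range real_of_rat. 0 \<le> x}"
  have A: "countable A" "A \<noteq> {}" by (auto simp: A_def intro!: countable_subset[OF _ countable_rat[unfolded Rats_def]] exI[of _ 0])
  define \<alpha> where "\<alpha> = from_nat_into A"
  have \<alpha>: "0 \<le> \<alpha> n" for n using from_nat_into[OF A(2), of n] by (auto simp: \<alpha>_def A_def)
  \<comment> \<open>The second condition keeps the sequence decreasing, so that \<open>g\<close>
    dominates it.\<close>
  define G where "G = rec_nat g (\<lambda>n h r. if lower_speed u r < ennreal (\<alpha> n) \<and> ennreal (\<alpha> n) \<le> h r then ennreal (\<alpha> n) else h r)"
  have G0: "G 0 = g" and GS: "G (Suc n) = (\<lambda>r. if lower_speed u r < ennreal (\<alpha> n) \<and> ennreal (\<alpha> n) \<le> G n r then ennreal (\<alpha> n) else G n r)" for n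
    by (auto simp: G_def)
  have dec: "G (Suc n) r \<le> G n r" for n r by (auto simp: GS)
  then have dec': "decseq (\<lambda>n. G n r)" for r by (simp add: decseq_SucI)
  have le_g: "G n r \<le> g r" for n r using decseqD[OF dec', of 0 n] by (simp add: G0)
  have finG: "(\<integral>\<^sup>+r\<in>{0..1}. G n r \<partial>lborel) < \<infinity>" for n
    by (rule le_less_trans[OF nn_integral_mono fin]) (use le_g in \<open>auto split: split_indicator\<close>)
  have G: "G n \<in> borel_measurable borel \<and> increment_bound {0..1} u (G n)" for n
  proof (induction n)
    case 0
    then show ?case using B by (simp add: G0)
  next
    case (Suc n)
    then have [measurable]: "G n \<in> borel_measurable borel" by simp
    define E where "E = {r. lower_speed u r < ennreal (\<alpha> n) \<and> ennreal (\<alpha> n) \<le> G n r}"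
    have [measurable]: "E \<in> sets borel" unfolding E_def by measurable
    have "increment_bound {0..1} u (\<lambda>r. if r \<in> E then ennreal (\<alpha> n) else G n r)"
      by (rule increment_bound_lower_speed_step) (use Suc finG \<alpha> in \<open>auto simp: E_def\<close>)
    then show ?case unfolding GS by (auto simp: E_def)
  qed
  have "increment_bound {0..1} u (\<lambda>r. INF n. G n r)"
    by (rule increment_bound_limit[where g=G and w=g])
      (use G le_g fin LIMSEQ_INF[OF dec'] in \<open>auto intro!: borel_measurable_INF\<close>)
  then show ?thesis
  proof (rule increment_bound_mono_AE)
    have "(INF n. G n r) \<le> lower_speed u r" for r
    proof (rule ccontr)
      assume "\<not> ?thesis"
      then obtain q :: rat where q: "lower_speed u r < real_of_rat q" "real_of_rat q < (INF n. G n r)"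
        using ennreal_rat_dense by (metis not_le)
      then have "0 \<le> real_of_rat q" by (metis ennreal_neg le_cases not_less_zero)
      then obtain n where n: "real_of_rat q = \<alpha> n"
        using A unfolding \<alpha>_def by (metis (mono_tags, lifting) A_def from_nat_into_surj mem_Collect_eq rangeI)
      have "(INF n. G n r) \<le> G (Suc n) r" by (rule INF_lower) simp
      also have "\<dots> \<le> ennreal (\<alpha> n)" using q n by (auto simp: GS)
      finally show False using q n by auto
    qed
    moreover have "(INF n. G n r) \<le> g r" for r by (metis G0 INF_lower UNIV_I)
    ultimately show "AE r in lborel. r \<in> {0..1} \<longrightarrow> (INF n. G n r) \<le> min (g r) (lower_speed u r)"
      by auto
  qed simp
qed

text \<open>Let \<open>E\<close> be the set where the bound is below \<alpha> and the upper speed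
  above \<beta>. On Vitali intervals \<beta> times the length is at most the increment, hence at
  most the mass of the measure \<open>M\<close> with density \<open>g\<close>. By outer regularity
  \<beta> |E| \<le> M(E) \<le> \<alpha> |E|, and \<open>E\<close> is null when
  \<open>\<alpha> < \<beta>\<close>.\<close>

lemma upper_speed_le_AE:
  fixes u :: "real \<Rightarrow> 'b::metric_space"
  assumes B: "increment_bound {0..1} u g" and g[measurable]: "g \<in> borel_measurable borel"
    and fin: "(set_nn_integral lborel {0..1} g) < \<infinity>"
    and [measurable]: "upper_speed u \<in> borel_measurable borel"
  shows "AE r in lborel. r \<in> {0<..<1} \<longrightarrow> upper_speed u r \<le> g r"
proof -
  have key: "AE r in lborel. r \<in> {0<..<1} \<longrightarrow> \<not> (g r < ennreal \<alpha> \<and> ennreal \<beta> < upper_speed u r)"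
    if \<alpha>\<beta>: "0 \<le> \<alpha>" "\<alpha> < \<beta>" for \<alpha> \<beta>
  proof -
    define E where "E = {r \<in> {0<..<1}. g r < ennreal \<alpha> \<and> ennreal \<beta> < upper_speed u r}"
    have E[measurable]: "E \<in> sets borel" unfolding E_def by measurable
    \<comment> \<open>Cutting the density off outside [0,1] makes \<open>M\<close> finite, as outer
      regularity requires.\<close>
    define M where "M = density lborel (\<lambda>r. g r * indicator {0..1} r)"
    have sM[simp, measurable_cong]: "sets M = sets borel" by (simp add: M_def)
    have M: "emeasure M A = (\<integral>\<^sup>+r. g r * indicator {0..1} r * indicator A r \<partial>lborel)" if "A \<in> sets borel" for A
      unfolding M_def using that by (subst emeasure_density) auto
    have finM: "emeasure M (space M) \<noteq> \<infinity>" using fin by (simp add: M_def emeasure_density)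
    have "ennreal \<beta> * emeasure lborel E \<le> emeasure M U" if U: "E \<subseteq> U" "open U" for U
    proof -
      define V where "V = U \<inter> {0<..<1}"
      have V: "open V" "E \<subseteq> V" and [measurable]: "V \<in> sets borel" "U \<in> sets borel" using U by (auto simp: V_def E_def)
      obtain C where C: "countable C" "\<And>x y. (x, y) \<in> C \<Longrightarrow> x < y \<and> \<beta> * (y - x) \<le> dist (u x) (u y) \<and> {x..y} \<subseteq> V"
        "disjoint_family_on (\<lambda>(x, y). {x..y}) C" "negligible (E - (\<Union>(x, y)\<in>C. {x..y}))"
      proof (rule Vitali_intervals[OF V, where P="\<lambda>x y. \<beta> * (y - x) \<le> dist (u x) (u y)"])
        show "\<exists>x y. x < y \<and> t \<in> {x..y} \<and> y - x < \<delta> \<and> \<beta> * (y - x) \<le> dist (u x) (u y)" 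
          if "t \<in> E" "0 < \<delta>" for t \<delta>
          using upper_speed_greater_intervals[of \<beta> u t \<delta>] that \<alpha>\<beta> by (auto simp: E_def)
      qed blast
      let ?J = "\<lambda>(x, y). {x..y::real}"
      have J: "?J i \<in> sets borel" for i by (auto split: prod.split)
      have UJ: "(\<Union>i\<in>C. ?J i) \<in> sets borel" by (rule sets.countable_UN''[OF C(1) J])
      have "emeasure lborel E \<le> emeasure lborel (\<Union>i\<in>C. ?J i)"
        by (rule emeasure_mono_AE[OF AE_mem_of_negligible_diff[OF C(4) E UJ]]) (use UJ in simp)
      also have "\<dots> = (\<integral>\<^sup>+i. emeasure lborel (?J i) \<partial>count_space C)"
        by (rule emeasure_UN_countable) (use J C in auto)
      finally have "ennreal \<beta> * emeasure lborel E \<le> ennreal \<beta> * (\<integral>\<^sup>+i. emeasure lborel (?J i) \<partial>count_space C)"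
        by (rule mult_left_mono) simp
      also have "\<dots> = (\<integral>\<^sup>+i. ennreal \<beta> * emeasure lborel (?J i) \<partial>count_space C)"
        by (rule nn_integral_cmult[symmetric]) simp
      also have "\<dots> \<le> (\<integral>\<^sup>+i. emeasure M (?J i) \<partial>count_space C)"
      proof (rule nn_integral_mono)
        fix i assume "i \<in> space (count_space C)"
        then obtain x y where i: "i = (x, y)" "(x, y) \<in> C" by (cases i) auto
        have xy: "x < y" "\<beta> * (y - x) \<le> dist (u x) (u y)" "{x..y} \<subseteq> {0<..<1}"
          using C(2)[OF i(2)] by (auto simp: V_def)
        then have "x \<in> {0<..<1}" "y \<in> {0<..<1}"
          by (metis atLeastAtMost_iff less_imp_le order_refl subsetD)+
        then have x01: "x \<in> {0..1}" "y \<in> {0..1}" by auto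
        have "ennreal \<beta> * emeasure lborel {x..y} = ennreal (\<beta> * (y - x))"
          using xy \<alpha>\<beta> by (simp add: ennreal_mult)
        also have "\<dots> \<le> ennreal (dist (u x) (u y))" using xy by (simp add: ennreal_leI)
        also have "\<dots> \<le> (set_nn_integral lborel {x..y} g)" using B xy x01 by (auto simp: increment_bound_def)
        also have "\<dots> = emeasure M {x..y}"
          unfolding M[OF atLeastAtMost_borel] by (intro nn_integral_cong) (use x01 in \<open>auto split: split_indicator\<close>)
        finally show "ennreal \<beta> * emeasure lborel (?J i) \<le> emeasure M (?J i)" by (simp add: i)
      qed
      also have "\<dots> = emeasure M (\<Union>i\<in>C. ?J i)"
        by (rule emeasure_UN_countable[symmetric]) (use J C in auto)
      also have "\<dots> \<le> emeasure M U"
      proof (rule emeasure_mono)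
        show "(\<Union>i\<in>C. ?J i) \<subseteq> U" using C(2) by (fastforce simp: V_def)
      qed simp
      finally show ?thesis .
    qed
    then have "ennreal \<beta> * emeasure lborel E \<le> (INF U\<in>{U. E \<subseteq> U \<and> open U}. emeasure M U)"
      by (auto intro!: INF_greatest)
    also have "\<dots> = emeasure M E" by (rule outer_regular[OF sM finM E, symmetric])
    also have "\<dots> \<le> (\<integral>\<^sup>+r. ennreal \<alpha> * indicator E r \<partial>lborel)"
      unfolding M[OF E] by (intro nn_integral_mono) (auto simp: E_def less_imp_le split: split_indicator)
    also have "\<dots> = ennreal \<alpha> * emeasure lborel E" by (simp add: nn_integral_cmult_indicator)
    finally have le: "ennreal \<beta> * emeasure lborel E \<le> ennreal \<alpha> * emeasure lborel E" .
    have "emeasure lborel E \<le> emeasure lborel {0<..<1::real}" by (rule emeasure_mono) (auto simp: E_def)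
    then obtain r where r: "emeasure lborel E = ennreal r" "0 \<le> r"
      by (cases "emeasure lborel E") (auto simp: top_unique)
    then have "\<beta> * r \<le> \<alpha> * r" using le \<alpha>\<beta> by (simp flip: ennreal_mult)
    then have "r = 0" using r \<alpha>\<beta> by (metis leD mult_right_le_imp_le order_le_less)
    then have "E \<in> null_sets lborel" using r by (auto simp: null_sets_def)
    then have "AE r in lborel. r \<notin> E" by (rule AE_not_in)
    then show ?thesis by eventually_elim (auto simp: E_def)
  qed
  have "AE r in lborel. \<forall>a b::rat. 0 \<le> a \<longrightarrow> a < b \<longrightarrow> r \<in> {0<..<1} \<longrightarrow>
      \<not> (g r < ennreal (of_rat a) \<and> ennreal (of_rat b) < upper_speed u r)"
    unfolding AE_all_countable by (intro allI) (use key in \<open>auto simp: of_rat_less\<close>)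
  then show ?thesis
  proof eventually_elim
    case (elim r)
    show ?case
    proof (rule impI, rule ccontr)
      assume r: "r \<in> {0<..<1}" "\<not> upper_speed u r \<le> g r"
      then obtain b :: rat where b: "g r < real_of_rat b" "real_of_rat b < upper_speed u r"
        using ennreal_rat_dense by (metis not_le)
      \<comment> \<open>A second rational separates \<open>g r\<close> from \<open>b\<close>,
        because \<open>key\<close> needs two distinct levels.\<close>
      then obtain a :: rat where a: "g r < real_of_rat a" "ennreal (real_of_rat a) < real_of_rat b"
        using ennreal_rat_dense by blast
      have "0 < a" using a(1) by (metis ennreal_neg not_le not_less_zero zero_less_of_rat_iff)
      then have "a < b" using a(2) by (simp add: ennreal_less_iff of_rat_less)
      then show False using elim[rule_format, of a b] r a b \<open>0 < a\<close> by auto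
    qed
  qed
qed

text \<open>The index set \<open>near\<close> moves with the time. Moving its condition into the
  values leaves an infimum over a fixed countable set, which preserves measurability.\<close>

lemma INF_Collect_eq_If:
  fixes Q :: "'s \<Rightarrow> 'c::complete_lattice"
  shows "(INF s\<in>{s \<in> A. P s}. Q s) = (INF s\<in>A. if P s then Q s else top)"
proof (intro antisym INF_greatest)
  show "(INF s\<in>{s \<in> A. P s}. Q s) \<le> (if P s then Q s else top)" if "s \<in> A" for s
    using that by (auto intro: INF_lower)
  show "(INF s\<in>A. if P s then Q s else top) \<le> Q s" if "s \<in> {s \<in> A. P s}" for s
    using that by (intro INF_lower2[of s]) auto
qed

lemma SUP_Collect_eq_If:
  fixes Q :: "'s \<Rightarrow> 'c::complete_lattice"
  shows "(SUP s\<in>{s \<in> A. P s}. Q s) = (SUP s\<in>A. if P s then Q s else bot)"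
proof (intro antisym SUP_least)
  show "(if P s then Q s else bot) \<le> (SUP s\<in>{s \<in> A. P s}. Q s)" if "s \<in> A" for s
    using that by (auto intro: SUP_upper)
  show "Q s \<le> (SUP s\<in>A. if P s then Q s else bot)" if "s \<in> {s \<in> A. P s}" for s
    using that by (intro SUP_upper2[of s]) auto
qed

text \<open>Curve and time both depend on a parameter, which covers a single curve with running time
  as well as the product of the curve space with the line.\<close>

lemma measurable_speed:
  fixes U :: "'n \<Rightarrow> real \<Rightarrow> 'b::{metric_space, second_countable_topology}"
  assumes [measurable]: "\<And>s. s \<in> \<rat> \<inter> {0..1} \<Longrightarrow> (\<lambda>x. U x s) \<in> borel_measurable N"
    "(\<lambda>x. U x (T x)) \<in> borel_measurable N" "T \<in> borel_measurable N"
  shows measurable_lower_speed: "(\<lambda>x. lower_speed (U x) (T x)) \<in> borel_measurable N"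
    and measurable_upper_speed: "(\<lambda>x. upper_speed (U x) (T x)) \<in> borel_measurable N"
proof -
  define Q where "Q x s = ennreal (dist (U x s) (U x (T x)) / \<bar>s - T x\<bar>)" for x s
  define P where "P x s n \<longleftrightarrow> 0 < \<bar>s - T x\<bar> \<and> \<bar>s - T x\<bar> < 1 / real (Suc n)" for x s n
  have [measurable]: "(\<lambda>x. if P x s n then Q x s else c) \<in> borel_measurable N" if "s \<in> \<rat> \<inter> {0..1}" for s n c
    unfolding P_def Q_def using that by measurable
  have cnt: "countable (\<rat> \<inter> {0..1::real})" by (intro countable_Int1 countable_rat)
  have near: "near (T x) n = {s \<in> \<rat> \<inter> {0..1}. P x s n}" for x n by (auto simp: near_def P_def)
  have L: "lower_speed (U x) (T x) = (SUP n. INF s\<in>\<rat> \<inter> {0..1}. if P x s n then Q x s else top)" for x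
    unfolding lower_speed_def near INF_Collect_eq_If Q_def ..
  show "(\<lambda>x. lower_speed (U x) (T x)) \<in> borel_measurable N"
    unfolding L by (intro borel_measurable_SUP borel_measurable_INF cnt) auto
  have U: "upper_speed (U x) (T x) = (INF n. SUP s\<in>\<rat> \<inter> {0..1}. if P x s n then Q x s else bot)" for x
    unfolding upper_speed_def near SUP_Collect_eq_If Q_def ..
  show "(\<lambda>x. upper_speed (U x) (T x)) \<in> borel_measurable N"
    unfolding U by (intro borel_measurable_SUP borel_measurable_INF cnt) auto
qed

lemma near_mono: "n \<le> k \<Longrightarrow> near t k \<subseteq> near t n"
  by (force simp: near_def intro: less_le_trans[OF _ frac_le])

text \<open>Bridge from rational to real times: every time close to \<open>t\<close> is a limit of
  rational ones at which the quotients are controlled.\<close>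

lemma near_closure:
  assumes s: "s \<in> {0..1}" "s \<noteq> t" "\<bar>s - t\<bar> < 1 / real (Suc n)"
  obtains x where "\<And>k. x k \<in> near t n" "x \<longlonglongrightarrow> s"
proof -
  define V where "V = {r. 0 < \<bar>r - t\<bar> \<and> \<bar>r - t\<bar> < 1 / real (Suc n)}"
  have "V = ball t (1 / real (Suc n)) - {t}" by (auto simp: V_def dist_real_def abs_minus_commute)
  then have "open V" by (simp add: open_delete)
  moreover have "s \<in> V" using s by (simp add: V_def)
  ultimately have V: "open V" "s \<in> V" .
  have "\<exists>r\<in>near t n. dist r s < e" if "e > 0" for e
  proof -
    obtain d where d: "d > 0" "ball s d \<subseteq> V" using V by (meson open_contains_ball)
    define d' where "d' = min d (min e 1)"
    have d': "0 < d'" "d' \<le> d" "d' \<le> e" "d' \<le> 1" using d that by (auto simp: d'_def)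
    have "\<exists>r\<in>\<rat>. max 0 (s - d') < r \<and> r < min 1 (s + d')"
      by (rule Rats_dense_in_real) (use s d' in auto)
    then obtain r where r: "r \<in> \<rat>" "max 0 (s - d') < r" "r < min 1 (s + d')" by auto
    then have "r \<in> ball s d" "dist r s < e" using d' by (auto simp: dist_real_def)
    moreover from this have "r \<in> V" using d(2) by blast
    then have "r \<in> near t n" using r by (simp add: near_def V_def)
    ultimately show ?thesis by blast
  qed
  then have "s \<in> closure (near t n)" by (simp add: closure_approachable)
  then show ?thesis using that by (auto simp: closure_sequential)
qed

lemma near_nonempty:
  assumes "t \<in> {0..1}" shows "near t n \<noteq> {}"
proof -
  define c where "c = 1 / (2 * real (Suc n))"
  have c: "0 < c" "c \<le> 1 / 2" "c < 1 / real (Suc n)"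
    by (auto simp: c_def field_simps)
  define s where "s = (if t \<le> 1/2 then t + c else t - c)"
  have "s \<in> {0..1}" "s \<noteq> t" "\<bar>s - t\<bar> < 1 / real (Suc n)"
    using assms c by (auto simp: s_def)
  from near_closure[OF this] show ?thesis by (metis empty_iff)
qed

lemma lower_speed_le_upper_speed:
  assumes "t \<in> {0..1}" shows "lower_speed u t \<le> upper_speed u t"
  unfolding lower_speed_def upper_speed_def
proof (intro SUP_least INF_greatest)
  fix n k
  obtain s where s: "s \<in> near t (max n k)" using near_nonempty[OF assms] by blast
  then have "s \<in> near t n" "s \<in> near t k" using near_mono[of n "max n k"] near_mono[of k "max n k"] by auto
  then show "(INF s\<in>near t n. ennreal (dist (u s) (u t) / \<bar>s - t\<bar>)) \<le> (SUP s\<in>near t k. ennreal (dist (u s) (u t) / \<bar>s - t\<bar>))"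
    by (meson INF_lower SUP_upper order_trans)
qed

lemma speed_eq_if_tendsto:
  fixes u :: "real \<Rightarrow> 'b::metric_space"
  assumes t: "t \<in> {0..1}"
    and lim: "((\<lambda>s. dist (u s) (u t) / \<bar>s - t\<bar>) \<longlongrightarrow> l) (at t within {0..1})"
  shows "0 \<le> l" "lower_speed u t = ennreal l" "upper_speed u t = ennreal l"
proof -
  let ?Q = "\<lambda>s. dist (u s) (u t) / \<bar>s - t\<bar>"
  have nt: "at t within {0..1} \<noteq> bot" using t by (simp add: at_within_Icc_at trivial_limit_within islimpt_Icc)
  show l: "0 \<le> l" by (rule tendsto_lowerbound[OF lim _ nt]) (auto simp: eventually_at_filter)
  have ev: "\<exists>n. \<forall>s\<in>near t n. \<bar>?Q s - l\<bar> \<le> e" if "e > 0" for e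
  proof -
    have "\<forall>\<^sub>F s in at t within {0..1}. dist (?Q s) l < e" using lim that by (rule tendstoD)
    then obtain d where d: "d > 0" "\<And>s. s \<in> {0..1} \<Longrightarrow> s \<noteq> t \<Longrightarrow> dist s t < d \<Longrightarrow> dist (?Q s) l < e"
      by (auto simp: eventually_at)
    obtain n where n: "1 / real (Suc n) < d" using nat_approx_posE d(1) by blast
    have "\<bar>?Q s - l\<bar> \<le> e" if "s \<in> near t n" for s
      using d(2)[of s] that n by (auto simp: near_def dist_real_def)
    then show ?thesis by blast
  qed
  have up: "upper_speed u t \<le> ennreal l"
  proof (rule ennreal_le_epsilon)
    fix e :: real assume e: "0 < e"
    obtain n where n: "\<forall>s\<in>near t n. \<bar>?Q s - l\<bar> \<le> e" using ev[OF e] by blast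
    have "upper_speed u t \<le> (SUP s\<in>near t n. ennreal (?Q s))" unfolding upper_speed_def by (rule INF_lower) simp
    also have "\<dots> \<le> ennreal (l + e)"
      using n by (intro SUP_least ennreal_leI) (auto simp: abs_le_iff)
    finally show "upper_speed u t \<le> ennreal l + ennreal e" using e l by simp
  qed
  have lo: "ennreal l \<le> lower_speed u t"
  proof (rule ennreal_le_epsilon)
    fix e :: real assume e: "0 < e"
    obtain n where n: "\<forall>s\<in>near t n. \<bar>?Q s - l\<bar> \<le> e" using ev[OF e] by blast
    have "ennreal (l - e) \<le> (INF s\<in>near t n. ennreal (?Q s))"
      using n by (intro INF_greatest ennreal_leI) (auto simp: abs_le_iff)
    also have "\<dots> \<le> lower_speed u t" unfolding lower_speed_def by (rule SUP_upper) simp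
    finally have "ennreal (l - e) + ennreal e \<le> lower_speed u t + ennreal e" by (rule add_right_mono)
    moreover have "ennreal l \<le> ennreal (l - e) + ennreal e"
      using e l by (cases "l - e \<ge> 0") (auto simp: ennreal_neg ennreal_leI simp flip: ennreal_plus)
    ultimately show "ennreal l \<le> lower_speed u t + ennreal e" by (rule order_trans[rotated])
  qed
  show "lower_speed u t = ennreal l" "upper_speed u t = ennreal l"
    using lower_speed_le_upper_speed[OF t, of u] up lo by auto
qed

text \<open>Equality of lower and upper speed controls the quotients at rational times only;
  continuity of \<open>u\<close> extends the two bounds to all nearby times and so gives the full
  limit.\<close>

lemma tendsto_if_speed_eq:
  fixes u :: "real \<Rightarrow> 'b::metric_space"
  assumes t: "t \<in> {0..1}" and u: "continuous_on {0..1} u"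
    and eq: "lower_speed u t = ennreal l" "upper_speed u t = ennreal l" "0 \<le> l"
  shows "((\<lambda>s. dist (u s) (u t) / \<bar>s - t\<bar>) \<longlongrightarrow> l) (at t within {0..1})"
proof (rule tendstoI)
  let ?Q = "\<lambda>s. dist (u s) (u t) / \<bar>s - t\<bar>"
  fix e :: real assume e: "0 < e"
  define e' where "e' = e / 2"
  have e': "0 < e'" "e' < e" using e by (auto simp: e'_def)
  have "upper_speed u t < ennreal (l + e')" using eq e' by (simp add: ennreal_less_iff)
  then obtain n where n: "(SUP s\<in>near t n. ennreal (?Q s)) < ennreal (l + e')"
    by (auto simp: upper_speed_def INF_less_iff)
  have Qn: "?Q s \<le> l + e'" if "s \<in> near t n" for s
  proof -
    have "ennreal (?Q s) < ennreal (l + e')" using n that by (meson SUP_upper le_less_trans)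
    then show ?thesis by (simp add: ennreal_less_iff)
  qed
  obtain k where Qk: "\<And>s. s \<in> near t k \<Longrightarrow> l - e' \<le> ?Q s"
  \<comment> \<open>For negative \<open>l - e'\<close> the embedding into \<open>ennreal\<close> is
    0 and a strict comparison with the lower speed could fail; the bound is trivial then, as the
    quotients are nonnegative.\<close>
  proof (cases "l - e' < 0")
    case True
    have "l - e' \<le> ?Q s" for s using True by (meson divide_nonneg_nonneg abs_ge_zero zero_le_dist less_imp_le order_trans)
    then show ?thesis using that by blast
  next
    case False
    then have "ennreal (l - e') < lower_speed u t" using eq e' by (simp add: ennreal_less_iff)
    then obtain k where k: "ennreal (l - e') < (INF s\<in>near t k. ennreal (?Q s))"
      by (auto simp: lower_speed_def less_SUP_iff)
    have "l - e' \<le> ?Q s" if "s \<in> near t k" for s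
    proof -
      have "ennreal (l - e') < ennreal (?Q s)" using k that by (meson INF_lower less_le_trans)
      then show ?thesis using False by (simp add: ennreal_less_iff)
    qed
    then show ?thesis using that by blast
  qed
  define N where "N = max n k"
  have QN: "l - e' \<le> ?Q s \<and> ?Q s \<le> l + e'" if "s \<in> near t N" for s
    using that near_mono[of n N t] near_mono[of k N t] Qn Qk by (auto simp: N_def)
  have "dist (?Q s) l < e" if s: "s \<in> {0..1}" "s \<noteq> t" "dist s t < 1 / real (Suc N)" for s
  proof -
    have "\<bar>s - t\<bar> < 1 / real (Suc N)" using s(3) by (simp add: dist_real_def)
    then obtain x where x: "\<And>k. x k \<in> near t N" "x \<longlonglongrightarrow> s" using near_closure[OF s(1,2)] by blast
    have "(\<lambda>k. u (x k)) \<longlonglongrightarrow> u s"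
      by (rule continuous_on_tendsto_compose[OF u x(2) s(1)]) (use x(1) in \<open>auto simp: near_def\<close>)
    then have "(\<lambda>k. ?Q (x k)) \<longlonglongrightarrow> ?Q s"
      using s(2) by (intro tendsto_intros x) auto
    then have "l - e' \<le> ?Q s" "?Q s \<le> l + e'"
      using QN[OF x(1)] by (auto intro: Lim_bounded Lim_bounded2)
    then show ?thesis using e' by (auto simp: dist_real_def abs_less_iff)
  qed
  then show "\<forall>\<^sub>F s in at t within {0..1}. dist (?Q s) l < e"
    unfolding eventually_at by (intro exI[of _ "1 / real (Suc N)"]) auto
qed

lemma metric_speed_eqI:
  assumes t: "t \<in> {0..1}"
    and l: "((\<lambda>s. dist (u s) (u t) / \<bar>s - t\<bar>) \<longlongrightarrow> l) (at t within {0..1})"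
  shows "metric_speed u t = l"
proof -
  have "at t within {0..1} \<noteq> bot" using t by (simp add: trivial_limit_within islimpt_Icc)
  then show ?thesis unfolding metric_speed_def using l tendsto_Lim[OF _ l] by auto
qed

text \<open>Expresses the limit, together with the default value 0 where it fails to exist, through
  countable suprema and infima; measurability of the speed rests on this.\<close>

lemma metric_speed_eq:
  fixes u :: "real \<Rightarrow> 'b::metric_space"
  assumes t: "t \<in> {0..1}" and u: "continuous_on {0..1} u"
  shows "metric_speed u t = (if lower_speed u t = upper_speed u t \<and> upper_speed u t < \<infinity> then enn2real (upper_speed u t) else 0)"
proof (cases "\<exists>l. ((\<lambda>s. dist (u s) (u t) / \<bar>s - t\<bar>) \<longlongrightarrow> l) (at t within {0..1})")
  case True
  then obtain l where l: "((\<lambda>s. dist (u s) (u t) / \<bar>s - t\<bar>) \<longlongrightarrow> l) (at t within {0..1})" by blast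
  then show ?thesis using metric_speed_eqI[OF t l] speed_eq_if_tendsto[OF t l] by simp
next
  case False
  then have "\<not> (lower_speed u t = upper_speed u t \<and> upper_speed u t < \<infinity>)"
    using tendsto_if_speed_eq[OF t u, of "enn2real (upper_speed u t)"] by (auto simp: less_top)
  then show ?thesis using False by (auto simp: metric_speed_def)
qed

lemma mem_curves_iff:
  "\<gamma> \<in> mspace curves \<longleftrightarrow> \<gamma> \<in> extensional {0..1} \<and> continuous_on {0..1} (\<gamma> :: real \<Rightarrow> 'b::metric_space)"
proof -
  have "bounded (\<gamma> ` {0..1})" if "continuous_on {0..1} \<gamma>"
    using compact_continuous_image[OF that] by (simp add: compact_imp_bounded)
  then show ?thesis
    by (auto simp: curves_def)
qed

lemma curve_borel:
  assumes "\<gamma> \<in> mspace curves"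
  shows "(\<gamma> :: real \<Rightarrow> 'b::metric_space) \<in> borel_measurable borel"
proof -
  have "(\<lambda>t. if t \<in> {0..1} then \<gamma> t else undefined) \<in> borel_measurable borel"
    using assms by (intro borel_measurable_continuous_on_if) (auto simp: mem_curves_iff)
  moreover have "(\<lambda>t. if t \<in> {0..1} then \<gamma> t else undefined) = \<gamma>"
    using assms by (auto simp: mem_curves_iff extensional_def)
  ultimately show ?thesis by simp
qed

lemma metric_speed_nonneg: "0 \<le> metric_speed u t" if "t \<in> {0..1}"
proof (cases "\<exists>l. ((\<lambda>s. dist (u s) (u t) / \<bar>s - t\<bar>) \<longlongrightarrow> l) (at t within {0..1})")
  case True
  then obtain l where l: "((\<lambda>s. dist (u s) (u t) / \<bar>s - t\<bar>) \<longlongrightarrow> l) (at t within {0..1})" by blast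
  then show ?thesis using metric_speed_eqI[OF that l] speed_eq_if_tendsto[OF that l] by simp
qed (simp add: metric_speed_def)

text \<open>Stands in for Hoelder's inequality on the unit interval: a finite integral of the q-th
  power gives a finite integral of the function itself.\<close>

lemma ennreal_le_one_plus_powr:
  assumes "1 < q" shows "ennreal x \<le> 1 + ennreal (x powr q)"
proof -
  have "x \<le> 1 + x powr q"
  proof (cases "x \<le> 1")
    case False
    then have "x powr 1 \<le> x powr q" using assms by (intro powr_mono) auto
    then show ?thesis using False by simp
  qed (simp add: add_increasing2)
  then have "ennreal x \<le> ennreal (1 + x powr q)" by (rule ennreal_leI)
  then show ?thesis by simp
qed

text \<open>The given bound \<open>g\<close> is first lowered to its minimum with the lower speed;
  the upper speed is then almost everywhere at most that minimum. So the two speeds agree and are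
  finite at almost every time, the limit exists there, and the metric speed dominates a valid
  bound.\<close>

lemma AC_increment_bound_metric_speed:
  fixes \<gamma> :: "real \<Rightarrow> 'b::{metric_space, second_countable_topology}"
  assumes "\<gamma> \<in> AC q" "1 < q"
  shows "increment_bound {0..1} \<gamma> (\<lambda>r. ennreal (metric_speed \<gamma> r))"
proof -
  from assms(1) obtain g where \<gamma>: "\<gamma> \<in> mspace curves" and [measurable]: "g \<in> borel_measurable borel"
    and g: "\<And>r. 0 \<le> g r" "(\<integral>\<^sup>+r\<in>{0..1}. ennreal (g r powr q) \<partial>lborel) < \<infinity>"
      "\<And>s t. 0 \<le> s \<Longrightarrow> s < t \<Longrightarrow> t \<le> 1 \<Longrightarrow> ennreal (dist (\<gamma> s) (\<gamma> t)) \<le> (\<integral>\<^sup>+r\<in>{s..t}. ennreal (g r) \<partial>lborel)"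
    unfolding AC_def by blast
  have B: "increment_bound {0..1} \<gamma> (\<lambda>r. ennreal (g r))" using g(3) by (auto simp: increment_bound_def)
  have cont: "continuous_on {0..1} \<gamma>" using \<gamma> by (simp add: mem_curves_iff)
  have [measurable]: "\<gamma> \<in> borel_measurable borel" by (rule curve_borel[OF \<gamma>])
  have [measurable]: "lower_speed \<gamma> \<in> borel_measurable borel"
    by (rule measurable_lower_speed[where U="\<lambda>_. \<gamma>" and T="\<lambda>t. t"]) simp_all
  have [measurable]: "upper_speed \<gamma> \<in> borel_measurable borel"
    by (rule measurable_upper_speed[where U="\<lambda>_. \<gamma>" and T="\<lambda>t. t"]) simp_all
  have "(\<integral>\<^sup>+r\<in>{0..1}. ennreal (g r) \<partial>lborel) \<le> (\<integral>\<^sup>+r\<in>{0..1}. (1 + ennreal (g r powr q)) \<partial>lborel)"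
    by (intro nn_integral_mono mult_right_mono ennreal_le_one_plus_powr assms(2)) auto
  also have "\<dots> = 1 + (\<integral>\<^sup>+r\<in>{0..1}. ennreal (g r powr q) \<partial>lborel)"
    by (simp add: distrib_right nn_integral_add)
  also have "\<dots> < \<infinity>" using g(2) by simp
  finally have fin: "(\<integral>\<^sup>+r\<in>{0..1}. ennreal (g r) \<partial>lborel) < \<infinity>" .
  let ?h = "\<lambda>r. min (ennreal (g r)) (lower_speed \<gamma> r)"
  have Bh: "increment_bound {0..1} \<gamma> ?h"
    by (rule increment_bound_lower_speed[OF B _ fin]) auto
  have finh: "(set_nn_integral lborel {0..1} ?h) < \<infinity>"
    by (rule le_less_trans[OF nn_integral_mono fin]) (auto split: split_indicator)
  have "AE r in lborel. r \<in> {0<..<1} \<longrightarrow> upper_speed \<gamma> r \<le> ?h r"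
    by (rule upper_speed_le_AE[OF Bh _ finh]) auto
  then have "AE r in lborel. r \<in> {0..1} \<longrightarrow> ?h r \<le> ennreal (metric_speed \<gamma> r)"
    using AE_lborel_singleton[of 0] AE_lborel_singleton[of 1]
  proof eventually_elim
    case (elim r)
    show ?case
    proof
      assume r: "r \<in> {0..1}"
      then have "r \<in> {0<..<1}" using elim by auto
      then have le: "upper_speed \<gamma> r \<le> ennreal (g r)" "upper_speed \<gamma> r \<le> lower_speed \<gamma> r" using elim by auto
      then have eq: "lower_speed \<gamma> r = upper_speed \<gamma> r" using lower_speed_le_upper_speed[OF r, of \<gamma>] by simp
      have "upper_speed \<gamma> r < \<infinity>" using le(1) by (simp add: le_less_trans)
      then have "ennreal (metric_speed \<gamma> r) = lower_speed \<gamma> r"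
        using eq metric_speed_eq[OF r cont] by simp
      then show "?h r \<le> ennreal (metric_speed \<gamma> r)" by simp
    qed
  qed
  then show ?thesis by (intro increment_bound_mono_AE[OF Bh]) simp_all
qed

subsection \<open>Measurability on the space of curves\<close>

lemma sets_borel_curves: "sets borel_curves = sigma_sets (mspace curves) {U. openin (mtopology_of curves) U}"
  and space_borel_curves: "space borel_curves = mspace curves"
  unfolding borel_curves_def
  by (subst sets_measure_of space_measure_of; force dest: openin_subset)+

lemma openin_sets_borel_curves: "openin (mtopology_of curves) U \<Longrightarrow> U \<in> sets borel_curves"
  by (auto simp: sets_borel_curves)

lemma dist_le_mdist_curves:
  assumes "\<gamma> \<in> mspace curves" "\<gamma>' \<in> mspace curves" "t \<in> {0..1}"
  shows "dist (\<gamma> t) (\<gamma>' t) \<le> mdist curves \<gamma> \<gamma>'"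
  using mdist_cfunspace_imp_mdist_le[of \<gamma> "top_of_set {0..1}" euclidean_metric \<gamma>' _ t] assms
  by (simp add: curves_def)

lemma mdist_curves_le:
  assumes "0 \<le> B" "\<And>t. t \<in> {0..1} \<Longrightarrow> dist (\<gamma> t) (\<gamma>' t) \<le> B"
  shows "mdist curves \<gamma> \<gamma>' \<le> B"
  using mdist_cfunspace_le[of B "top_of_set {0..1}" euclidean_metric \<gamma> \<gamma>'] assms
  by (simp add: curves_def)

lemma measurable_eval:
  assumes t: "t \<in> {0..1}"
  shows "(\<lambda>\<gamma>. \<gamma> t :: 'b::metric_space) \<in> borel_measurable borel_curves"
proof (rule borel_measurableI)
  fix S :: "'b set" assume S: "open S"
  have "Lipschitz_continuous_map curves euclidean_metric (\<lambda>\<gamma>. \<gamma> t :: 'b)"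
    unfolding Lipschitz_continuous_map_def
    by (intro conjI exI[of _ 1]) (auto simp: dist_le_mdist_curves[OF _ _ t])
  then have "continuous_map (mtopology_of curves) euclidean (\<lambda>\<gamma>. \<gamma> t :: 'b)"
    by (metis Lipschitz_continuous_imp_continuous_map mtopology_of_euclidean)
  then have "openin (mtopology_of curves) {\<gamma> \<in> mspace curves. \<gamma> t \<in> S}"
    using S by (auto simp: continuous_map_def)
  then have "{\<gamma> \<in> mspace curves. \<gamma> t \<in> S} \<in> sets borel_curves" by (rule openin_sets_borel_curves)
  moreover have "(\<lambda>\<gamma>. \<gamma> t) -` S \<inter> space borel_curves = {\<gamma> \<in> mspace curves. \<gamma> t \<in> S}"
    by (auto simp: space_borel_curves)
  ultimately show "(\<lambda>\<gamma>. \<gamma> t) -` S \<inter> space borel_curves \<in> sets borel_curves" by simp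
qed

text \<open>Joint measurability in curve and time: the time is approximated by multiples of
  \<open>1 / (n + 1)\<close>, of which there are countably many, and continuity of the curve passes
  to the limit.\<close>

lemma measurable_eval_pair:
  assumes [measurable]: "F \<in> measurable N borel_curves" "T \<in> borel_measurable N"
  shows "(\<lambda>x. F x (T x) :: 'b::metric_space) \<in> borel_measurable N"
proof -
  define clip :: "real \<Rightarrow> real" where "clip t = max 0 (min 1 t)" for t
  define step where "step n x = \<lfloor>real (Suc n) * clip (T x)\<rfloor>" for n x
  have [measurable]: "clip \<in> borel_measurable borel" unfolding clip_def by measurable
  have "(\<lambda>x. F x (clip (real_of_int (step n x) / real (Suc n)))) \<in> borel_measurable N" for n
  proof (rule measurable_compose_countable[where f="\<lambda>i x. F x (clip (real_of_int i / real (Suc n)))"])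
    show "(\<lambda>x. F x (clip (real_of_int i / real (Suc n)))) \<in> borel_measurable N" for i
      by (rule measurable_compose[OF assms(1) measurable_eval]) (simp add: clip_def)
  qed (unfold step_def, measurable)
  then have "(\<lambda>x. F x (clip (T x))) \<in> borel_measurable N"
  proof (rule borel_measurable_LIMSEQ_metric)
    fix x assume x: "x \<in> space N"
    then have Fx: "F x \<in> mspace curves" using measurable_space[OF assms(1)] by (simp add: space_borel_curves)
    then have cont: "continuous_on {0..1} (F x)" by (simp add: mem_curves_iff)
    have "(\<lambda>n. real_of_int (step n x) / real (Suc n)) \<longlonglongrightarrow> clip (T x)"
    proof (rule real_tendsto_sandwich)
      show "\<forall>\<^sub>F n in sequentially. clip (T x) - 1 / real (Suc n) \<le> real_of_int (step n x) / real (Suc n)"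
      proof (intro always_eventually allI)
        fix n
        have "clip (T x) * real (Suc n) - 1 \<le> real_of_int (step n x)"
          unfolding step_def mult.commute[of "clip (T x)"] by linarith
        then have "(clip (T x) * real (Suc n) - 1) / real (Suc n) \<le> real_of_int (step n x) / real (Suc n)"
          by (rule divide_right_mono) simp
        then show "clip (T x) - 1 / real (Suc n) \<le> real_of_int (step n x) / real (Suc n)"
          by (simp add: diff_divide_distrib)
      qed
      show "\<forall>\<^sub>F n in sequentially. real_of_int (step n x) / real (Suc n) \<le> clip (T x)"
      proof (intro always_eventually allI)
        fix n
        have "real_of_int (step n x) \<le> real (Suc n) * clip (T x)" unfolding step_def by linarith
        then show "real_of_int (step n x) / real (Suc n) \<le> clip (T x)"
          by (simp add: field_simps del: of_nat_Suc)
      qed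
      have "(\<lambda>n. 1 / real (Suc n)) \<longlonglongrightarrow> 0"
        using LIMSEQ_inverse_real_of_nat by (simp add: inverse_eq_divide)
      then show "(\<lambda>n. clip (T x) - 1 / real (Suc n)) \<longlonglongrightarrow> clip (T x)"
        using tendsto_diff[OF tendsto_const[of "clip (T x)"]] by fastforce
    qed simp
    then have "(\<lambda>n. clip (real_of_int (step n x) / real (Suc n))) \<longlonglongrightarrow> clip (clip (T x))"
      unfolding clip_def by (intro tendsto_intros)
    then have "(\<lambda>n. clip (real_of_int (step n x) / real (Suc n))) \<longlonglongrightarrow> clip (T x)"
      by (simp add: clip_def)
    then show "(\<lambda>n. F x (clip (real_of_int (step n x) / real (Suc n)))) \<longlonglongrightarrow> F x (clip (T x))"
      by (rule continuous_on_tendsto_compose[OF cont]) (auto simp: clip_def)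
  qed
  \<comment> \<open>Outside [0,1] every curve of the space has the value \<open>undefined\<close>,
    so the clipped evaluation is corrected there by a constant.\<close>
  then have "(\<lambda>x. if T x \<in> {0..1} then F x (clip (T x)) else undefined) \<in> borel_measurable N"
    by measurable
  also have "?this \<longleftrightarrow> ?thesis"
  proof (rule measurable_cong)
    fix x assume "x \<in> space N"
    then have "F x \<in> extensional {0..1}" 
      using measurable_space[OF assms(1)] by (simp add: space_borel_curves mem_curves_iff)
    then show "(if T x \<in> {0..1} then F x (clip (T x)) else undefined) = F x (T x)"
      by (auto simp: clip_def extensional_def)
  qed
  finally show ?thesis .
qed

text \<open>The extension by zero lets time integrals run over the whole line without an indicator
  of [0,1].\<close>

definition speed :: "(real \<Rightarrow> 'a::metric_space) \<Rightarrow> real \<Rightarrow> real" where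
  "speed \<gamma> t = (if t \<in> {0..1} then metric_speed \<gamma> t else 0)"

lemma speed_nonneg: "0 \<le> speed \<gamma> t"
  by (auto simp: speed_def metric_speed_nonneg)

lemma speed_outside: "t \<notin> {0..1} \<Longrightarrow> speed \<gamma> t = 0"
  unfolding speed_def by (rule if_not_P)

lemma measurable_speed_pair [measurable (raw)]:
  fixes F :: "'n \<Rightarrow> real \<Rightarrow> 'b::{metric_space, second_countable_topology}"
  assumes F: "F \<in> measurable N borel_curves" and T[measurable]: "T \<in> borel_measurable N"
  shows "(\<lambda>x. speed (F x) (T x)) \<in> borel_measurable N"
proof -
  have 1: "(\<lambda>x. F x s) \<in> borel_measurable N" for s
    by (rule measurable_eval_pair[OF F]) simp
  have 2: "(\<lambda>x. F x (T x)) \<in> borel_measurable N"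
    by (rule measurable_eval_pair[OF F T])
  have [measurable]: "(\<lambda>x. lower_speed (F x) (T x)) \<in> borel_measurable N"
    by (rule measurable_lower_speed[OF 1 2 T])
  have [measurable]: "(\<lambda>x. upper_speed (F x) (T x)) \<in> borel_measurable N"
    by (rule measurable_upper_speed[OF 1 2 T])
  have "(\<lambda>x. if T x \<in> {0..1} \<and> lower_speed (F x) (T x) = upper_speed (F x) (T x) \<and> upper_speed (F x) (T x) < \<infinity>
      then enn2real (upper_speed (F x) (T x)) else 0) \<in> borel_measurable N"
    by measurable
  also have "?this \<longleftrightarrow> ?thesis"
  proof (rule measurable_cong)
    fix x assume "x \<in> space N"
    then have "continuous_on {0..1} (F x)" 
      using measurable_space[OF F] by (simp add: space_borel_curves mem_curves_iff)
    then show "(if T x \<in> {0..1} \<and> lower_speed (F x) (T x) = upper_speed (F x) (T x) \<and> upper_speed (F x) (T x) < \<infinity>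
      then enn2real (upper_speed (F x) (T x)) else 0) = speed (F x) (T x)"
      by (auto simp: speed_def metric_speed_eq)
  qed
  finally show ?thesis .
qed

subsection \<open>Restriction of curves\<close>

definition restr :: "real \<Rightarrow> real \<Rightarrow> (real \<Rightarrow> 'a) \<Rightarrow> real \<Rightarrow> 'a" where
  "restr s t \<gamma> = restrict (\<lambda>r. \<gamma> (s + (t - s) * r)) {0..1}"

lemma affine_mem:
  assumes "0 \<le> s" "s < t" "t \<le> 1" "r \<in> {0..1}"
  shows "s + (t - s) * r \<in> {0..1::real}"
proof -
  have "0 \<le> (t - s) * r" "(t - s) * r \<le> t - s" using assms by (auto simp: mult_left_le)
  then show ?thesis using assms unfolding atLeastAtMost_iff by linarith
qed

lemma restr_mem_curves:
  assumes "0 \<le> s" "s < t" "t \<le> 1" "\<gamma> \<in> mspace curves"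
  shows "restr s t \<gamma> \<in> mspace (curves :: (real \<Rightarrow> 'b::metric_space) metric)"
proof -
  have "continuous_on {0..1} (\<lambda>r. \<gamma> (s + (t - s) * r))"
    by (rule continuous_on_compose2[of "{0..1}" \<gamma>])
      (use assms affine_mem[OF assms(1-3)] in \<open>auto simp: mem_curves_iff intro!: continuous_intros\<close>)
  then have "continuous_on {0..1} (restr s t \<gamma>)"
    by (rule continuous_on_eq) (simp add: restr_def)
  then show ?thesis by (simp add: mem_curves_iff restr_def)
qed

lemma measurable_restr:
  assumes "0 \<le> s" "s < t" "t \<le> 1"
  shows "restr s t \<in> measurable borel_curves (borel_curves :: (real \<Rightarrow> 'b::metric_space) measure)"
proof -
  have "restr s t \<in> measurable borel_curves (sigma (mspace curves) {U :: (real \<Rightarrow> 'b) set. openin (mtopology_of curves) U})"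
  proof (rule measurable_measure_of)
    show "restr s t \<in> space borel_curves \<rightarrow> mspace (curves :: (real \<Rightarrow> 'b) metric)"
      using restr_mem_curves[OF assms] by (auto simp: space_borel_curves)
    fix U :: "(real \<Rightarrow> 'b) set" assume U: "U \<in> {U. openin (mtopology_of curves) U}"
    have "Lipschitz_continuous_map curves curves (restr s t :: (real \<Rightarrow> 'b) \<Rightarrow> _)"
      unfolding Lipschitz_continuous_map_def
    proof (intro conjI exI[of _ 1] ballI)
      show "restr s t \<in> mspace curves \<rightarrow> mspace (curves :: (real \<Rightarrow> 'b) metric)"
        using restr_mem_curves[OF assms] by auto
      fix x y :: "real \<Rightarrow> 'b" assume xy: "x \<in> mspace curves" "y \<in> mspace curves"
      have "mdist curves (restr s t x) (restr s t y) \<le> mdist curves x y"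
        by (rule mdist_curves_le)
          (use xy dist_le_mdist_curves[OF xy affine_mem[OF assms]] in \<open>auto simp: restr_def\<close>)
      then show "mdist curves (restr s t x) (restr s t y) \<le> 1 * mdist curves x y" by simp
    qed
    then have "continuous_map (mtopology_of curves) (mtopology_of curves) (restr s t :: (real \<Rightarrow> 'b) \<Rightarrow> _)"
      by (rule Lipschitz_continuous_imp_continuous_map)
    then have "openin (mtopology_of curves) {\<gamma> \<in> mspace curves. restr s t \<gamma> \<in> U}"
      using U by (auto simp: continuous_map_def)
    then have "{\<gamma> \<in> mspace curves. restr s t \<gamma> \<in> U} \<in> sets borel_curves" by (rule openin_sets_borel_curves)
    moreover have "restr s t -` U \<inter> space borel_curves = {\<gamma> \<in> mspace curves. restr s t \<gamma> \<in> U}"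
      by (auto simp: space_borel_curves)
    ultimately show "restr s t -` U \<inter> space borel_curves \<in> sets borel_curves" by simp
  qed (force dest: openin_subset)+
  then show ?thesis by (simp only: borel_curves_def)
qed

lemma nn_integral_affine_Icc:
  fixes h :: "real \<Rightarrow> ennreal"
  assumes [measurable]: "h \<in> borel_measurable borel" and c: "0 < c"
  shows "(\<integral>\<^sup>+r\<in>{a..b}. ennreal c * h (s + c * r) \<partial>lborel) = (set_nn_integral lborel {s + c * a..s + c * b} h)"
proof -
  have "(set_nn_integral lborel {s + c * a..s + c * b} h)
     = ennreal c * (\<integral>\<^sup>+r. h (s + c * r) * indicator {s + c * a..s + c * b} (s + c * r) \<partial>lborel)"
    using c by (subst nn_integral_real_affine[where c=c and t=s]) auto
  also have "(\<lambda>r. indicator {s + c * a..s + c * b} (s + c * r) :: ennreal) = indicator {a..b}"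
    using c by (auto split: split_indicator)
  finally show ?thesis by (simp add: nn_integral_cmult[symmetric] mult.assoc fun_eq_iff)
qed

text \<open>Affine change of variables in the difference quotient. It is only an inequality: where
  the restricted curve has no limit its speed is 0 by default. The endpoints are excluded because
  the restricted curve sees a one-sided limit there, which can exist although the speed of
  \<open>\<gamma>\<close> at that time is the default 0.\<close>

lemma speed_restr_le:
  fixes \<gamma> :: "real \<Rightarrow> 'b::metric_space"
  assumes st: "0 \<le> s" "s < t" "t \<le> 1" and r: "r \<in> {0<..<1}"
  shows "speed (restr s t \<gamma>) r \<le> (t - s) * speed \<gamma> (s + (t - s) * r)"
proof -
  let ?c = "t - s" and ?\<gamma> = "restr s t \<gamma>" and ?x = "s + (t - s) * r"
  have c: "0 < ?c" using st by simp
  have "0 < ?c * r" "?c * r < ?c" using r c by auto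
  then have x: "?x \<in> {0<..<1}" using st unfolding greaterThanLessThan_iff by linarith
  show ?thesis
  proof (cases "\<exists>l. ((\<lambda>\<sigma>. dist (?\<gamma> \<sigma>) (?\<gamma> r) / \<bar>\<sigma> - r\<bar>) \<longlongrightarrow> l) (at r within {0..1})")
    case True
    then obtain l where l: "((\<lambda>\<sigma>. dist (?\<gamma> \<sigma>) (?\<gamma> r) / \<bar>\<sigma> - r\<bar>) \<longlongrightarrow> l) (at r within {0..1})" by blast
    have at_r: "at r within {0..1} = at r" using r by (simp add: at_within_Icc_at)
    have at_x: "at ?x within {0..1} = at ?x" using x by (intro at_within_Icc_at) auto
    have "((\<lambda>\<sigma>. dist (?\<gamma> \<sigma>) (?\<gamma> r) / \<bar>\<sigma> - r\<bar> / ?c) \<longlongrightarrow> l / ?c) (at r)"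
      using l c unfolding at_r by (intro tendsto_intros) auto
    moreover have "filterlim (\<lambda>y. (y - s) / ?c) (at r) (at ?x)"
      unfolding filterlim_at
    proof
      have "isCont (\<lambda>y. (y - s) / ?c) ?x" using c by (intro continuous_intros) auto
      then show "((\<lambda>y. (y - s) / ?c) \<longlongrightarrow> r) (at ?x)" using c by (simp add: isCont_def)
      show "\<forall>\<^sub>F y in at ?x. (y - s) / ?c \<in> UNIV \<and> (y - s) / ?c \<noteq> r"
        using c by (auto simp: eventually_at_filter field_simps)
    qed
    ultimately have "((\<lambda>y. dist (?\<gamma> ((y - s) / ?c)) (?\<gamma> r) / \<bar>(y - s) / ?c - r\<bar> / ?c) \<longlongrightarrow> l / ?c) (at ?x)"
      by (rule filterlim_compose)
    moreover have "\<forall>\<^sub>F y in at ?x. dist (?\<gamma> ((y - s) / ?c)) (?\<gamma> r) / \<bar>(y - s) / ?c - r\<bar> / ?c = dist (\<gamma> y) (\<gamma> ?x) / \<bar>y - ?x\<bar>"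
    proof -
      have "?x \<in> {s<..<t}" using \<open>0 < ?c * r\<close> \<open>?c * r < ?c\<close> unfolding greaterThanLessThan_iff by linarith
      then have "\<forall>\<^sub>F y in at ?x. y \<in> {s<..<t}"
        by (intro eventually_at_in_open') auto
      then show ?thesis
      proof eventually_elim
        case (elim y)
        then have "(y - s) / ?c \<in> {0..1}" using c by (auto simp: field_simps)
        moreover have "s + ?c * ((y - s) / ?c) = y" using c by simp
        ultimately have 1: "?\<gamma> ((y - s) / ?c) = \<gamma> y" by (simp add: restr_def)
        have 2: "?\<gamma> r = \<gamma> ?x" using r by (simp add: restr_def)
        have "(y - s) / ?c - r = (y - ?x) / ?c" using c by (simp add: field_simps)
        then have "\<bar>(y - s) / ?c - r\<bar> * ?c = \<bar>y - ?x\<bar>" using c by (simp add: abs_mult)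
        then show ?case unfolding 1 2 by (simp add: divide_divide_eq_left)
      qed
    qed
    ultimately have lim: "((\<lambda>y. dist (\<gamma> y) (\<gamma> ?x) / \<bar>y - ?x\<bar>) \<longlongrightarrow> l / ?c) (at ?x within {0..1})"
      unfolding at_x by (rule Lim_transform_eventually)
    have "metric_speed \<gamma> ?x = l / ?c"
      unfolding metric_speed_def using lim tendsto_Lim[OF _ lim] at_x by auto
    moreover have "metric_speed ?\<gamma> r = l"
      unfolding metric_speed_def using l tendsto_Lim[OF _ l] at_r by auto
    ultimately show ?thesis using r x c by (simp add: speed_def)
  next
    case False
    then have "speed ?\<gamma> r = 0" by (simp add: speed_def metric_speed_def)
    then show ?thesis using c speed_nonneg[of \<gamma> ?x] by simp
  qed
qed

lemma curve_borel_speed [measurable (raw)]: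
  fixes \<gamma> :: "real \<Rightarrow> 'b::{metric_space, second_countable_topology}"
  assumes "\<gamma> \<in> mspace curves" "T \<in> borel_measurable N"
  shows "(\<lambda>x. speed \<gamma> (T x)) \<in> borel_measurable N"
  by (rule measurable_speed_pair) (use assms in \<open>auto simp: space_borel_curves\<close>)

lemma AC_restr:
  fixes \<gamma> :: "real \<Rightarrow> 'b::metric_space"
  assumes st: "0 \<le> s" "s < t" "t \<le> 1" and q: "1 \<le> q" and AC: "\<gamma> \<in> AC q"
  shows "restr s t \<gamma> \<in> AC q"
proof -
  let ?c = "t - s"
  have c: "0 < ?c" "?c \<le> 1" using st by auto
  from AC obtain g where \<gamma>: "\<gamma> \<in> mspace curves" and [measurable]: "g \<in> borel_measurable borel"
    and g: "\<And>r. 0 \<le> g r" "(\<integral>\<^sup>+r\<in>{0..1}. ennreal (g r powr q) \<partial>lborel) < \<infinity>"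
      "\<And>s t. 0 \<le> s \<Longrightarrow> s < t \<Longrightarrow> t \<le> 1 \<Longrightarrow> ennreal (dist (\<gamma> s) (\<gamma> t)) \<le> (\<integral>\<^sup>+r\<in>{s..t}. ennreal (g r) \<partial>lborel)"
    unfolding AC_def by blast
  define h where "h r = ?c * g (s + ?c * r)" for r
  have [measurable]: "h \<in> borel_measurable borel" unfolding h_def by measurable
  have "(\<integral>\<^sup>+r\<in>{0..1}. ennreal (h r powr q) \<partial>lborel) \<le> (\<integral>\<^sup>+r\<in>{0..1}. ennreal ?c * ennreal (g (s + ?c * r) powr q) \<partial>lborel)"
  proof (intro nn_integral_mono mult_right_mono)
    fix r
    \<comment> \<open>As \<open>?c \<le> 1\<close> and \<open>1 \<le> q\<close>, one factor
      \<open>?c\<close> is kept as the Jacobian of the substitution and the rest of the power is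
      dropped.\<close>
    have "?c powr q \<le> ?c powr 1" using c q by (intro powr_mono') auto
    then have "h r powr q \<le> ?c * g (s + ?c * r) powr q"
      unfolding h_def using c g(1) by (simp add: powr_mult mult_right_mono)
    then show "ennreal (h r powr q) \<le> ennreal ?c * ennreal (g (s + ?c * r) powr q)"
      using c by (simp add: ennreal_leI flip: ennreal_mult)
  qed simp
  also have "\<dots> = (\<integral>\<^sup>+r\<in>{s + ?c * 0..s + ?c * 1}. ennreal (g r powr q) \<partial>lborel)"
    using c by (intro nn_integral_affine_Icc) auto
  also have "\<dots> \<le> (\<integral>\<^sup>+r\<in>{0..1}. ennreal (g r powr q) \<partial>lborel)"
    by (rule set_nn_integral_mono_set) (use st in auto)
  also have "\<dots> < \<infinity>" by (rule g(2))
  finally have fin: "(\<integral>\<^sup>+r\<in>{0..1}. ennreal (h r powr q) \<partial>lborel) < \<infinity>" .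
  have inc: "ennreal (dist (restr s t \<gamma> a) (restr s t \<gamma> b)) \<le> (\<integral>\<^sup>+r\<in>{a..b}. ennreal (h r) \<partial>lborel)"
    if ab: "0 \<le> a" "a < b" "b \<le> 1" for a b
  proof -
    have "s + ?c * a < s + ?c * b" using ab c by simp
    then have "ennreal (dist (\<gamma> (s + ?c * a)) (\<gamma> (s + ?c * b))) \<le> (\<integral>\<^sup>+r\<in>{s + ?c * a..s + ?c * b}. ennreal (g r) \<partial>lborel)"
      using affine_mem[OF st, of a] affine_mem[OF st, of b] ab by (intro g(3)) auto
    also have "\<dots> = (\<integral>\<^sup>+r\<in>{a..b}. ennreal ?c * ennreal (g (s + ?c * r)) \<partial>lborel)"
      using c by (intro nn_integral_affine_Icc[symmetric]) auto
    also have "\<dots> = (\<integral>\<^sup>+r\<in>{a..b}. ennreal (h r) \<partial>lborel)"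
      unfolding h_def using c g(1) by (simp add: ennreal_mult)
    finally show ?thesis using ab by (simp add: restr_def)
  qed
  show ?thesis
    unfolding AC_def using restr_mem_curves[OF st \<gamma>] fin inc c g(1)
    by (auto intro!: bexI[of _ h] simp: h_def[abs_def])
qed

lemma energy_eq: 
  "energy q \<gamma> = (if \<gamma> \<in> AC q then \<integral>\<^sup>+t. ennreal (speed \<gamma> t powr q) \<partial>lborel else \<infinity>)"
  unfolding energy_def by (auto simp: speed_def intro!: nn_integral_cong split: split_indicator)

lemma energy_restr_le:
  fixes \<gamma> :: "real \<Rightarrow> 'b::{metric_space, second_countable_topology}"
  assumes st: "0 \<le> s" "s < t" "t \<le> 1" and q: "1 \<le> q"
  shows "energy q (restr s t \<gamma>) \<le> energy q \<gamma>"
proof (cases "\<gamma> \<in> AC q")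
  case True
  let ?c = "t - s"
  have c: "0 < ?c" "?c \<le> 1" using st by auto
  have [measurable]: "\<gamma> \<in> mspace curves" using True by (simp add: AC_def)
  have "(\<integral>\<^sup>+r. ennreal (speed (restr s t \<gamma>) r powr q) \<partial>lborel) \<le> (\<integral>\<^sup>+r\<in>{0..1}. ennreal ?c * ennreal (speed \<gamma> (s + ?c * r) powr q) \<partial>lborel)"
  proof (intro nn_integral_mono_AE, use AE_lborel_singleton[of 0] AE_lborel_singleton[of 1] in eventually_elim)
    case (elim r)
    have "?c powr q \<le> ?c powr 1" using c q by (intro powr_mono') auto
    then have *: "(?c * speed \<gamma> (s + ?c * r)) powr q \<le> ?c * speed \<gamma> (s + ?c * r) powr q"
      using c speed_nonneg[of \<gamma>] by (simp add: powr_mult mult_right_mono)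
    show ?case
    proof (cases "r \<in> {0..1}")
      case True
      then have "r \<in> {0<..<1}" using elim by auto
      then have "speed (restr s t \<gamma>) r powr q \<le> (?c * speed \<gamma> (s + ?c * r)) powr q"
        using speed_nonneg q by (intro powr_mono2 speed_restr_le[OF st]) auto
      then have "ennreal (speed (restr s t \<gamma>) r powr q) \<le> ennreal ?c * ennreal (speed \<gamma> (s + ?c * r) powr q)"
        using * c by (simp add: ennreal_leI flip: ennreal_mult)
      then show ?thesis using True by simp
    next
      case False
      then show ?thesis by (simp add: speed_outside[OF False])
    qed
  qed
  also have "\<dots> = (\<integral>\<^sup>+r\<in>{s + ?c * 0..s + ?c * 1}. ennreal (speed \<gamma> r powr q) \<partial>lborel)"
    using c by (intro nn_integral_affine_Icc) auto
  also have "\<dots> \<le> (\<integral>\<^sup>+r. ennreal (speed \<gamma> r powr q) \<partial>lborel)"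
    by (intro nn_integral_mono) (auto split: split_indicator)
  finally show ?thesis using True AC_restr[OF st q True] by (simp add: energy_eq)
qed (simp add: energy_def)

subsection \<open>Test plans\<close>

text \<open>The energy is not known to be measurable, so integrals of it are estimated through simple
  functions below it.\<close>

lemma nn_integral_distr_le:
  assumes T: "T \<in> measurable M N"
  shows "(\<integral>\<^sup>+y. f y \<partial>distr M N T) \<le> (\<integral>\<^sup>+x. f (T x) \<partial>M)"
  unfolding nn_integral_def[of "distr M N T"]
proof (rule SUP_least, safe)
  fix g assume g: "simple_function (distr M N T) g" "g \<le> f"
  have [measurable]: "g \<in> borel_measurable N" using borel_measurable_simple_function[OF g(1)] by simp
  have "integral\<^sup>S (distr M N T) g = (\<integral>\<^sup>+y. g y \<partial>distr M N T)"
    by (rule nn_integral_eq_simple_integral[OF g(1), symmetric])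
  also have "\<dots> = (\<integral>\<^sup>+x. g (T x) \<partial>M)" by (rule nn_integral_distr[OF T]) simp
  also have "\<dots> \<le> (\<integral>\<^sup>+x. f (T x) \<partial>M)" using g(2) by (intro nn_integral_mono) (auto simp: le_fun_def)
  finally show "integral\<^sup>S (distr M N T) g \<le> (\<integral>\<^sup>+x. f (T x) \<partial>M)" .
qed

lemma nn_integral_uniform_measure_le:
  assumes S: "S \<in> sets M"
  shows "(\<integral>\<^sup>+x. f x \<partial>uniform_measure M S) \<le> (\<integral>\<^sup>+x. f x \<partial>M) / emeasure M S"
  unfolding nn_integral_def[of "uniform_measure M S"]
proof (rule SUP_least, safe)
  fix g assume g: "simple_function (uniform_measure M S) g" "g \<le> f"
  have [measurable]: "g \<in> borel_measurable M" 
    using borel_measurable_simple_function[OF g(1)] by simp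
  have "integral\<^sup>S (uniform_measure M S) g = (\<integral>\<^sup>+y. g y \<partial>uniform_measure M S)"
    by (rule nn_integral_eq_simple_integral[OF g(1), symmetric])
  also have "\<dots> = (\<integral>\<^sup>+x. g x * indicator S x \<partial>M) / emeasure M S" 
    by (rule nn_integral_uniform_measure) (use S in auto)
  also have "\<dots> \<le> (\<integral>\<^sup>+x. f x \<partial>M) / emeasure M S" 
    using g(2) by (intro divide_right_mono_ennreal nn_integral_mono) (auto simp: le_fun_def split: split_indicator)
  finally show "integral\<^sup>S (uniform_measure M S) g \<le> (\<integral>\<^sup>+x. f x \<partial>M) / emeasure M S" .
qed

definition restr_plan :: "real \<Rightarrow> real \<Rightarrow> (real \<Rightarrow> 'a::metric_space) set \<Rightarrow> (real \<Rightarrow> 'a) measure \<Rightarrow> (real \<Rightarrow> 'a) measure" where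
  "restr_plan s t \<Gamma> \<pi> = distr (uniform_measure \<pi> \<Gamma>) borel_curves (restr s t)"

lemma test_plan_restr_plan:
  fixes \<pi> :: "(real \<Rightarrow> 'a::polish_space) measure"
  assumes st: "0 \<le> s" "s < t" "t \<le> 1" and q: "1 \<le> q" and \<pi>: "test_plan m q \<pi>"
    and \<Gamma>: "\<Gamma> \<in> sets \<pi>" "emeasure \<pi> \<Gamma> \<noteq> 0"
  shows "test_plan m q (restr_plan s t \<Gamma> \<pi>)"
proof -
  let ?U = "uniform_measure \<pi> \<Gamma>"
  from \<pi> have s\<pi>[measurable_cong]: "sets \<pi> = sets borel_curves" and one: "emeasure \<pi> (space \<pi>) = 1"
    and E: "(\<integral>\<^sup>+\<gamma>. energy q \<gamma> \<partial>\<pi>) < \<infinity>" by (auto simp: test_plan_def)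
  from \<pi> obtain C where C: "C > 0" "\<And>t A. t \<in> {0..1} \<Longrightarrow> A \<in> sets borel \<Longrightarrow>
    emeasure (distr \<pi> borel (\<lambda>\<gamma>. \<gamma> t)) A \<le> ennreal C * emeasure m A"
    unfolding test_plan_def by blast
  have le1: "emeasure \<pi> \<Gamma> \<le> 1" using emeasure_space[of \<pi> \<Gamma>] one by simp
  then obtain z where z: "emeasure \<pi> \<Gamma> = ennreal z" "0 \<le> z" by (cases "emeasure \<pi> \<Gamma>") (auto simp: top_unique)
  then have z0: "0 < z" using \<Gamma>(2) by (cases "z = 0") auto
  have R[measurable]: "restr s t \<in> measurable borel_curves (borel_curves :: (real \<Rightarrow> 'a) measure)"
    by (rule measurable_restr[OF st])
  have RU[measurable]: "restr s t \<in> measurable ?U (borel_curves :: (real \<Rightarrow> 'a) measure)"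
    by (simp cong: measurable_cong_sets add: s\<pi>)
  have [measurable]: "(\<lambda>\<gamma>. \<gamma> r :: 'a) \<in> borel_measurable borel_curves" if "r \<in> {0..1}" for r
    by (rule measurable_eval[OF that])
  show ?thesis
    unfolding test_plan_def restr_plan_def
  proof (intro conjI)
    have "emeasure (distr ?U borel_curves (restr s t)) (space (distr ?U borel_curves (restr s t))) = emeasure ?U (space ?U)"
      using measurable_space[OF RU] by (subst emeasure_distr[OF RU]) (auto intro!: arg_cong[where f="emeasure ?U"])
    also have "\<dots> = 1" using \<Gamma> z sets.sets_into_space[OF \<Gamma>(1)]
      by (simp add: Int_absorb2 z0 divide_ennreal)
    finally show "emeasure (distr ?U borel_curves (restr s t)) (space (distr ?U borel_curves (restr s t))) = 1" .
    show "\<exists>C>0. \<forall>r\<in>{0..1}. \<forall>A\<in>sets borel.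
       emeasure (distr (distr ?U borel_curves (restr s t)) borel (\<lambda>\<gamma>. \<gamma> r)) A \<le> ennreal C * emeasure m A"
    \<comment> \<open>Conditioning divides the compression constant by the mass \<open>z\<close> of
      \<open>\<Gamma>\<close>; passing to a subinterval only relabels the times.\<close>
    proof (intro exI[of _ "C / z"] conjI ballI)
      show "0 < C / z" using C z0 by simp
      fix r :: real and A :: "'a set" assume r: "r \<in> {0..1}" and A[measurable]: "A \<in> sets borel"
      let ?x = "s + (t - s) * r"
      have x: "?x \<in> {0..1}" by (rule affine_mem[OF st r])
      have ev[measurable]: "(\<lambda>\<gamma>. \<gamma> ?x :: 'a) \<in> borel_measurable \<pi>" 
        using measurable_eval[OF x, where 'b='a] by (simp cong: measurable_cong_sets add: s\<pi>)
      have evr: "(\<lambda>\<gamma>. \<gamma> r :: 'a) \<in> borel_measurable borel_curves" by (rule measurable_eval[OF r])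
      have "emeasure (distr (distr ?U borel_curves (restr s t)) borel (\<lambda>\<gamma>. \<gamma> r)) A
        = emeasure (distr ?U borel (\<lambda>\<gamma>. restr s t \<gamma> r)) A"
        using distr_distr[OF evr RU] by (simp add: comp_def)
      also have "\<dots> = emeasure (distr ?U borel (\<lambda>\<gamma>. \<gamma> ?x)) A"
        using r by (simp add: restr_def)
      also have "\<dots> = emeasure ?U ((\<lambda>\<gamma>. \<gamma> ?x) -` A \<inter> space ?U)"
        by (rule emeasure_distr) auto
      also have "\<dots> = emeasure \<pi> (\<Gamma> \<inter> ((\<lambda>\<gamma>. \<gamma> ?x) -` A \<inter> space \<pi>)) / emeasure \<pi> \<Gamma>"
        using \<Gamma>(1) measurable_sets[OF ev A] by simp
      also have "\<dots> \<le> emeasure \<pi> ((\<lambda>\<gamma>. \<gamma> ?x) -` A \<inter> space \<pi>) / emeasure \<pi> \<Gamma>"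
        by (intro divide_right_mono_ennreal emeasure_mono) (use measurable_sets[OF ev A] in auto)
      also have "\<dots> = emeasure (distr \<pi> borel (\<lambda>\<gamma>. \<gamma> ?x)) A / emeasure \<pi> \<Gamma>"
        by (simp add: emeasure_distr[OF ev A])
      also have "\<dots> \<le> ennreal C * emeasure m A / emeasure \<pi> \<Gamma>"
        by (intro divide_right_mono_ennreal C x A)
      also have "\<dots> = ennreal (C / z) * emeasure m A"
        using z0 C(1) by (simp add: z(1) divide_ennreal_def inverse_ennreal divide_inverse ennreal_mult mult_ac)
      finally show "emeasure (distr (distr ?U borel_curves (restr s t)) borel (\<lambda>\<gamma>. \<gamma> r)) A \<le> ennreal (C / z) * emeasure m A" .
    qed
    have "(\<integral>\<^sup>+\<gamma>. energy q \<gamma> \<partial>distr ?U borel_curves (restr s t)) \<le> (\<integral>\<^sup>+\<gamma>. energy q (restr s t \<gamma>) \<partial>?U)"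
      by (rule nn_integral_distr_le[OF RU])
    also have "\<dots> \<le> (\<integral>\<^sup>+\<gamma>. energy q \<gamma> \<partial>?U)" by (intro nn_integral_mono energy_restr_le st q)
    also have "\<dots> \<le> (\<integral>\<^sup>+\<gamma>. energy q \<gamma> \<partial>\<pi>) / emeasure \<pi> \<Gamma>" by (rule nn_integral_uniform_measure_le[OF \<Gamma>(1)])
    also have "\<dots> < \<infinity>" using E \<Gamma>(2) by (auto simp: ennreal_divide_eq_top_iff less_top[symmetric])
    finally show "(\<integral>\<^sup>+\<gamma>. energy q \<gamma> \<partial>distr ?U borel_curves (restr s t)) < \<infinity>" .
  qed simp
qed

subsection \<open>Localisation of the plan inequality\<close>

abbreviation curve_integral :: "(real \<Rightarrow> 'a::metric_space) \<Rightarrow> real set \<Rightarrow> ('a \<Rightarrow> ennreal) \<Rightarrow> ennreal" where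
  "curve_integral \<gamma> S h \<equiv> \<integral>\<^sup>+r\<in>S. h (\<gamma> r) * ennreal (speed \<gamma> r) \<partial>lborel"

definition plan_integral :: "(real \<Rightarrow> 'a::metric_space) measure \<Rightarrow> ('a \<Rightarrow> ennreal) \<Rightarrow> ennreal" where
  "plan_integral \<pi> h = (\<integral>\<^sup>+\<gamma>. (\<integral>\<^sup>+t. h (\<gamma> t) * ennreal (speed \<gamma> t) \<partial>lborel) \<partial>\<pi>)"

lemma weak_upper_gradient_iff:
  "weak_upper_gradient m p f G \<longleftrightarrow> G \<in> Lp m p \<and> (AE x in m. 0 \<le> G x) \<and>
     (\<forall>\<pi>. test_plan m (conj_exp p) \<pi> \<longrightarrow>
        (\<integral>\<^sup>+\<gamma>. ennreal \<bar>f (\<gamma> 1) - f (\<gamma> 0)\<bar> \<partial>\<pi>) \<le> plan_integral \<pi> (\<lambda>x. ennreal (G x)))"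
proof -
  have "ennreal (G (\<gamma> t) * metric_speed \<gamma> t) * indicator {0..1} t = ennreal (G (\<gamma> t)) * ennreal (speed \<gamma> t)" for \<gamma> t
    by (auto simp: speed_def metric_speed_nonneg ennreal_mult'' split: split_indicator)
  then show ?thesis unfolding weak_upper_gradient_def plan_integral_def by simp
qed

lemma conj_exp_gt_1: "1 < p \<Longrightarrow> 1 < conj_exp p"
  by (simp add: conj_exp_def)

locale test_plan_setting =
  fixes m :: "'a::polish_space measure" and p :: real and \<pi> :: "(real \<Rightarrow> 'a) measure"
  assumes sets_m [measurable_cong]: "sets m = sets borel"
    and p: "1 < p"
    and plan: "test_plan m (conj_exp p) \<pi>"
begin

abbreviation q :: real where "q \<equiv> conj_exp p"

lemma q: "1 < q"
  by (rule conj_exp_gt_1[OF p])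

lemma sets_plan [measurable_cong]: "sets \<pi> = sets borel_curves"
  using plan by (simp add: test_plan_def)

lemma space_plan: "space \<pi> = mspace curves"
  using sets_eq_imp_space_eq[OF sets_plan] by (simp add: space_borel_curves)

lemma finite_plan: "finite_measure \<pi>"
  using plan by (intro finite_measureI) (simp add: test_plan_def)

sublocale finite_measure \<pi>
  by (rule finite_plan)

sublocale pair_sigma_finite \<pi> "lborel :: real measure"
  by unfold_locales

lemma eval_measurable: "t \<in> {0..1} \<Longrightarrow> (\<lambda>\<gamma>. \<gamma> t) \<in> borel_measurable \<pi>"
  using measurable_eval[of t, where 'b='a] by (simp cong: measurable_cong_sets add: sets_plan)

lemma measurable_plan_ident: "(\<lambda>\<gamma>. \<gamma>) \<in> measurable \<pi> borel_curves"
  by (rule measurable_ident_sets[OF sets_plan])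

lemma measurable_fst_plan: "fst \<in> measurable (\<pi> \<Otimes>\<^sub>M (lborel :: real measure)) borel_curves"
  by (rule measurable_compose[OF measurable_fst measurable_plan_ident])

lemma measurable_eval_fst_snd [measurable]: "(\<lambda>x. fst x (snd x)) \<in> borel_measurable (\<pi> \<Otimes>\<^sub>M lborel)"
  by (rule measurable_eval_pair[OF measurable_fst_plan]) simp

lemma measurable_comp_eval:
  assumes "h \<in> borel_measurable borel"
  shows "(\<lambda>x. h (fst x (snd x))) \<in> borel_measurable (\<pi> \<Otimes>\<^sub>M lborel)"
  by (rule measurable_compose[OF measurable_eval_fst_snd assms])

lemma measurable_speed_fst_snd [measurable]: "(\<lambda>x. speed (fst x) (snd x)) \<in> borel_measurable (\<pi> \<Otimes>\<^sub>M lborel)"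
  by (rule measurable_speed_pair[OF measurable_fst_plan]) simp

lemma measurable_inner_integral:
  fixes H :: "(real \<Rightarrow> 'a) \<Rightarrow> real \<Rightarrow> ennreal"
  assumes "(\<lambda>x. H (fst x) (snd x)) \<in> borel_measurable (\<pi> \<Otimes>\<^sub>M lborel)"
  shows "(\<lambda>\<gamma>. \<integral>\<^sup>+t. H \<gamma> t \<partial>lborel) \<in> borel_measurable \<pi>"
  by (rule lborel.borel_measurable_nn_integral) (use assms in \<open>simp add: split_beta'\<close>)

lemma compression:
  "\<exists>C::real. \<forall>t\<in>{0..1}. \<forall>h\<in>borel_measurable borel.
    (\<integral>\<^sup>+\<gamma>. h (\<gamma> t) \<partial>\<pi>) \<le> ennreal C * (\<integral>\<^sup>+x. h x \<partial>m)"
proof -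
  from plan obtain C where C: "C > 0" "\<And>t A. t \<in> {0..1} \<Longrightarrow> A \<in> sets borel \<Longrightarrow>
    emeasure (distr \<pi> borel (\<lambda>\<gamma>. \<gamma> t)) A \<le> ennreal C * emeasure m A"
    unfolding test_plan_def by blast
  show ?thesis
  proof (intro exI ballI)
    fix t :: real and h :: "'a \<Rightarrow> ennreal" assume t: "t \<in> {0..1}" and h[measurable]: "h \<in> borel_measurable borel"
    have "(\<integral>\<^sup>+\<gamma>. h (\<gamma> t) \<partial>\<pi>) = (\<integral>\<^sup>+x. h x \<partial>distr \<pi> borel (\<lambda>\<gamma>. \<gamma> t))"
      by (rule nn_integral_distr[symmetric, OF eval_measurable[OF t]]) simp
    also have "\<dots> \<le> (\<integral>\<^sup>+x. h x \<partial>scale_measure (ennreal C) m)"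
    proof (rule nn_integral_mono_measure)
      show "sets (distr \<pi> borel (\<lambda>\<gamma>. \<gamma> t)) = sets (scale_measure (ennreal C) m)" by (simp add: sets_m)
      then show "distr \<pi> borel (\<lambda>\<gamma>. \<gamma> t) \<le> scale_measure (ennreal C) m"
        using C(2)[OF t] by (subst le_measure) auto
    qed
    also have "\<dots> = ennreal C * (\<integral>\<^sup>+x. h x \<partial>m)" by (rule nn_integral_scale_measure) (simp cong: measurable_cong_sets add: sets_m)
    finally show "(\<integral>\<^sup>+\<gamma>. h (\<gamma> t) \<partial>\<pi>) \<le> ennreal C * (\<integral>\<^sup>+x. h x \<partial>m)" .
  qed
qed

text \<open>By compression a null set of the space is avoided at each fixed time by almost every
  curve; Fubini exchanges curves and times. The null set is enlarged to a Borel one so that the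
  exchange is measurable.\<close>

lemma AE_plan:
  assumes "AE x in m. P x"
  shows "AE \<gamma> in \<pi>. AE t in lborel. t \<in> {0..1} \<longrightarrow> P (\<gamma> t)"
proof -
  obtain N where N: "{x \<in> space m. \<not> P x} \<subseteq> N" "emeasure m N = 0" and [measurable]: "N \<in> sets borel"
    using assms sets_m by (auto elim: AE_E)
  have spm: "space m = UNIV" using sets_eq_imp_space_eq[OF sets_m] by simp
  obtain C :: real where C: "\<forall>t\<in>{0..1}. \<forall>h\<in>borel_measurable borel.
    (\<integral>\<^sup>+\<gamma>. h (\<gamma> t) \<partial>\<pi>) \<le> ennreal C * (\<integral>\<^sup>+x. h x \<partial>m)" using compression ..
  have "AE t in lborel. AE \<gamma> in \<pi>. t \<in> {0..1} \<longrightarrow> \<gamma> t \<notin> N"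
  proof (rule AE_I2)
    fix t :: real
    show "AE \<gamma> in \<pi>. t \<in> {0..1} \<longrightarrow> \<gamma> t \<notin> N"
    proof (cases "t \<in> {0..1}")
      case True
      have "(\<integral>\<^sup>+\<gamma>. indicator N (\<gamma> t) \<partial>\<pi>) \<le> ennreal C * (\<integral>\<^sup>+x. indicator N x \<partial>m)"
        by (rule C[rule_format, OF True]) measurable
      also have "\<dots> = 0" using N(2) by (simp add: sets_m)
      finally have "(\<integral>\<^sup>+\<gamma>. indicator N (\<gamma> t) \<partial>\<pi>) = 0" by simp
      moreover have "(\<lambda>\<gamma>. indicator N (\<gamma> t) :: ennreal) \<in> borel_measurable \<pi>"
        by (rule measurable_compose[OF eval_measurable[OF True]]) simp
      ultimately have "AE \<gamma> in \<pi>. indicator N (\<gamma> t) = (0 :: ennreal)"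
        by (simp only: nn_integral_0_iff_AE)
      then show ?thesis by eventually_elim (auto simp: indicator_eq_0_iff)
    next
      case False
      then show ?thesis by (intro AE_I2) blast
    qed
  qed
  then have "AE \<gamma> in \<pi>. AE t in lborel. t \<in> {0..1} \<longrightarrow> \<gamma> t \<notin> N"
    by (subst AE_commute) measurable
  then show ?thesis
  proof eventually_elim
    case (elim \<gamma>)
    then show ?case by eventually_elim (use N(1) spm in auto)
  qed
qed

lemma speed_integral_finite: "(\<integral>\<^sup>+\<gamma>. (\<integral>\<^sup>+t. ennreal (speed \<gamma> t powr q) \<partial>lborel) \<partial>\<pi>) < \<infinity>"
proof -
  have "(\<integral>\<^sup>+\<gamma>. (\<integral>\<^sup>+t. ennreal (speed \<gamma> t powr q) \<partial>lborel) \<partial>\<pi>) \<le> (\<integral>\<^sup>+\<gamma>. energy q \<gamma> \<partial>\<pi>)"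
    by (intro nn_integral_mono) (auto simp: energy_eq)
  also have "\<dots> < \<infinity>" using plan by (simp add: test_plan_def)
  finally show ?thesis .
qed

text \<open>\<open>AC q\<close> need not be measurable, but the energy is infinite off it, so a measurable set
  containing it has full measure.\<close>

lemma AE_AC:
  assumes P: "\<And>\<gamma>. \<gamma> \<in> AC q \<Longrightarrow> P \<gamma>" and S: "{\<gamma> \<in> space \<pi>. P \<gamma>} \<in> sets \<pi>"
  shows "AE \<gamma> in \<pi>. P \<gamma>"
proof -
  let ?N = "space \<pi> - {\<gamma> \<in> space \<pi>. P \<gamma>}"
  have N: "?N \<in> sets \<pi>" using S by auto
  have "(\<integral>\<^sup>+\<gamma>. \<infinity> * indicator ?N \<gamma> \<partial>\<pi>) \<le> (\<integral>\<^sup>+\<gamma>. energy q \<gamma> \<partial>\<pi>)"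
    using P by (intro nn_integral_mono) (auto simp: energy_def split: split_indicator)
  also have "\<dots> < \<infinity>" using plan by (simp add: test_plan_def)
  finally have "\<infinity> * emeasure \<pi> ?N < \<infinity>" using N by (simp add: nn_integral_cmult_indicator)
  then have "emeasure \<pi> ?N = 0" by (auto simp: ennreal_top_mult split: if_splits)
  then show ?thesis by (intro AE_I[OF _ _ N]) auto
qed

lemma Lp_borel: "G \<in> Lp m r \<Longrightarrow> G \<in> borel_measurable borel"
  using measurable_cong_sets[OF sets_m refl] by (auto simp: Lp_def)

text \<open>Young's inequality splits the integrand: compression controls the power of
  \<open>G\<close>, and the finite energy of the plan controls the power of the speed.\<close>

lemma plan_integral_finite:
  assumes G: "G \<in> Lp m p"
  shows "plan_integral \<pi> (\<lambda>x. ennreal \<bar>G x\<bar>) < \<infinity>"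
proof -
  have [measurable]: "G \<in> borel_measurable borel" using G by (rule Lp_borel)
  have [measurable]: "(\<lambda>x. \<bar>G (fst x (snd x))\<bar> powr p) \<in> borel_measurable (\<pi> \<Otimes>\<^sub>M lborel)"
    by (rule measurable_comp_eval[where h="\<lambda>x. \<bar>G x\<bar> powr p"]) measurable
  have GI: "(\<integral>\<^sup>+x. ennreal (\<bar>G x\<bar> powr p) \<partial>m) < \<infinity>"
    using G by (auto simp: Lp_def integrable_iff_bounded)
  let ?A = "\<lambda>\<gamma>. \<integral>\<^sup>+t. ennreal (\<bar>G (\<gamma> t)\<bar> powr p) * indicator {0..1} t \<partial>lborel"
    and ?B = "\<lambda>\<gamma>. \<integral>\<^sup>+t. ennreal (speed \<gamma> t powr q) \<partial>lborel"
  have conj: "1 / p + 1 / q = 1" using p by (simp add: conj_exp_def field_simps)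
  have pw: "ennreal \<bar>G (\<gamma> t)\<bar> * ennreal (speed \<gamma> t) \<le>
    ennreal (\<bar>G (\<gamma> t)\<bar> powr p) * indicator {0..1} t + ennreal (speed \<gamma> t powr q)" for \<gamma> t
  proof (cases "t \<in> {0..1}")
    case True
    let ?a = "\<bar>G (\<gamma> t)\<bar>" and ?b = "speed \<gamma> t"
    have "?a * ?b \<le> ?a powr p / p + ?b powr q / q"
      using speed_nonneg by (intro Youngs_inequality p q conj) auto
    also have "\<dots> \<le> ?a powr p / 1 + ?b powr q / 1" using p q by (intro add_mono divide_left_mono) auto
    finally have "ennreal (?a * ?b) \<le> ennreal (?a powr p + ?b powr q)" by (intro ennreal_leI) simp
    then show ?thesis using True by (simp add: ennreal_mult''[OF speed_nonneg])
  next
    case False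
    then show ?thesis by (simp add: speed_outside[OF False])
  qed
  have "plan_integral \<pi> (\<lambda>x. ennreal \<bar>G x\<bar>) \<le> (\<integral>\<^sup>+\<gamma>. (\<integral>\<^sup>+t. ennreal (\<bar>G (\<gamma> t)\<bar> powr p) * indicator {0..1} t + ennreal (speed \<gamma> t powr q) \<partial>lborel) \<partial>\<pi>)"
    unfolding plan_integral_def by (intro nn_integral_mono pw)
  also have "\<dots> = (\<integral>\<^sup>+\<gamma>. ?A \<gamma> + ?B \<gamma> \<partial>\<pi>)"
  proof (rule nn_integral_cong)
    fix \<gamma> assume "\<gamma> \<in> space \<pi>"
    then have \<gamma>: "\<gamma> \<in> mspace curves" by (simp add: space_plan)
    have [measurable]: "\<gamma> \<in> borel_measurable borel" by (rule curve_borel[OF \<gamma>])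
    have [measurable]: "speed \<gamma> \<in> borel_measurable borel" using curve_borel_speed[OF \<gamma>, of "\<lambda>x. x" borel] by simp
    show "(\<integral>\<^sup>+t. ennreal (\<bar>G (\<gamma> t)\<bar> powr p) * indicator {0..1} t + ennreal (speed \<gamma> t powr q) \<partial>lborel) =
      ?A \<gamma> + ?B \<gamma>"
      by (rule nn_integral_add) auto
  qed
  also have "\<dots> = (\<integral>\<^sup>+\<gamma>. ?A \<gamma> \<partial>\<pi>) + (\<integral>\<^sup>+\<gamma>. ?B \<gamma> \<partial>\<pi>)"
    by (intro nn_integral_add measurable_inner_integral) measurable
  also have "\<dots> < \<infinity>"
  proof -
    obtain C :: real where C: "\<forall>t\<in>{0..1}. \<forall>h\<in>borel_measurable borel.
    (\<integral>\<^sup>+\<gamma>. h (\<gamma> t) \<partial>\<pi>) \<le> ennreal C * (\<integral>\<^sup>+x. h x \<partial>m)" using compression ..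
    have "(\<integral>\<^sup>+\<gamma>. ?A \<gamma> \<partial>\<pi>)
      = (\<integral>\<^sup>+t. (\<integral>\<^sup>+\<gamma>. ennreal (\<bar>G (\<gamma> t)\<bar> powr p) * indicator {0..1} t \<partial>\<pi>) \<partial>lborel)"
      by (rule Fubini'[symmetric]) (simp add: split_beta')
    also have "\<dots> \<le> (\<integral>\<^sup>+t. ennreal C * (\<integral>\<^sup>+x. ennreal (\<bar>G x\<bar> powr p) \<partial>m) * indicator {0..1} (t::real) \<partial>lborel)"
    proof (rule nn_integral_mono)
      fix t :: real
      show "(\<integral>\<^sup>+\<gamma>. ennreal (\<bar>G (\<gamma> t)\<bar> powr p) * indicator {0..1} t \<partial>\<pi>) \<le> ennreal C * (\<integral>\<^sup>+x. ennreal (\<bar>G x\<bar> powr p) \<partial>m) * indicator {0..1} t"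
        using C[rule_format, of t "\<lambda>x. ennreal (\<bar>G x\<bar> powr p)"] by (auto split: split_indicator)
    qed
    also have "\<dots> = ennreal C * (\<integral>\<^sup>+x. ennreal (\<bar>G x\<bar> powr p) \<partial>m)" by (simp add: nn_integral_cmult_indicator)
    also have "\<dots> < \<infinity>" using GI by (simp add: ennreal_mult_less_top)
    finally show ?thesis using speed_integral_finite by simp
  qed
  finally show ?thesis .
qed

end

section \<open>From the integrated inequality to almost every curve\<close>

context test_plan_setting
begin

lemma restr_plan_setting:
  assumes st: "0 \<le> s" "s < t" "t \<le> 1" and \<Gamma>: "\<Gamma> \<in> sets \<pi>" "emeasure \<pi> \<Gamma> \<noteq> 0"
  shows "test_plan_setting m p (restr_plan s t \<Gamma> \<pi>)"
  using test_plan_restr_plan[OF st _ plan \<Gamma>] q p sets_m by unfold_locales auto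

lemma curve_plan: "\<gamma> \<in> space \<pi> \<Longrightarrow> \<gamma> \<in> borel_measurable borel" "\<gamma> \<in> space \<pi> \<Longrightarrow> speed \<gamma> \<in> borel_measurable borel"
  using curve_borel curve_borel_speed[of \<gamma> "\<lambda>x. x" borel] by (auto simp: space_plan)

lemma measurable_set_integral_speed:
  assumes h: "h \<in> borel_measurable borel"
  shows "(\<lambda>\<gamma>. \<integral>\<^sup>+r\<in>{a..b}. h (\<gamma> r) * ennreal (speed \<gamma> r) \<partial>lborel) \<in> borel_measurable \<pi>"
proof (rule measurable_inner_integral)
  note measurable_comp_eval[OF h, measurable]
  show "(\<lambda>x. h (fst x (snd x)) * ennreal (speed (fst x) (snd x)) * indicator {a..b} (snd x)) \<in> borel_measurable (\<pi> \<Otimes>\<^sub>M lborel)"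
    by measurable
qed

lemma measurable_increment:
  fixes f :: "'a \<Rightarrow> real"
  assumes f: "f \<in> borel_measurable borel" and st: "s \<in> {0..1}" "t \<in> {0..1}"
  shows "(\<lambda>\<gamma>. ennreal (dist (f (\<gamma> s)) (f (\<gamma> t)))) \<in> borel_measurable \<pi>"
proof -
  note measurable_compose[OF eval_measurable[OF st(1)] f, measurable]
    measurable_compose[OF eval_measurable[OF st(2)] f, measurable]
  show ?thesis by measurable
qed

lemma set_integral_le_plan_integral:
  "(\<integral>\<^sup>+\<gamma>. curve_integral \<gamma> {a..b} h \<partial>\<pi>) \<le> plan_integral \<pi> h"
  unfolding plan_integral_def by (intro nn_integral_mono) (auto split: split_indicator)

text \<open>The factor \<open>t - s\<close> from \<open>speed_restr_le\<close> is the Jacobian that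
  turns the integral over [0,1] into one over \<open>{s..t}\<close>.\<close>

lemma restr_plan_integral_le:
  assumes h: "h \<in> borel_measurable borel" and st: "0 \<le> s" "s < t" "t \<le> 1"
    and \<Gamma>: "\<Gamma> \<in> sets \<pi>"
  shows "plan_integral (restr_plan s t \<Gamma> \<pi>) h \<le>
    (\<integral>\<^sup>+\<gamma>. curve_integral \<gamma> {s..t} h * indicator \<Gamma> \<gamma> \<partial>\<pi>) / emeasure \<pi> \<Gamma>"
proof -
  let ?U = "uniform_measure \<pi> \<Gamma>" and ?c = "t - s"
  have c: "0 < ?c" using st by simp
  have RU: "restr s t \<in> measurable ?U (borel_curves :: (real \<Rightarrow> 'a) measure)"
    using measurable_restr[OF st, where 'b='a] by (simp cong: measurable_cong_sets add: sets_plan)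
  have "plan_integral (restr_plan s t \<Gamma> \<pi>) h \<le> (\<integral>\<^sup>+\<gamma>. (\<integral>\<^sup>+r. h (restr s t \<gamma> r) * ennreal (speed (restr s t \<gamma>) r) \<partial>lborel) \<partial>?U)"
    unfolding plan_integral_def restr_plan_def by (rule nn_integral_distr_le[OF RU])
  also have "\<dots> \<le> (\<integral>\<^sup>+\<gamma>. curve_integral \<gamma> {s..t} h \<partial>?U)"
  proof (rule nn_integral_mono)
    fix \<gamma> assume "\<gamma> \<in> space ?U"
    then have \<gamma>: "\<gamma> \<in> space \<pi>" by simp
    note curve_plan(1)[OF \<gamma>, measurable] curve_plan(2)[OF \<gamma>, measurable]
    have hm[measurable]: "(\<lambda>r. h (\<gamma> r)) \<in> borel_measurable borel" by (rule measurable_compose[OF curve_plan(1)[OF \<gamma>] h])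
    have "(\<integral>\<^sup>+r. h (restr s t \<gamma> r) * ennreal (speed (restr s t \<gamma>) r) \<partial>lborel)
      \<le> (\<integral>\<^sup>+r\<in>{0..1}. ennreal ?c * (h (\<gamma> (s + ?c * r)) * ennreal (speed \<gamma> (s + ?c * r))) \<partial>lborel)"
    proof (intro nn_integral_mono_AE, use AE_lborel_singleton[of 0] AE_lborel_singleton[of 1] in eventually_elim)
      case (elim r)
      show ?case
      proof (cases "r \<in> {0..1}")
        case True
        then have "r \<in> {0<..<1}" using elim by auto
        then have "ennreal (speed (restr s t \<gamma>) r) \<le> ennreal ?c * ennreal (speed \<gamma> (s + ?c * r))"
          using speed_restr_le[OF st, of r \<gamma>] c by (subst ennreal_mult[symmetric]) (auto intro: ennreal_leI speed_nonneg)
        moreover have "restr s t \<gamma> r = \<gamma> (s + ?c * r)" using True by (simp add: restr_def)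
        ultimately have "h (restr s t \<gamma> r) * ennreal (speed (restr s t \<gamma>) r) \<le>
            h (\<gamma> (s + ?c * r)) * (ennreal ?c * ennreal (speed \<gamma> (s + ?c * r)))"
          by (simp add: mult_left_mono)
        then show ?thesis using True by (simp add: mult_ac)
      next
        case False
        then show ?thesis by (simp add: speed_outside[OF False])
      qed
    qed
    also have "\<dots> = curve_integral \<gamma> {s + ?c * 0..s + ?c * 1} h"
      by (rule nn_integral_affine_Icc[OF _ c, where h="\<lambda>r. h (\<gamma> r) * ennreal (speed \<gamma> r)"]) measurable
    finally show "(\<integral>\<^sup>+r. h (restr s t \<gamma> r) * ennreal (speed (restr s t \<gamma>) r) \<partial>lborel)
      \<le> curve_integral \<gamma> {s..t} h" by simp
  qed
  also have "\<dots> = (\<integral>\<^sup>+\<gamma>. curve_integral \<gamma> {s..t} h * indicator \<Gamma> \<gamma> \<partial>\<pi>) / emeasure \<pi> \<Gamma>"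
    by (rule nn_integral_uniform_measure[OF measurable_set_integral_speed[OF h] \<Gamma>])
  finally show ?thesis .
qed

text \<open>Condition the plan on the set \<open>\<Gamma>\<close> of curves that violate the
  inequality and restrict it to \<open>{s..t}\<close>. The integrated inequality for the new plan
  makes the integral of \<open>A\<close> over \<open>\<Gamma>\<close> at most that of
  \<open>B\<close>, although \<open>A\<close> exceeds \<open>B\<close> there; so
  \<open>\<Gamma>\<close> is null.\<close>

lemma increment_le_AE:
  assumes f: "f \<in> borel_measurable borel" and wug: "weak_upper_gradient m p f G"
    and st: "0 \<le> s" "s < t" "t \<le> 1"
  shows "AE \<gamma> in \<pi>. ennreal (dist (f (\<gamma> s)) (f (\<gamma> t))) \<le> curve_integral \<gamma> {s..t} (\<lambda>x. ennreal (G x))"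
proof -
  define A where "A \<gamma> = ennreal (dist (f (\<gamma> s)) (f (\<gamma> t)))" for \<gamma>
  define B where "B \<gamma> = curve_integral \<gamma> {s..t} (\<lambda>x. ennreal (G x))" for \<gamma>
  have GLp: "G \<in> Lp m p" using wug by (simp add: weak_upper_gradient_def)
  then have G: "(\<lambda>x. ennreal (G x)) \<in> borel_measurable borel" using Lp_borel by measurable
  have [measurable]: "A \<in> borel_measurable \<pi>" unfolding A_def using measurable_increment[OF f, of s t] st by simp
  have [measurable]: "B \<in> borel_measurable \<pi>" unfolding B_def by (rule measurable_set_integral_speed[OF G])
  define \<Gamma> where "\<Gamma> = {\<gamma> \<in> space \<pi>. B \<gamma> < A \<gamma>}"
  have \<Gamma>[measurable]: "\<Gamma> \<in> sets \<pi>" unfolding \<Gamma>_def by measurable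
  \<comment> \<open>Finiteness of this integral makes the strict comparison of the integrals over
    \<open>\<Gamma>\<close> valid.\<close>
  have Bfin: "(\<integral>\<^sup>+\<gamma>. B \<gamma> * indicator \<Gamma> \<gamma> \<partial>\<pi>) < \<infinity>"
  proof -
    have "(\<integral>\<^sup>+\<gamma>. B \<gamma> * indicator \<Gamma> \<gamma> \<partial>\<pi>) \<le> (\<integral>\<^sup>+\<gamma>. B \<gamma> \<partial>\<pi>)"
      by (intro nn_integral_mono) (auto split: split_indicator)
    also have "\<dots> \<le> plan_integral \<pi> (\<lambda>x. ennreal (G x))" unfolding B_def by (rule set_integral_le_plan_integral)
    also have "\<dots> \<le> plan_integral \<pi> (\<lambda>x. ennreal \<bar>G x\<bar>)"
      unfolding plan_integral_def by (intro nn_integral_mono mult_right_mono ennreal_leI) auto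
    also have "\<dots> < \<infinity>" by (rule plan_integral_finite[OF GLp])
    finally show ?thesis .
  qed
  have null: "emeasure \<pi> \<Gamma> = 0"
  proof (rule ccontr)
    assume nz: "emeasure \<pi> \<Gamma> \<noteq> 0"
    let ?\<pi>' = "restr_plan s t \<Gamma> \<pi>" and ?U = "uniform_measure \<pi> \<Gamma>"
    interpret R: test_plan_setting m p ?\<pi>' by (rule restr_plan_setting[OF st \<Gamma> nz])
    have RU: "restr s t \<in> measurable ?U (borel_curves :: (real \<Rightarrow> 'a) measure)"
      using measurable_restr[OF st, where 'b='a] by (simp cong: measurable_cong_sets add: sets_plan)
    have m01: "(\<lambda>\<gamma>. ennreal (dist (f (\<gamma> 0)) (f (\<gamma> 1)))) \<in> borel_measurable borel_curves"
      using R.measurable_increment[OF f, of 0 1] by (simp cong: measurable_cong_sets add: R.sets_plan)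
    have "(\<integral>\<^sup>+\<gamma>. A \<gamma> * indicator \<Gamma> \<gamma> \<partial>\<pi>) / emeasure \<pi> \<Gamma> = (\<integral>\<^sup>+\<gamma>. A \<gamma> \<partial>?U)"
      by (rule nn_integral_uniform_measure[symmetric]) measurable
    also have "\<dots> = (\<integral>\<^sup>+\<gamma>. ennreal (dist (f (restr s t \<gamma> 0)) (f (restr s t \<gamma> 1))) \<partial>?U)"
      by (simp add: A_def restr_def)
    also have "\<dots> = (\<integral>\<^sup>+\<gamma>. ennreal (dist (f (\<gamma> 0)) (f (\<gamma> 1))) \<partial>?\<pi>')"
      unfolding restr_plan_def by (rule nn_integral_distr[symmetric, OF RU]) (use m01 in simp)
    also have "\<dots> \<le> plan_integral ?\<pi>' (\<lambda>x. ennreal (G x))"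
      using wug R.plan unfolding weak_upper_gradient_iff by (auto simp: dist_real_def abs_minus_commute)
    also have "\<dots> \<le> (\<integral>\<^sup>+\<gamma>. B \<gamma> * indicator \<Gamma> \<gamma> \<partial>\<pi>) / emeasure \<pi> \<Gamma>"
      unfolding B_def by (rule restr_plan_integral_le[OF G st \<Gamma>])
    finally have le: "(\<integral>\<^sup>+\<gamma>. A \<gamma> * indicator \<Gamma> \<gamma> \<partial>\<pi>) / emeasure \<pi> \<Gamma> \<le> (\<integral>\<^sup>+\<gamma>. B \<gamma> * indicator \<Gamma> \<gamma> \<partial>\<pi>) / emeasure \<pi> \<Gamma>" .
    have fin: "emeasure \<pi> \<Gamma> \<noteq> top" by simp
    have eq: "x / emeasure \<pi> \<Gamma> * emeasure \<pi> \<Gamma> = x" for x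
      using nz fin by (simp add: ennreal_divide_times less_top[symmetric])
    have "(\<integral>\<^sup>+\<gamma>. A \<gamma> * indicator \<Gamma> \<gamma> \<partial>\<pi>) \<le> (\<integral>\<^sup>+\<gamma>. B \<gamma> * indicator \<Gamma> \<gamma> \<partial>\<pi>)"
      using mult_right_mono[OF le, of "emeasure \<pi> \<Gamma>"] unfolding eq by simp
    moreover have "(\<integral>\<^sup>+\<gamma>. B \<gamma> * indicator \<Gamma> \<gamma> \<partial>\<pi>) < (\<integral>\<^sup>+\<gamma>. A \<gamma> * indicator \<Gamma> \<gamma> \<partial>\<pi>)"
    proof (rule nn_integral_less)
      show "AE \<gamma> in \<pi>. B \<gamma> * indicator \<Gamma> \<gamma> \<le> A \<gamma> * indicator \<Gamma> \<gamma>"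
        by (auto simp: \<Gamma>_def less_imp_le split: split_indicator)
      show "\<not> (AE \<gamma> in \<pi>. A \<gamma> * indicator \<Gamma> \<gamma> \<le> B \<gamma> * indicator \<Gamma> \<gamma>)"
      proof
        assume "AE \<gamma> in \<pi>. A \<gamma> * indicator \<Gamma> \<gamma> \<le> B \<gamma> * indicator \<Gamma> \<gamma>"
        then have "AE \<gamma> in \<pi>. \<gamma> \<notin> \<Gamma>" by eventually_elim (auto simp: \<Gamma>_def)
        then have "\<Gamma> \<in> null_sets \<pi>" using AE_iff_null_sets[OF \<Gamma>] by simp
        then show False using nz by auto
      qed
    qed (use Bfin in auto)
    ultimately show False by simp
  qed
  then have "AE \<gamma> in \<pi>. \<gamma> \<notin> \<Gamma>" by (intro AE_not_in) (simp add: null_sets_def)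
  then have "AE \<gamma> in \<pi>. A \<gamma> \<le> B \<gamma>" using AE_space by eventually_elim (auto simp: \<Gamma>_def)
  then show ?thesis unfolding A_def B_def .
qed

lemma integrand_finite_AE:
  assumes "G \<in> Lp m p"
  shows "AE \<gamma> in \<pi>. curve_integral \<gamma> {0..1} (\<lambda>x. ennreal (G x)) < \<infinity>"
proof -
  have G: "(\<lambda>x. ennreal (G x)) \<in> borel_measurable borel" using Lp_borel[OF assms] by measurable
  have "(\<integral>\<^sup>+\<gamma>. curve_integral \<gamma> {0..1} (\<lambda>x. ennreal (G x)) \<partial>\<pi>) \<le> plan_integral \<pi> (\<lambda>x. ennreal (G x))"
    by (rule set_integral_le_plan_integral)
  also have "\<dots> \<le> plan_integral \<pi> (\<lambda>x. ennreal \<bar>G x\<bar>)"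
    unfolding plan_integral_def by (intro nn_integral_mono mult_right_mono ennreal_leI) auto
  also have "\<dots> < \<infinity>" by (rule plan_integral_finite[OF assms])
  finally have "AE \<gamma> in \<pi>. curve_integral \<gamma> {0..1} (\<lambda>x. ennreal (G x)) \<noteq> \<infinity>"
    by (intro nn_integral_PInf_AE measurable_set_integral_speed[OF G]) simp
  then show ?thesis by eventually_elim (simp add: less_top)
qed

text \<open>A time is compared with rational times only, which keeps membership a countable
  condition, measurable in curve and time; two good times are then compared through a rational
  between them.\<close>

definition good_times :: "('a \<Rightarrow> real) \<Rightarrow> ('a \<Rightarrow> real) \<Rightarrow> (real \<Rightarrow> 'a) \<Rightarrow> real set" where
  "good_times f G \<gamma> = {t \<in> {0..1}. \<forall>s\<in>\<rat> \<inter> {0..1}.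
     ennreal (dist (f (\<gamma> s)) (f (\<gamma> t))) \<le> curve_integral \<gamma> {min s t..max s t} (\<lambda>x. ennreal (G x))}"

lemma AE_mem_good_times:
  assumes f: "f \<in> borel_measurable borel" and wug: "weak_upper_gradient m p f G" and t: "t \<in> {0..1}"
  shows "AE \<gamma> in \<pi>. t \<in> good_times f G \<gamma>"
proof -
  have "AE \<gamma> in \<pi>. ennreal (dist (f (\<gamma> s)) (f (\<gamma> t))) \<le> curve_integral \<gamma> {min s t..max s t} (\<lambda>x. ennreal (G x))"
    if s: "s \<in> \<rat> \<inter> {0..1}" for s
  proof -
    consider "s < t" | "s = t" | "t < s" by linarith
    then show ?thesis
    proof cases
      case 1
      then show ?thesis using increment_le_AE[OF f wug, of s t] s t by (simp add: min_def max_def)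
    next
      case 2
      then show ?thesis by simp
    next
      case 3
      then show ?thesis using increment_le_AE[OF f wug, of t s] s t by (simp add: min_def max_def dist_commute)
    qed
  qed
  moreover have "countable (\<rat> \<inter> {0..1::real})" by (intro countable_Int1 countable_rat)
  ultimately have "AE \<gamma> in \<pi>. \<forall>s\<in>\<rat> \<inter> {0..1}.
     ennreal (dist (f (\<gamma> s)) (f (\<gamma> t))) \<le> curve_integral \<gamma> {min s t..max s t} (\<lambda>x. ennreal (G x))"
    by (subst AE_ball_countable) auto
  then show ?thesis by eventually_elim (use t in \<open>auto simp: good_times_def\<close>)
qed

text \<open>For each fixed time almost every curve is good. Countability settles all rational times
  at once, and Fubini almost all times; the latter requires joint measurability of the defining
  inequalities.\<close>

lemma AE_good_times:
  assumes f: "f \<in> borel_measurable borel" and wug: "weak_upper_gradient m p f G"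
  shows "AE \<gamma> in \<pi>. \<rat> \<inter> {0..1} \<subseteq> good_times f G \<gamma> \<and> (AE t in lborel. t \<in> {0..1} \<longrightarrow> t \<in> good_times f G \<gamma>)"
proof -
  have cnt: "countable (\<rat> \<inter> {0..1::real})" by (intro countable_Int1 countable_rat)
  have "AE \<gamma> in \<pi>. \<forall>t\<in>\<rat> \<inter> {0..1}. t \<in> good_times f G \<gamma>"
    by (subst AE_ball_countable[OF cnt]) (use AE_mem_good_times[OF f wug] in auto)
  moreover have "AE \<gamma> in \<pi>. AE t in lborel. t \<in> {0..1} \<longrightarrow> t \<in> good_times f G \<gamma>"
  proof -
    have AE1: "AE t in lborel. AE \<gamma> in \<pi>. t \<in> {0..1} \<longrightarrow> t \<in> good_times f G \<gamma>"
    proof (rule AE_I2)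
      fix t :: real
      show "AE \<gamma> in \<pi>. t \<in> {0..1} \<longrightarrow> t \<in> good_times f G \<gamma>"
        using AE_mem_good_times[OF f wug, of t] by (cases "t \<in> {0..1}") (simp, intro AE_I2, blast)
    qed
    have GLp: "G \<in> Lp m p" using wug by (simp add: weak_upper_gradient_def)
    have [measurable]: "G \<in> borel_measurable borel" by (rule Lp_borel[OF GLp])
    let ?P = "\<pi> \<Otimes>\<^sub>M (lborel :: real measure)"
    have ft: "(\<lambda>x. f (fst x (snd x))) \<in> borel_measurable ?P" by (rule measurable_comp_eval[OF f])
    have fs: "(\<lambda>x. f (fst x s)) \<in> borel_measurable ?P" if "s \<in> {0..1}" for s
      by (rule measurable_compose[OF measurable_fst measurable_compose[OF eval_measurable[OF that] f]])
    \<comment> \<open>The moving endpoints enter through an indicator, so this is an inner integral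
      of a function measurable in curve, time and integration variable.\<close>
    have int: "(\<lambda>x. \<integral>\<^sup>+r\<in>{min s (snd x)..max s (snd x)}. ennreal (G (fst x r)) * ennreal (speed (fst x) r) \<partial>lborel) \<in> borel_measurable ?P" for s
    proof -
      have F: "(\<lambda>y. fst (fst y)) \<in> measurable (?P \<Otimes>\<^sub>M (lborel :: real measure)) borel_curves"
        by (rule measurable_compose[OF measurable_fst measurable_fst_plan])
      have G': "(\<lambda>y. G (fst (fst y) (snd y))) \<in> borel_measurable (?P \<Otimes>\<^sub>M lborel)"
        by (rule measurable_compose[OF measurable_eval_pair[OF F]]) measurable
      have S: "(\<lambda>y. speed (fst (fst y)) (snd y)) \<in> borel_measurable (?P \<Otimes>\<^sub>M lborel)"
        by (rule measurable_speed_pair[OF F]) simp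
      have "(\<lambda>y. ennreal (G (fst (fst y) (snd y))) * ennreal (speed (fst (fst y)) (snd y)) *
         (if min s (snd (fst y)) \<le> snd y \<and> snd y \<le> max s (snd (fst y)) then 1 else 0)) \<in> borel_measurable (?P \<Otimes>\<^sub>M lborel)"
        using G' S by measurable
      then have "(\<lambda>(x, r). ennreal (G (fst x r)) * ennreal (speed (fst x) r) * indicator {min s (snd x)..max s (snd x)} r) \<in> borel_measurable (?P \<Otimes>\<^sub>M lborel)"
        by (simp add: split_beta' indicator_def of_bool_def)
      then show ?thesis by (rule lborel.borel_measurable_nn_integral)
    qed
    let ?W = "\<lambda>x s. ennreal (dist (f (fst x s)) (f (fst x (snd x)))) \<le>
        (\<integral>\<^sup>+r\<in>{min s (snd x)..max s (snd x)}. ennreal (G (fst x r)) * ennreal (speed (fst x) r) \<partial>lborel)"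
    have W: "{x \<in> space ?P. ?W x s} \<in> sets ?P" if s: "s \<in> \<rat> \<inter> {0..1}" for s
    proof -
      have "s \<in> {0..1}" using s by simp
      note fs[OF this, measurable] ft[measurable] int[of s, measurable]
      show ?thesis by (rule borel_measurable_le) measurable
    qed
    have "{x \<in> space ?P. \<forall>s\<in>\<rat> \<inter> {0..1}. ?W x s} \<in> sets ?P"
      by (rule sets.sets_Collect_countable_All'[OF W cnt])
    moreover have "{x \<in> space ?P. snd x \<in> {0..1}} \<in> sets ?P" by measurable
    ultimately have "{x \<in> space ?P. snd x \<in> {0..1} \<longrightarrow> (\<forall>s\<in>\<rat> \<inter> {0..1}. ?W x s)} \<in> sets ?P"
      by (rule sets.sets_Collect_imp)
    also have "?this \<longleftrightarrow> {x \<in> space ?P. snd x \<in> {0..1} \<longrightarrow> snd x \<in> good_times f G (fst x)} \<in> sets ?P"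
      by (intro arg_cong[where f="\<lambda>S. S \<in> sets ?P"]) (auto simp: good_times_def)
    finally have S: "{x \<in> space ?P. snd x \<in> {0..1} \<longrightarrow> snd x \<in> good_times f G (fst x)} \<in> sets ?P" .
    show ?thesis
      using AE1 AE_commute[of "\<lambda>\<gamma> t. t \<in> {0..1} \<longrightarrow> t \<in> good_times f G \<gamma>", OF S] by blast
  qed
  ultimately show ?thesis by eventually_elim auto
qed

lemma increment_bound_good_times:
  assumes G: "G \<in> Lp m p" and \<gamma>: "\<gamma> \<in> space \<pi>"
  shows "increment_bound (good_times f G \<gamma>) (\<lambda>t. f (\<gamma> t)) (\<lambda>r. ennreal (G (\<gamma> r)) * ennreal (speed \<gamma> r))"
  unfolding increment_bound_def
proof (intro ballI impI)
  fix s t assume st: "s \<in> good_times f G \<gamma>" "t \<in> good_times f G \<gamma>" "s < t"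
  then have st01: "s \<in> {0..1}" "t \<in> {0..1}" by (auto simp: good_times_def)
  obtain z where z: "z \<in> \<rat>" "s < z" "z < t" using Rats_dense_in_real[OF st(3)] by auto
  then have zq: "z \<in> \<rat> \<inter> {0..1}" using st01 by auto
  let ?g = "\<lambda>r. ennreal (G (\<gamma> r)) * ennreal (speed \<gamma> r)"
  note curve_plan(2)[OF \<gamma>, measurable]
  have [measurable]: "(\<lambda>r. G (\<gamma> r)) \<in> borel_measurable borel"
    by (rule measurable_compose[OF curve_plan(1)[OF \<gamma>] Lp_borel[OF G]])
  have "ennreal (dist (f (\<gamma> z)) (f (\<gamma> s))) \<le> (set_nn_integral lborel {s..z} ?g)"
    using st(1) zq z by (auto simp: good_times_def min_def max_def dest!: bspec[of _ _ z])
  moreover have "ennreal (dist (f (\<gamma> z)) (f (\<gamma> t))) \<le> (set_nn_integral lborel {z..t} ?g)"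
    using st(2) zq z by (auto simp: good_times_def min_def max_def dest!: bspec[of _ _ z])
  ultimately have "ennreal (dist (f (\<gamma> z)) (f (\<gamma> s))) + ennreal (dist (f (\<gamma> z)) (f (\<gamma> t))) \<le> (set_nn_integral lborel {s..t} ?g)"
    by (subst set_nn_integral_split[of ?g s z t, symmetric]) (use z in \<open>auto intro: add_mono\<close>)
  moreover have "ennreal (dist (f (\<gamma> s)) (f (\<gamma> t))) \<le> ennreal (dist (f (\<gamma> z)) (f (\<gamma> s))) + ennreal (dist (f (\<gamma> z)) (f (\<gamma> t)))"
    by (simp add: dist_triangle3 flip: ennreal_plus)
  ultimately show "ennreal (dist (f (\<gamma> s)) (f (\<gamma> t))) \<le> (set_nn_integral lborel {s..t} ?g)" by order
qed

end

subsection \<open>Calculus along a test plan\<close>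

lemma increment_bound_subset: "increment_bound D u g \<Longrightarrow> D' \<subseteq> D \<Longrightarrow> increment_bound D' u g"
  by (auto simp: increment_bound_def)

lemma zero_one_Rats: "0 \<in> \<rat> \<inter> {0..1::real}" "1 \<in> \<rat> \<inter> {0..1::real}"
  by auto

section \<open>Closure properties of the Lebesgue classes\<close>

lemma Lp_bound:
  assumes [measurable]: "f \<in> borel_measurable m" and g: "g \<in> Lp m p" and p: "1 < p"
    and "AE x in m. \<bar>f x\<bar> \<le> \<bar>g x\<bar>"
  shows "f \<in> Lp m p"
proof -
  have "integrable m (\<lambda>x. \<bar>f x\<bar> powr p)"
  proof (rule Bochner_Integration.integrable_bound)
    show "integrable m (\<lambda>x. \<bar>g x\<bar> powr p)" using g by (simp add: Lp_def)
    show "AE x in m. norm (\<bar>f x\<bar> powr p) \<le> norm (\<bar>g x\<bar> powr p)"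
      using assms(4) by eventually_elim (use p in \<open>auto intro: powr_mono2\<close>)
  qed measurable
  then show ?thesis by (simp add: Lp_def)
qed

lemma Lp_add:
  assumes f: "f \<in> Lp m p" and g: "g \<in> Lp m p" and p: "1 < p"
  shows "(\<lambda>x. f x + g x) \<in> Lp m p"
proof -
  have [measurable]: "f \<in> borel_measurable m" "g \<in> borel_measurable m"
    and fi: "integrable m (\<lambda>x. \<bar>f x\<bar> powr p)" and gi: "integrable m (\<lambda>x. \<bar>g x\<bar> powr p)"
    using f g by (auto simp: Lp_def)
  have "integrable m (\<lambda>x. \<bar>f x + g x\<bar> powr p)"
  proof (rule Bochner_Integration.integrable_bound)
    show "integrable m (\<lambda>x. 2 powr p * (\<bar>f x\<bar> powr p + \<bar>g x\<bar> powr p))" using fi gi by simp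
    have "\<bar>f x + g x\<bar> powr p \<le> 2 powr p * (\<bar>f x\<bar> powr p + \<bar>g x\<bar> powr p)" for x
    proof -
      have "\<bar>f x + g x\<bar> powr p \<le> (2 * max \<bar>f x\<bar> \<bar>g x\<bar>) powr p" using p by (intro powr_mono2) auto
      also have "\<dots> = 2 powr p * max \<bar>f x\<bar> \<bar>g x\<bar> powr p" by (simp add: powr_mult)
      also have "\<dots> \<le> 2 powr p * (\<bar>f x\<bar> powr p + \<bar>g x\<bar> powr p)" by (intro mult_left_mono) (auto simp: max_def)
      finally show ?thesis .
    qed
    then show "AE x in m. norm (\<bar>f x + g x\<bar> powr p) \<le> norm (2 powr p * (\<bar>f x\<bar> powr p + \<bar>g x\<bar> powr p))"
      by (auto simp: abs_mult)
  qed measurable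
  then show ?thesis by (simp add: Lp_def)
qed

lemma Lp_cmult: "f \<in> Lp m p \<Longrightarrow> (\<lambda>x. c * f x) \<in> Lp m p"
  by (auto simp: Lp_def abs_mult powr_mult)

lemma Lp_abs: "f \<in> Lp m p \<Longrightarrow> (\<lambda>x. \<bar>f x\<bar>) \<in> Lp m p"
  by (auto simp: Lp_def)

section \<open>Integrals along a plan, and plan inequalities for modified gradients\<close>

context test_plan_setting
begin

lemma plan_integral_mono_AE:
  assumes "AE x in m. h x \<le> h' x"
  shows "plan_integral \<pi> h \<le> plan_integral \<pi> h'"
  unfolding plan_integral_def
proof (rule nn_integral_mono_AE)
  show "AE \<gamma> in \<pi>. (\<integral>\<^sup>+t. h (\<gamma> t) * ennreal (speed \<gamma> t) \<partial>lborel) \<le> (\<integral>\<^sup>+t. h' (\<gamma> t) * ennreal (speed \<gamma> t) \<partial>lborel)"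
    using AE_plan[OF assms]
  proof eventually_elim
    case (elim \<gamma>)
    show ?case
    proof (rule nn_integral_mono_AE)
      show "AE t in lborel. h (\<gamma> t) * ennreal (speed \<gamma> t) \<le> h' (\<gamma> t) * ennreal (speed \<gamma> t)"
        using elim
      proof eventually_elim
        case (elim t)
        show ?case using elim speed_outside[of t \<gamma>] by (cases "t \<in> {0..1}") (auto intro: mult_right_mono)
      qed
    qed
  qed
qed

lemma plan_integral_pair:
  assumes "h \<in> borel_measurable borel"
  shows "plan_integral \<pi> h = (\<integral>\<^sup>+x. h (fst x (snd x)) * ennreal (speed (fst x) (snd x)) \<partial>(\<pi> \<Otimes>\<^sub>M lborel))"
proof -
  note measurable_comp_eval[OF assms, measurable]
  show ?thesis unfolding plan_integral_def
    by (subst lborel.nn_integral_fst[symmetric]) simp_all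
qed

lemma measurable_integrand_pair:
  assumes "h \<in> borel_measurable borel"
  shows "(\<lambda>x. h (fst x (snd x)) * ennreal (speed (fst x) (snd x))) \<in> borel_measurable (\<pi> \<Otimes>\<^sub>M lborel)"
proof -
  note measurable_comp_eval[OF assms, measurable]
  show ?thesis by measurable
qed

lemma plan_integral_add:
  assumes "h \<in> borel_measurable borel" "h' \<in> borel_measurable borel"
  shows "plan_integral \<pi> (\<lambda>x. h x + h' x) = plan_integral \<pi> h + plan_integral \<pi> h'"
  using assms measurable_integrand_pair[OF assms(1)] measurable_integrand_pair[OF assms(2)]
  by (simp add: plan_integral_pair distrib_right nn_integral_add)

lemma plan_integral_cmult:
  assumes "h \<in> borel_measurable borel"
  shows "plan_integral \<pi> (\<lambda>x. c * h x) = c * plan_integral \<pi> h"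
  using assms measurable_integrand_pair[OF assms]
  by (simp add: plan_integral_pair mult.assoc nn_integral_cmult)

lemma measurable_integrand_curve:
  assumes "h \<in> borel_measurable borel" "\<gamma> \<in> space \<pi>"
  shows "(\<lambda>r. h (\<gamma> r) * ennreal (speed \<gamma> r)) \<in> borel_measurable borel"
proof -
  note measurable_compose[OF curve_plan(1)[OF assms(2)] assms(1), measurable] curve_plan(2)[OF assms(2), measurable]
  show ?thesis by measurable
qed

lemma increment_le_plan_integral:
  assumes "AE \<gamma> in \<pi>. ennreal (dist (f (\<gamma> 0)) (f (\<gamma> 1))) \<le> curve_integral \<gamma> {0..1} h"
  shows "(\<integral>\<^sup>+\<gamma>. ennreal \<bar>f (\<gamma> 1) - f (\<gamma> 0)\<bar> \<partial>\<pi>) \<le> plan_integral \<pi> h"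
proof -
  have "(\<integral>\<^sup>+\<gamma>. ennreal \<bar>f (\<gamma> 1) - f (\<gamma> 0)\<bar> \<partial>\<pi>) \<le> (\<integral>\<^sup>+\<gamma>. curve_integral \<gamma> {0..1} h \<partial>\<pi>)"
    by (rule nn_integral_mono_AE) (use assms in \<open>simp add: dist_real_def abs_minus_commute\<close>)
  also have "\<dots> \<le> plan_integral \<pi> h" by (rule set_integral_le_plan_integral)
  finally show ?thesis .
qed

text \<open>Along a curve the set \<open>A\<close> pulls back to a Borel set of times, so the choice
  between gradients in space becomes a choice in time. Rational times suffice as the set
  \<open>D\<close>: they are good for both gradients and include 0 and 1.\<close>

lemma piecewise_plan_le:
  assumes f: "f \<in> borel_measurable borel" and G1: "weak_upper_gradient m p f G1"
    and G2: "weak_upper_gradient m p f G2" and A: "A \<in> sets borel"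
  shows "(\<integral>\<^sup>+\<gamma>. ennreal \<bar>f (\<gamma> 1) - f (\<gamma> 0)\<bar> \<partial>\<pi>) \<le> plan_integral \<pi> (\<lambda>x. ennreal (if x \<in> A then G1 x else G2 x))"
proof (rule increment_le_plan_integral)
  have L: "G1 \<in> Lp m p" "G2 \<in> Lp m p" using G1 G2 by (auto simp: weak_upper_gradient_def)
  show "AE \<gamma> in \<pi>. ennreal (dist (f (\<gamma> 0)) (f (\<gamma> 1))) \<le>
      (\<integral>\<^sup>+r\<in>{0..1}. ennreal (if \<gamma> r \<in> A then G1 (\<gamma> r) else G2 (\<gamma> r)) * ennreal (speed \<gamma> r) \<partial>lborel)"
    using AE_good_times[OF f G1] AE_good_times[OF f G2] integrand_finite_AE[OF L(1)] integrand_finite_AE[OF L(2)] AE_space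
  proof eventually_elim
    case (elim \<gamma>)
    let ?E = "\<gamma> -` A"
    let ?g1 = "\<lambda>r. ennreal (G1 (\<gamma> r)) * ennreal (speed \<gamma> r)" and ?g2 = "\<lambda>r. ennreal (G2 (\<gamma> r)) * ennreal (speed \<gamma> r)"
    have m: "?g1 \<in> borel_measurable borel" "?g2 \<in> borel_measurable borel"
      using measurable_integrand_curve[OF _ elim(5), of "\<lambda>x. ennreal (G1 x)"]
        measurable_integrand_curve[OF _ elim(5), of "\<lambda>x. ennreal (G2 x)"] Lp_borel[OF L(1)] Lp_borel[OF L(2)] by auto
    have E: "?E \<in> sets borel" using measurable_sets[OF curve_plan(1)[OF elim(5)] A] by simp
    have "increment_bound (\<rat> \<inter> {0..1}) (\<lambda>t. f (\<gamma> t)) (\<lambda>r. if r \<in> ?E then ?g1 r else ?g2 r)"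
      by (rule increment_bound_piecewise[OF _ _ E m(1) elim(3) m(2) elim(4)])
        (use increment_bound_subset[OF increment_bound_good_times[OF L(1) elim(5)]]
          increment_bound_subset[OF increment_bound_good_times[OF L(2) elim(5)]] elim(1,2) in auto)
    then have "ennreal (dist (f (\<gamma> 0)) (f (\<gamma> 1))) \<le> (\<integral>\<^sup>+r\<in>{0..1}. (if r \<in> ?E then ?g1 r else ?g2 r) \<partial>lborel)"
      using zero_one_Rats unfolding increment_bound_def by fastforce
    also have "\<dots> = (\<integral>\<^sup>+r\<in>{0..1}. ennreal (if \<gamma> r \<in> A then G1 (\<gamma> r) else G2 (\<gamma> r)) * ennreal (speed \<gamma> r) \<partial>lborel)"
      by (intro nn_integral_cong) simp
    finally show ?case .
  qed
qed

text \<open>The one-dimensional statement detects zeros of \<open>f - c\<close> only at good times,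
  so here these must have full measure; rational times alone would miss zeros.\<close>

lemma off_level_plan_le:
  assumes f: "f \<in> borel_measurable borel" and G: "weak_upper_gradient m p f G"
  shows "(\<integral>\<^sup>+\<gamma>. ennreal \<bar>f (\<gamma> 1) - f (\<gamma> 0)\<bar> \<partial>\<pi>) \<le> plan_integral \<pi> (\<lambda>x. ennreal (if f x = c then 0 else G x))"
proof (rule increment_le_plan_integral)
  have L: "G \<in> Lp m p" using G by (auto simp: weak_upper_gradient_def)
  show "AE \<gamma> in \<pi>. ennreal (dist (f (\<gamma> 0)) (f (\<gamma> 1))) \<le>
      (\<integral>\<^sup>+r\<in>{0..1}. ennreal (if f (\<gamma> r) = c then 0 else G (\<gamma> r)) * ennreal (speed \<gamma> r) \<partial>lborel)"
    using AE_good_times[OF f G] integrand_finite_AE[OF L] AE_space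
  proof eventually_elim
    case (elim \<gamma>)
    let ?g = "\<lambda>r. ennreal (G (\<gamma> r)) * ennreal (speed \<gamma> r)" and ?w = "\<lambda>t. f (\<gamma> t) - c" and ?T = "good_times f G \<gamma>"
    have m: "?g \<in> borel_measurable borel"
      using measurable_integrand_curve[OF _ elim(3), of "\<lambda>x. ennreal (G x)"] Lp_borel[OF L] by auto
    have "increment_bound ?T ?w ?g"
      using increment_bound_good_times[OF L elim(3), of f] by (simp add: increment_bound_def dist_real_def)
    then have "increment_bound ?T ?w (\<lambda>r. if ?w r = 0 then 0 else ?g r)"
      by (rule increment_bound_off_zeros[OF _ m elim(2)]) (use elim(1) in \<open>auto simp: good_times_def\<close>)
    moreover have "0 \<in> ?T" "1 \<in> ?T" using elim(1) zero_one_Rats by blast+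
    ultimately have "ennreal (dist (?w 0) (?w 1)) \<le> (\<integral>\<^sup>+r\<in>{0..1}. (if ?w r = 0 then 0 else ?g r) \<partial>lborel)"
      unfolding increment_bound_def by fastforce
    also have "\<dots> = (\<integral>\<^sup>+r\<in>{0..1}. ennreal (if f (\<gamma> r) = c then 0 else G (\<gamma> r)) * ennreal (speed \<gamma> r) \<partial>lborel)"
      by (intro nn_integral_cong) simp
    finally show ?case by (simp add: dist_real_def)
  qed
qed

text \<open>On an absolutely continuous curve the Lipschitz constant and the metric speed control
  increments at all times, so the bound can be set to zero where \<open>\<eta>\<close> vanishes with
  all of \<open>{0..1}\<close> as good times.\<close>

lemma lipschitz_plan_le:
  assumes \<eta>: "L-lipschitz_on UNIV \<eta>"
  shows "(\<integral>\<^sup>+\<gamma>. ennreal \<bar>\<eta> (\<gamma> 1) - \<eta> (\<gamma> 0)\<bar> \<partial>\<pi>) \<le> plan_integral \<pi> (\<lambda>x. ennreal (if \<eta> x = 0 then 0 else L))"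
proof (rule increment_le_plan_integral)
  have L: "0 \<le> L" using \<eta> by (rule lipschitz_on_nonneg)
  have \<eta>m[measurable]: "\<eta> \<in> borel_measurable borel"
    by (intro borel_measurable_continuous_onI lipschitz_on_continuous_on[OF \<eta>])
  let ?h = "\<lambda>x. ennreal (if \<eta> x = 0 then 0 else L)"
  have hm: "?h \<in> borel_measurable borel" by measurable
  define S where "S \<gamma> = (\<integral>\<^sup>+t. ennreal (speed \<gamma> t powr q) \<partial>lborel)" for \<gamma> :: "real \<Rightarrow> 'a"
  define A where "A \<gamma> = ennreal (dist (\<eta> (\<gamma> 0)) (\<eta> (\<gamma> 1)))" for \<gamma> :: "real \<Rightarrow> 'a"
  define B where "B \<gamma> = curve_integral \<gamma> {0..1} ?h" for \<gamma> :: "real \<Rightarrow> 'a"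
  have Sm: "S \<in> borel_measurable \<pi>"
    unfolding S_def by (rule measurable_inner_integral) measurable
  have Am: "A \<in> borel_measurable \<pi>"
    unfolding A_def by (rule measurable_increment[OF \<eta>m]) auto
  have Bm: "B \<in> borel_measurable \<pi>"
    unfolding B_def by (rule measurable_set_integral_speed[OF hm])
  \<comment> \<open>Finiteness of \<open>S\<close> enters as a premise because it supplies the
    finite integral of the bound on the curve; it is discharged separately for almost every curve,
    from the finite energy of the plan.\<close>
  have "AE \<gamma> in \<pi>. S \<gamma> < \<infinity> \<longrightarrow> A \<gamma> \<le> B \<gamma>"
  proof (rule AE_AC)
    show "{\<gamma> \<in> space \<pi>. S \<gamma> < \<infinity> \<longrightarrow> A \<gamma> \<le> B \<gamma>} \<in> sets \<pi>"
      by (intro sets.sets_Collect_imp borel_measurable_le[OF Am Bm] borel_measurable_less[OF Sm]) simp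
    fix \<gamma> :: "real \<Rightarrow> 'a" assume AC: "\<gamma> \<in> AC q"
    then have \<gamma>: "\<gamma> \<in> space \<pi>" by (simp add: AC_def space_plan)
    note curve_plan(2)[OF \<gamma>, measurable]
    show "S \<gamma> < \<infinity> \<longrightarrow> A \<gamma> \<le> B \<gamma>"
    proof
      assume "S \<gamma> < \<infinity>"
      then have fin: "(\<integral>\<^sup>+t. ennreal (speed \<gamma> t powr q) \<partial>lborel) < \<infinity>" by (simp add: S_def)
      let ?g = "\<lambda>r. ennreal L * ennreal (speed \<gamma> r)"
      have "(set_nn_integral lborel {0..1} ?g) \<le> (\<integral>\<^sup>+r. ennreal L * (indicator {0..1} r + ennreal (speed \<gamma> r powr q)) \<partial>lborel)"
        by (intro nn_integral_mono) (auto intro!: mult_left_mono ennreal_le_one_plus_powr q split: split_indicator)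
      also have "\<dots> = ennreal L * (1 + (\<integral>\<^sup>+t. ennreal (speed \<gamma> t powr q) \<partial>lborel))"
        by (simp add: nn_integral_cmult nn_integral_add)
      also have "\<dots> < \<infinity>" using fin by (simp add: ennreal_mult_less_top)
      finally have gfin: "(set_nn_integral lborel {0..1} ?g) < \<infinity>" .
      have "increment_bound {0..1} (\<lambda>t. \<eta> (\<gamma> t)) ?g"
        unfolding increment_bound_def
      proof (intro ballI impI)
        fix s t :: real assume st: "s \<in> {0..1}" "t \<in> {0..1}" "s < t"
        have "ennreal (dist (\<eta> (\<gamma> s)) (\<eta> (\<gamma> t))) \<le> ennreal (L * dist (\<gamma> s) (\<gamma> t))"
          by (intro ennreal_leI lipschitz_onD[OF \<eta>]) auto
        also have "\<dots> = ennreal L * ennreal (dist (\<gamma> s) (\<gamma> t))" using L by (simp add: ennreal_mult)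
        also have "\<dots> \<le> ennreal L * (\<integral>\<^sup>+r\<in>{s..t}. ennreal (metric_speed \<gamma> r) \<partial>lborel)"
          using AC_increment_bound_metric_speed[OF AC q] st by (intro mult_left_mono) (auto simp: increment_bound_def)
        also have "(\<integral>\<^sup>+r\<in>{s..t}. ennreal (metric_speed \<gamma> r) \<partial>lborel) = (\<integral>\<^sup>+r\<in>{s..t}. ennreal (speed \<gamma> r) \<partial>lborel)"
          by (intro nn_integral_cong) (use st in \<open>auto simp: speed_def split: split_indicator\<close>)
        also have "ennreal L * (\<integral>\<^sup>+r\<in>{s..t}. ennreal (speed \<gamma> r) \<partial>lborel) = (set_nn_integral lborel {s..t} ?g)"
          by (subst nn_integral_cmult[symmetric]) (auto simp: mult.assoc)
        finally show "ennreal (dist (\<eta> (\<gamma> s)) (\<eta> (\<gamma> t))) \<le> (set_nn_integral lborel {s..t} ?g)" .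
      qed
      then have "increment_bound {0..1} (\<lambda>t. \<eta> (\<gamma> t)) (\<lambda>r. if \<eta> (\<gamma> r) = 0 then 0 else ?g r)"
        by (rule increment_bound_off_zeros[OF _ _ gfin]) auto
      then have "ennreal (dist (\<eta> (\<gamma> 0)) (\<eta> (\<gamma> 1))) \<le> (\<integral>\<^sup>+r\<in>{0..1}. (if \<eta> (\<gamma> r) = 0 then 0 else ?g r) \<partial>lborel)"
        by (simp add: increment_bound_def)
      also have "\<dots> = curve_integral \<gamma> {0..1} ?h"
        by (intro nn_integral_cong) simp
      finally show "A \<gamma> \<le> B \<gamma>" unfolding A_def B_def .
    qed
  qed
  moreover have "AE \<gamma> in \<pi>. S \<gamma> \<noteq> \<infinity>"
    by (rule nn_integral_PInf_AE[OF Sm]) (use speed_integral_finite in \<open>simp add: S_def[abs_def]\<close>)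
  ultimately have "AE \<gamma> in \<pi>. A \<gamma> \<le> B \<gamma>"
    by eventually_elim (simp add: less_top)
  then show "AE \<gamma> in \<pi>. ennreal (dist (\<eta> (\<gamma> 0)) (\<eta> (\<gamma> 1))) \<le> curve_integral \<gamma> {0..1} ?h"
    unfolding A_def B_def .
qed

text \<open>Works directly with the integrated inequality. One comparison of increments covers sums,
  differences and the coarse product rule.\<close>

lemma dominated_plan_le:
  assumes f: "g \<in> borel_measurable borel" "h \<in> borel_measurable borel"
    and G: "weak_upper_gradient m p g G" and H: "weak_upper_gradient m p h H"
    and ab: "0 \<le> a" "0 \<le> b" and le: "\<And>x y. \<bar>f x - f y\<bar> \<le> a * \<bar>g x - g y\<bar> + b * \<bar>h x - h y\<bar>"
  shows "(\<integral>\<^sup>+\<gamma>. ennreal \<bar>f (\<gamma> 1) - f (\<gamma> 0)\<bar> \<partial>\<pi>) \<le> plan_integral \<pi> (\<lambda>x. ennreal (a * G x + b * H x))"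
proof -
  let ?I = "\<lambda>g. \<integral>\<^sup>+\<gamma>. ennreal \<bar>g (\<gamma> 1) - g (\<gamma> 0)\<bar> \<partial>\<pi>"
  have L: "G \<in> Lp m p" "H \<in> Lp m p" using G H by (auto simp: weak_upper_gradient_def)
  have [measurable]: "(\<lambda>x. ennreal (G x)) \<in> borel_measurable borel" "(\<lambda>x. ennreal (H x)) \<in> borel_measurable borel"
    using Lp_borel[OF L(1)] Lp_borel[OF L(2)] by measurable
  have m: "(\<lambda>\<gamma>. ennreal \<bar>g (\<gamma> 1) - g (\<gamma> 0)\<bar>) \<in> borel_measurable \<pi>" "(\<lambda>\<gamma>. ennreal \<bar>h (\<gamma> 1) - h (\<gamma> 0)\<bar>) \<in> borel_measurable \<pi>"
    using measurable_increment[OF f(1), of 1 0] measurable_increment[OF f(2), of 1 0] by (auto simp: dist_real_def)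
  have "?I f \<le>
    (\<integral>\<^sup>+\<gamma>. ennreal a * ennreal \<bar>g (\<gamma> 1) - g (\<gamma> 0)\<bar> + ennreal b * ennreal \<bar>h (\<gamma> 1) - h (\<gamma> 0)\<bar> \<partial>\<pi>)"
    using le ab by (intro nn_integral_mono) (auto intro!: ennreal_leI simp flip: ennreal_mult ennreal_plus)
  also have "\<dots> = ennreal a * ?I g + ennreal b * ?I h"
    using m by (simp add: nn_integral_add nn_integral_cmult)
  also have "\<dots> \<le> ennreal a * plan_integral \<pi> (\<lambda>x. ennreal (G x)) + ennreal b * plan_integral \<pi> (\<lambda>x. ennreal (H x))"
    using G H plan unfolding weak_upper_gradient_iff by (intro add_mono mult_left_mono) auto
  also have "\<dots> = plan_integral \<pi> (\<lambda>x. ennreal a * ennreal (G x) + ennreal b * ennreal (H x))"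
    by (subst plan_integral_add) (simp_all add: plan_integral_cmult)
  also have "\<dots> \<le> plan_integral \<pi> (\<lambda>x. ennreal (a * G x + b * H x))"
  proof (rule plan_integral_mono_AE)
    have "AE x in m. 0 \<le> G x" "AE x in m. 0 \<le> H x" using G H by (auto simp: weak_upper_gradient_def)
    then show "AE x in m. ennreal a * ennreal (G x) + ennreal b * ennreal (H x) \<le> ennreal (a * G x + b * H x)"
      by eventually_elim (use ab in \<open>simp flip: ennreal_mult ennreal_plus\<close>)
  qed
  finally show ?thesis .
qed

text \<open>Dominated convergence for the product of the plan with Lebesgue measure, where |H| times
  the speed has a finite integral.\<close>

lemma decreasing_limit_plan_le:
  assumes K: "\<And>n. K n \<in> borel_measurable borel" "\<And>x. (\<lambda>n. K n x) \<longlonglongrightarrow> K' x" "\<And>n x. \<bar>K n x\<bar> \<le> \<bar>H x\<bar>"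
    and K': "K' \<in> borel_measurable borel" and H: "H \<in> Lp m p"
    and le: "\<And>n. I \<le> plan_integral \<pi> (\<lambda>x. ennreal (K n x))"
  shows "I \<le> plan_integral \<pi> (\<lambda>x. ennreal (K' x))"
proof -
  have [measurable]: "H \<in> borel_measurable borel" by (rule Lp_borel[OF H])
  note K(1)[measurable] K'[measurable]
  let ?i = "\<lambda>K x. ennreal (K (fst x (snd x))) * ennreal (speed (fst x) (snd x))" and ?H = "\<lambda>x. \<bar>H x\<bar>"
  let ?P = "\<pi> \<Otimes>\<^sub>M (lborel :: real measure)"
  have "(\<lambda>n. plan_integral \<pi> (\<lambda>x. ennreal (K n x))) \<longlonglongrightarrow> plan_integral \<pi> (\<lambda>x. ennreal (K' x))"
    unfolding plan_integral_pair[OF measurable_compose_rev[OF measurable_ennreal K(1)]]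
      plan_integral_pair[OF measurable_compose_rev[OF measurable_ennreal K']]
  proof (rule nn_integral_dominated_convergence[where w="\<lambda>x. ?i ?H x"])
    show "(\<lambda>x. ?i (K n) x) \<in> borel_measurable ?P" for n
      by (rule measurable_integrand_pair) measurable
    show "(\<lambda>x. ?i K' x) \<in> borel_measurable ?P"
      by (rule measurable_integrand_pair[of "\<lambda>x. ennreal (K' x)"]) measurable
    show "(\<lambda>x. ?i ?H x) \<in> borel_measurable ?P"
      by (rule measurable_integrand_pair[of "\<lambda>x. ennreal \<bar>H x\<bar>"]) measurable
    show "AE x in ?P. ?i (K n) x \<le> ?i ?H x" for n
      using K(3) by (intro AE_I2 mult_right_mono ennreal_leI) (auto intro: order_trans[OF abs_ge_self])
    show "(\<integral>\<^sup>+x. ?i ?H x \<partial>?P) < \<infinity>"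
      using plan_integral_finite[OF H] by (subst (asm) plan_integral_pair) auto
    show "AE x in ?P. (\<lambda>n. ?i (K n) x) \<longlonglongrightarrow> ?i K' x"
    proof (rule AE_I2)
      fix x
      have "(\<lambda>n. ennreal (speed (fst x) (snd x)) * ennreal (K n (fst x (snd x)))) \<longlonglongrightarrow> ennreal (speed (fst x) (snd x)) * ennreal (K' (fst x (snd x)))"
        by (intro ennreal_tendsto_cmult tendsto_ennrealI K(2)) simp
      then show "(\<lambda>n. ?i (K n) x) \<longlonglongrightarrow> ?i K' x"
        by (simp only: mult.commute)
    qed
  qed
  then show ?thesis by (rule Lim_bounded2[where N=0]) (use le in auto)
qed

end

subsection \<open>Minimal weak upper gradients\<close>

locale sobolev_setting =
  fixes m :: "'a::polish_space measure" and p :: real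
  assumes sets_m [measurable_cong]: "sets m = sets borel" and p: "1 < p"
begin

lemma setting: "test_plan m (conj_exp p) \<pi> \<Longrightarrow> test_plan_setting m p \<pi>"
  by unfold_locales (rule sets_m, rule p)

lemma measurable_m_iff: "f \<in> borel_measurable m \<longleftrightarrow> f \<in> borel_measurable borel"
  using measurable_cong_sets[OF sets_m refl] by auto

lemma wug_Lp: "weak_upper_gradient m p f G \<Longrightarrow> G \<in> Lp m p"
  and wug_nonneg: "weak_upper_gradient m p f G \<Longrightarrow> AE x in m. 0 \<le> G x"
  by (auto simp: weak_upper_gradient_def)

lemma wug_borel: "weak_upper_gradient m p f G \<Longrightarrow> G \<in> borel_measurable borel"
  using wug_Lp by (auto simp: Lp_def measurable_m_iff)

lemma wug_piecewise:
  assumes f: "f \<in> borel_measurable borel" and G1: "weak_upper_gradient m p f G1"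
    and G2: "weak_upper_gradient m p f G2" and A: "A \<in> sets borel"
  shows "weak_upper_gradient m p f (\<lambda>x. if x \<in> A then G1 x else G2 x)"
  unfolding weak_upper_gradient_iff
proof (intro conjI allI impI)
  note wug_borel[OF G1, measurable] wug_borel[OF G2, measurable] A[measurable]
  show "(\<lambda>x. if x \<in> A then G1 x else G2 x) \<in> Lp m p"
    by (rule Lp_bound[OF _ Lp_add[OF Lp_abs[OF wug_Lp[OF G1]] Lp_abs[OF wug_Lp[OF G2]] p] p])
      (auto simp: measurable_m_iff)
  show "AE x in m. 0 \<le> (if x \<in> A then G1 x else G2 x)"
    using wug_nonneg[OF G1] wug_nonneg[OF G2] by eventually_elim auto
qed (rule test_plan_setting.piecewise_plan_le[OF setting f G1 G2 A])

lemma wug_off_level: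
  assumes f: "f \<in> borel_measurable borel" and G: "weak_upper_gradient m p f G"
  shows "weak_upper_gradient m p f (\<lambda>x. if f x = c then 0 else G x)"
  unfolding weak_upper_gradient_iff
proof (intro conjI allI impI)
  note wug_borel[OF G, measurable] f[measurable]
  show "(\<lambda>x. if f x = c then 0 else G x) \<in> Lp m p"
    by (rule Lp_bound[OF _ wug_Lp[OF G] p]) (auto simp: measurable_m_iff)
  show "AE x in m. 0 \<le> (if f x = c then 0 else G x)"
    using wug_nonneg[OF G] by eventually_elim auto
qed (rule test_plan_setting.off_level_plan_le[OF setting f G])

lemma wug_dominated:
  assumes f: "g \<in> borel_measurable borel" "h \<in> borel_measurable borel"
    and G: "weak_upper_gradient m p g G" and H: "weak_upper_gradient m p h H"
    and ab: "0 \<le> a" "0 \<le> b" and le: "\<And>x y. \<bar>f x - f y\<bar> \<le> a * \<bar>g x - g y\<bar> + b * \<bar>h x - h y\<bar>"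
  shows "weak_upper_gradient m p f (\<lambda>x. a * G x + b * H x)"
  unfolding weak_upper_gradient_iff
proof (intro conjI allI impI)
  show "(\<lambda>x. a * G x + b * H x) \<in> Lp m p"
    by (intro Lp_add Lp_cmult wug_Lp[OF G] wug_Lp[OF H] p)
  show "AE x in m. 0 \<le> a * G x + b * H x"
    using wug_nonneg[OF G] wug_nonneg[OF H] by eventually_elim (use ab in auto)
qed (rule test_plan_setting.dominated_plan_le[OF setting f G H ab le])

lemma indicator_bounded_Lp:
  assumes mm: "metric_measure_space m" and B: "B \<in> sets borel" "bounded B"
  shows "(\<lambda>x. c * indicator B x) \<in> Lp m r"
proof -
  have "emeasure m B < \<infinity>" using mm B by (auto simp: metric_measure_space_def)
  then have "integrable m (\<lambda>x. \<bar>c\<bar> powr r * indicator B x)"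
    using B by (simp add: sets_m integrable_real_indicator)
  moreover have "(\<lambda>x. \<bar>c * indicator B x\<bar> powr r) = (\<lambda>x. \<bar>c\<bar> powr r * indicator B x)"
    by (auto split: split_indicator)
  ultimately show ?thesis using B by (simp add: Lp_def measurable_m_iff)
qed

lemma Lip_bs_borel: "\<eta> \<in> Lip_bs \<Longrightarrow> \<eta> \<in> borel_measurable borel"
  by (auto simp: Lip_bs_def intro!: borel_measurable_continuous_onI intro: lipschitz_on_continuous_on)

lemma Lip_bs_support:
  assumes "\<eta> \<in> Lip_bs"
  shows "bounded {x. \<eta> x \<noteq> 0}" "{x. \<eta> x \<noteq> 0} \<in> sets borel"
proof -
  note Lip_bs_borel[OF assms, measurable]
  show "{x. \<eta> x \<noteq> 0} \<in> sets borel" by measurable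
  show "bounded {x. \<eta> x \<noteq> 0}" using assms bounded_subset[OF _ closure_subset] by (auto simp: Lip_bs_def)
qed

text \<open>A constant gradient \<open>L\<close> need not lie in \<open>Lp m p\<close>; cut off
  outside the bounded set where \<open>\<eta>\<close> is nonzero, it does.\<close>

lemma wug_Lip_bs:
  assumes mm: "metric_measure_space m" and \<eta>: "\<eta> \<in> Lip_bs" and L: "L-lipschitz_on UNIV \<eta>"
  shows "weak_upper_gradient m p \<eta> (\<lambda>x. if \<eta> x = 0 then 0 else L)"
  unfolding weak_upper_gradient_iff
proof (intro conjI allI impI)
  have "(\<lambda>x. L * indicator {x. \<eta> x \<noteq> 0} x) \<in> Lp m p"
    by (rule indicator_bounded_Lp[OF mm Lip_bs_support(2,1)[OF \<eta>]])
  also have "(\<lambda>x. L * indicator {x. \<eta> x \<noteq> 0} x) = (\<lambda>x. if \<eta> x = 0 then 0 else L)" by auto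
  finally show "(\<lambda>x. if \<eta> x = 0 then 0 else L) \<in> Lp m p" .
  show "AE x in m. 0 \<le> (if \<eta> x = 0 then 0 else L)"
    using lipschitz_on_nonneg[OF L] by simp
qed (rule test_plan_setting.lipschitz_plan_le[OF setting L])

text \<open>Finite minima of weak upper gradients are weak upper gradients, so a minimising sequence for
  the \<open>L\<^sup>p\<close> norm can be taken decreasing; its limit is the minimal one.\<close>

lemma minimal_wug_exists:
  assumes f: "f \<in> borel_measurable borel" and ex: "\<exists>G. weak_upper_gradient m p f G"
  shows "\<exists>G. weak_upper_gradient m p f G \<and> (\<forall>G'. weak_upper_gradient m p f G' \<longrightarrow> (AE x in m. G x \<le> G' x))"
proof -
  define W where "W = {G. weak_upper_gradient m p f G}"
  define \<Phi> where "\<Phi> G = (\<integral>\<^sup>+x. ennreal (\<bar>G x\<bar> powr p) \<partial>m)" for G :: "'a \<Rightarrow> real"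
  define I where "I = (INF G\<in>W. \<Phi> G)"
  have W: "W \<noteq> {}" using ex by (auto simp: W_def)
  have \<Phi>fin: "\<Phi> G < \<infinity>" if "G \<in> W" for G
    using wug_Lp[of f G] that by (auto simp: W_def \<Phi>_def Lp_def integrable_iff_bounded)
  have "\<exists>G\<in>W. \<Phi> G < I + ennreal (1 / real (Suc n))" for n
  proof -
    have "I < \<infinity>" using W \<Phi>fin unfolding I_def by (metis INF_lower all_not_in_conv le_less_trans)
    then have "I < I + ennreal (1 / real (Suc n))"
      by (cases I) (auto simp: ennreal_less_iff simp del: of_nat_Suc simp flip: ennreal_plus)
    then show ?thesis unfolding I_def by (auto simp: INF_less_iff)
  qed
  then obtain Gs where Gs: "\<And>n. Gs n \<in> W" "\<And>n. \<Phi> (Gs n) < I + ennreal (1 / real (Suc n))" by metis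
  \<comment> \<open>Running minima of the minimising sequence, in the form that gluing along a Borel
    set provides.\<close>
  define H where "H = rec_nat (Gs 0) (\<lambda>n h x. if x \<in> {x. h x \<le> Gs (Suc n) x} then h x else Gs (Suc n) x)"
  have H0: "H 0 = Gs 0" and HS: "H (Suc n) = (\<lambda>x. if x \<in> {x. H n x \<le> Gs (Suc n) x} then H n x else Gs (Suc n) x)" for n
    by (auto simp: H_def)
  have HW: "weak_upper_gradient m p f (H n)" for n
  proof (induction n)
    case 0
    then show ?case using Gs(1)[of 0] by (simp add: H0 W_def)
  next
    case (Suc n)
    have G: "weak_upper_gradient m p f (Gs (Suc n))" using Gs(1)[of "Suc n"] by (simp add: W_def)
    note wug_borel[OF Suc, measurable] wug_borel[OF G, measurable]
    have "{x. H n x \<le> Gs (Suc n) x} \<in> sets borel" by measurable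
    then show ?case unfolding HS by (rule wug_piecewise[OF f Suc G])
  qed
  \<comment> \<open>Weak upper gradients are nonnegative only almost everywhere; the positive part
    bounds the infimum from below at every point.\<close>
  define K where "K n x = max 0 (H n x)" for n x
  have Kdec: "decseq (\<lambda>n. K n x)" for x
    by (rule decseq_SucI) (auto simp: K_def HS)
  have Kbdd: "bdd_below (range (\<lambda>n. K n x))" for x by (rule bdd_belowI[of _ 0]) (auto simp: K_def)
  have Km[measurable]: "K n \<in> borel_measurable borel" for n
    unfolding K_def using wug_borel[OF HW] by measurable
  define K' where "K' x = (INF n. K n x)" for x
  have lim: "(\<lambda>n. K n x) \<longlonglongrightarrow> K' x" for x
    unfolding K'_def by (rule LIMSEQ_decseq_INF[OF Kbdd Kdec])
  have K'm[measurable]: "K' \<in> borel_measurable borel"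
    by (rule borel_measurable_LIMSEQ_real[OF lim]) measurable
  have K'le: "K' x \<le> K n x" for x n unfolding K'_def by (rule cINF_lower[OF Kbdd]) simp
  have K'0: "0 \<le> K' x" for x unfolding K'_def by (rule cINF_greatest) (auto simp: K_def)
  have HGs: "H n x \<le> Gs n x" for n x by (cases n) (auto simp: H0 HS)
  have K'Gs: "K' x \<le> \<bar>Gs n x\<bar>" for n x using K'le[of x n] HGs[of n x] by (auto simp: K_def)
  have K'wug: "weak_upper_gradient m p f K'"
    unfolding weak_upper_gradient_iff
  proof (intro conjI allI impI)
    show "K' \<in> Lp m p"
      by (rule Lp_bound[OF _ wug_Lp[OF HW[of 0]] p]) (use K'Gs K'0 in \<open>auto simp: measurable_m_iff H0\<close>)
    show "AE x in m. 0 \<le> K' x" using K'0 by simp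
    fix \<pi> assume \<pi>: "test_plan m (conj_exp p) \<pi>"
    interpret test_plan_setting m p \<pi> by (rule setting[OF \<pi>])
    show "(\<integral>\<^sup>+\<gamma>. ennreal \<bar>f (\<gamma> 1) - f (\<gamma> 0)\<bar> \<partial>\<pi>) \<le> plan_integral \<pi> (\<lambda>x. ennreal (K' x))"
    proof (rule decreasing_limit_plan_le[OF Km lim _ K'm wug_Lp[OF HW[of 0]]])
      show "\<bar>K n x\<bar> \<le> \<bar>H 0 x\<bar>" for n x
        using decseqD[OF Kdec, of 0 n x] by (auto simp: K_def)
      show "(\<integral>\<^sup>+\<gamma>. ennreal \<bar>f (\<gamma> 1) - f (\<gamma> 0)\<bar> \<partial>\<pi>) \<le> plan_integral \<pi> (\<lambda>x. ennreal (K n x))" for n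
      proof -
        have "(\<integral>\<^sup>+\<gamma>. ennreal \<bar>f (\<gamma> 1) - f (\<gamma> 0)\<bar> \<partial>\<pi>) \<le> plan_integral \<pi> (\<lambda>x. ennreal (H n x))"
          using HW[of n] \<pi> by (simp add: weak_upper_gradient_iff)
        also have "\<dots> \<le> plan_integral \<pi> (\<lambda>x. ennreal (K n x))"
          by (intro plan_integral_mono_AE) (auto simp: K_def intro!: ennreal_leI)
        finally show ?thesis .
      qed
    qed
  qed
  have "\<Phi> K' \<le> I"
  proof (rule ennreal_le_epsilon)
    fix e :: real assume e: "0 < e"
    obtain n where n: "1 / real (Suc n) < e" using nat_approx_posE e by blast
    have "\<Phi> K' \<le> \<Phi> (Gs n)" unfolding \<Phi>_def
      by (intro nn_integral_mono ennreal_leI powr_mono2) (use p K'0 K'Gs in auto)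
    also have "\<dots> \<le> I + ennreal (1 / real (Suc n))" using Gs(2)[of n] by simp
    also have "\<dots> \<le> I + ennreal e" using n by (intro add_left_mono ennreal_leI) simp
    finally show "\<Phi> K' \<le> I + ennreal e" .
  qed
  show ?thesis
  proof (intro exI conjI allI impI)
    show "weak_upper_gradient m p f K'" by (rule K'wug)
    fix G' assume G': "weak_upper_gradient m p f G'"
    note wug_borel[OF G', measurable]
    \<comment> \<open>The minimum of \<open>K'\<close> and the competitor is again admissible, so
      its norm cannot fall below the infimum; this forces \<open>K' x \<le> G' x\<close> almost
      everywhere.\<close>
    define M where "M x = (if x \<in> {x. K' x \<le> G' x} then K' x else G' x)" for x
    have M: "weak_upper_gradient m p f M"
      unfolding M_def by (rule wug_piecewise[OF f K'wug G']) measurable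
    note wug_borel[OF M, measurable]
    have M0: "AE x in m. \<bar>M x\<bar> powr p \<le> \<bar>K' x\<bar> powr p"
      using wug_nonneg[OF G']
      by eventually_elim (use p K'0 in \<open>auto simp: M_def intro!: powr_mono2\<close>)
    have "AE x in m. ennreal (\<bar>K' x\<bar> powr p) \<le> ennreal (\<bar>M x\<bar> powr p)"
    proof (rule ccontr)
      assume "\<not> ?thesis"
      then have "\<Phi> M < \<Phi> K'"
        unfolding \<Phi>_def
      proof (rule nn_integral_less[rotated -1])
        show "(\<integral>\<^sup>+x. ennreal (\<bar>M x\<bar> powr p) \<partial>m) \<noteq> \<infinity>"
          using \<Phi>fin[of M] M by (simp add: W_def \<Phi>_def)
        show "AE x in m. ennreal (\<bar>M x\<bar> powr p) \<le> ennreal (\<bar>K' x\<bar> powr p)"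
          using M0 by eventually_elim (rule ennreal_leI)
      qed measurable
      moreover have "I \<le> \<Phi> M" unfolding I_def by (rule INF_lower) (simp add: W_def M)
      ultimately show False using \<open>\<Phi> K' \<le> I\<close> by order
    qed
    then show "AE x in m. K' x \<le> G' x"
      using wug_nonneg[OF G']
    proof eventually_elim
      case (elim x)
      show ?case
      proof (rule ccontr)
        assume n: "\<not> K' x \<le> G' x"
        then have "G' x powr p < K' x powr p"
          using elim p by (intro powr_less_mono2) auto
        then show False using elim n K'0[of x] by (simp add: M_def)
      qed
    qed
  qed
qed

section \<open>Minimality and locality of the gradient\<close>

lemma wgrad_minimal:
  assumes "f \<in> Sp m p"
  shows "weak_upper_gradient m p f (wgrad m p f)"
    and "weak_upper_gradient m p f G \<Longrightarrow> AE x in m. wgrad m p f x \<le> G x"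
proof -
  have "\<exists>G. weak_upper_gradient m p f G \<and> (\<forall>G'. weak_upper_gradient m p f G' \<longrightarrow> (AE x in m. G x \<le> G' x))"
    using assms by (intro minimal_wug_exists) (auto simp: Sp_def)
  from someI_ex[OF this] show "weak_upper_gradient m p f (wgrad m p f)"
    and "weak_upper_gradient m p f G \<Longrightarrow> AE x in m. wgrad m p f x \<le> G x"
    unfolding wgrad_def by auto
qed

lemma Sp_borel: "f \<in> Sp m p \<Longrightarrow> f \<in> borel_measurable borel"
  by (simp add: Sp_def)

text \<open>The gradient set to zero on the level is still admissible, so minimality makes it vanish
  there.\<close>

lemma wgrad_level:
  assumes f: "f \<in> Sp m p"
  shows "AE x in m. f x = c \<longrightarrow> wgrad m p f x = 0"
  using wgrad_minimal(2)[OF f wug_off_level[OF Sp_borel[OF f] wgrad_minimal(1)[OF f], of c]]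
    wug_nonneg[OF wgrad_minimal(1)[OF f]]
  by eventually_elim auto

text \<open>Write f = g + (f - g). The gradient of the difference may be set to zero where f = g, so
  the bound for the sum reduces there to the gradient of \<open>g\<close>.\<close>

lemma wgrad_local_le:
  assumes f: "f \<in> Sp m p" and g: "g \<in> Sp m p"
  shows "AE x in m. f x = g x \<longrightarrow> wgrad m p f x \<le> wgrad m p g x"
proof -
  let ?F = "wgrad m p f" and ?G = "wgrad m p g" and ?d = "\<lambda>x. f x - g x"
  note Sp_borel[OF f, measurable] Sp_borel[OF g, measurable]
  have d: "?d \<in> borel_measurable borel" by measurable
  have "weak_upper_gradient m p ?d (\<lambda>x. 1 * ?F x + 1 * ?G x)"
    by (rule wug_dominated[OF Sp_borel[OF f] Sp_borel[OF g] wgrad_minimal(1)[OF f] wgrad_minimal(1)[OF g]]) auto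
  then have "weak_upper_gradient m p ?d (\<lambda>x. if ?d x = 0 then 0 else 1 * ?F x + 1 * ?G x)"
    by (rule wug_off_level[OF d])
  then have "weak_upper_gradient m p f (\<lambda>x. 1 * ?G x + 1 * (if ?d x = 0 then 0 else 1 * ?F x + 1 * ?G x))"
    by (rule wug_dominated[OF Sp_borel[OF g] d wgrad_minimal(1)[OF g]]) auto
  from wgrad_minimal(2)[OF f this] show ?thesis
    by eventually_elim auto
qed

lemma wgrad_local:
  assumes f: "f \<in> Sp m p" and g: "g \<in> Sp m p"
  shows "AE x in m. f x = g x \<longrightarrow> wgrad m p f x = wgrad m p g x"
  using wgrad_local_le[OF f g] wgrad_local_le[OF g f] by eventually_elim auto

end

subsection \<open>Truncations\<close>

definition cutoff :: "'a::metric_space \<Rightarrow> nat \<Rightarrow> 'a \<Rightarrow> real" where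
  "cutoff c n x = max 0 (min 1 (real n + 1 - dist c x))"

lemma cutoff_eq_1: "dist c x \<le> real n \<Longrightarrow> cutoff c n x = 1"
  by (simp add: cutoff_def)

lemma cutoff_Lip_bs: "cutoff c n \<in> Lip_bs"
  unfolding Lip_bs_def
proof (intro CollectI conjI exI)
  show "1-lipschitz_on UNIV (cutoff c n)"
  proof (rule lipschitz_onI)
    fix x y
    have "\<bar>dist c x - dist c y\<bar> \<le> dist x y" using abs_dist_diff_le[of x c y] by (simp add: dist_commute)
    then show "dist (cutoff c n x) (cutoff c n y) \<le> 1 * dist x y"
      unfolding cutoff_def dist_real_def by (simp add: max_def min_def abs_le_iff)
  qed simp
  have "{x. cutoff c n x \<noteq> 0} \<subseteq> cball c (real n + 1)" by (auto simp: cutoff_def max_def min_def split: if_splits)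
  then show "bounded (closure {x. cutoff c n x \<noteq> 0})" by (meson bounded_cball bounded_closure bounded_subset)
qed

lemma Lip_bs_bounded:
  assumes "\<eta> \<in> Lip_bs"
  obtains N where "0 \<le> N" "\<And>x. \<bar>\<eta> x\<bar> \<le> N"
proof -
  obtain L where L: "L-lipschitz_on UNIV \<eta>" using assms by (auto simp: Lip_bs_def)
  have "bounded {x. \<eta> x \<noteq> 0}" using assms bounded_subset[OF _ closure_subset] by (auto simp: Lip_bs_def)
  then obtain c e where ce: "\<And>x. \<eta> x \<noteq> 0 \<Longrightarrow> dist c x \<le> e" by (auto simp: bounded_def)
  have L0: "0 \<le> L" by (rule lipschitz_on_nonneg[OF L])
  have "\<bar>\<eta> x\<bar> \<le> \<bar>\<eta> c\<bar> + L * \<bar>e\<bar>" for x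
  proof (cases "\<eta> x = 0")
    case False
    have "\<bar>\<eta> c - \<eta> x\<bar> \<le> L * dist c x" using lipschitz_onD[OF L, of c x] by (simp add: dist_real_def)
    also have "\<dots> \<le> L * \<bar>e\<bar>" using ce[OF False] L0 by (intro mult_left_mono) auto
    finally show ?thesis by linarith
  qed (use L0 in auto)
  then show ?thesis using that[of "\<bar>\<eta> c\<bar> + L * \<bar>e\<bar>"] L0 by simp
qed

lemma trunc_bound: "0 < k \<Longrightarrow> \<bar>trunc k f x\<bar> \<le> k"
  and trunc_eq: "\<bar>f x\<bar> < k \<Longrightarrow> trunc k f x = f x"
  by (auto simp: trunc_def)

lemma trunc_eq_level: "0 < k \<Longrightarrow> k \<le> \<bar>f x\<bar> \<Longrightarrow> trunc k f x = k \<or> trunc k f x = - k"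
  by (auto simp: trunc_def)

context sobolev_setting
begin

lemma Sp_locD:
  assumes "f \<in> Sp_loc m p" "0 < k" "\<eta> \<in> Lip_bs"
  shows "(\<lambda>x. \<eta> x * trunc k f x) \<in> Sp m p"
  using assms by (auto simp: Sp_loc_def)

text \<open>The definition by choice becomes usable through a witness: at \<open>x\<close> take the
  gradient of the cutoff truncation with the least index \<open>N x\<close> that sees
  \<open>x\<close>. Locality compares it with any other truncation, simultaneously for countably
  many indices.\<close>

lemma wgrad_loc_AE:
  assumes f: "f \<in> Sp_loc m p" and k: "0 < k" and \<eta>: "\<eta> \<in> Lip_bs"
  shows "AE x in m. \<eta> x = 1 \<and> \<bar>f x\<bar> < k \<longrightarrow> wgrad_loc m p f x = wgrad m p (\<lambda>x. \<eta> x * trunc k f x) x"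
proof -
  have fm[measurable]: "f \<in> borel_measurable borel" using f by (auto simp: Sp_loc_def)
  \<comment> \<open>Centre of the cutoffs; any point serves.\<close>
  fix c :: 'a
  define u where "u n x = cutoff c n x * trunc (real n) f x" for n x
  have u: "u n \<in> Sp m p" if "0 < n" for n
    unfolding u_def using that by (intro Sp_locD[OF f _ cutoff_Lip_bs]) simp
  \<comment> \<open>Index 0 is a dummy, as truncation needs a positive level; |f x| < N x forces
    \<open>N x\<close> to be positive.\<close>
  define F where "F n = (if 0 < n then wgrad m p (u n) else (\<lambda>_. 0))" for n
  define N where "N x = (LEAST n. dist c x \<le> real n \<and> \<bar>f x\<bar> < real n)" for x
  have N: "dist c x \<le> real (N x) \<and> \<bar>f x\<bar> < real (N x)" for x
  proof -
    obtain n where "max (dist c x) \<bar>f x\<bar> < real n" using reals_Archimedean2 by blast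
    then have "dist c x \<le> real n \<and> \<bar>f x\<bar> < real n" by auto
    then show ?thesis unfolding N_def by (rule LeastI)
  qed
  have Nm: "N \<in> measurable borel (count_space UNIV)" unfolding N_def by measurable
  have Fm: "F n \<in> borel_measurable borel" for n
    using wug_borel[OF wgrad_minimal(1)[OF u]] by (auto simp: F_def)
  have Hm: "(\<lambda>x. F (N x) x) \<in> borel_measurable borel"
    by (rule measurable_compose_countable[OF Fm Nm])
  have "AE x in m. \<eta> x = 1 \<and> \<bar>f x\<bar> < k \<longrightarrow> F (N x) x = wgrad m p (\<lambda>x. \<eta> x * trunc k f x) x"
    if k: "0 < k" and \<eta>: "\<eta> \<in> Lip_bs" for k \<eta>
  proof -
    have "AE x in m. \<forall>n. 0 < n \<longrightarrow> u n x = \<eta> x * trunc k f x \<longrightarrow> wgrad m p (u n) x = wgrad m p (\<lambda>x. \<eta> x * trunc k f x) x"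
    proof (subst AE_all_countable, intro allI)
      fix n :: nat
      show "AE x in m. 0 < n \<longrightarrow> u n x = \<eta> x * trunc k f x \<longrightarrow> wgrad m p (u n) x = wgrad m p (\<lambda>x. \<eta> x * trunc k f x) x"
        using wgrad_local[OF u[of n] Sp_locD[OF f k \<eta>]] by (cases "0 < n") auto
    qed
    then show ?thesis
    proof eventually_elim
      case (elim x)
      show ?case
      proof
        assume x: "\<eta> x = 1 \<and> \<bar>f x\<bar> < k"
        have n: "0 < N x" using N[of x] by (metis abs_ge_zero le_less_trans of_nat_0_less_iff)
        have "u (N x) x = \<eta> x * trunc k f x"
          using x N[of x] by (simp add: u_def cutoff_eq_1 trunc_eq)
        then show "F (N x) x = wgrad m p (\<lambda>x. \<eta> x * trunc k f x) x" using elim n by (simp add: F_def)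
      qed
    qed
  qed
  then have "\<exists>H. H \<in> borel_measurable borel \<and> (\<forall>k>0. \<forall>\<eta>\<in>Lip_bs. AE x in m.
        \<eta> x = 1 \<and> \<bar>f x\<bar> < k \<longrightarrow> H x = wgrad m p (\<lambda>x. \<eta> x * trunc k f x) x)"
    using Hm by blast
  from someI_ex[OF this] show ?thesis unfolding wgrad_loc_def using k \<eta> by blast
qed

text \<open>Where |f| < k the two gradients agree. Elsewhere on \<open>\<eta> = 1\<close> the
  product sits at level \<open>k\<close> or \<open>- k\<close>, where its gradient vanishes, and
  nonnegativity of the local gradient concludes.\<close>

lemma wgrad_le_wgrad_loc:
  assumes f: "f \<in> Sp_loc m p" and k: "0 < k" and \<eta>: "\<eta> \<in> Lip_bs"
    and nonneg: "AE x in m. 0 \<le> wgrad_loc m p f x"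
  shows "AE x in m. \<eta> x = 1 \<longrightarrow> wgrad m p (\<lambda>x. \<eta> x * trunc k f x) x \<le> wgrad_loc m p f x"
  using wgrad_loc_AE[OF f k \<eta>] wgrad_level[OF Sp_locD[OF f k \<eta>], of k] wgrad_level[OF Sp_locD[OF f k \<eta>], of "- k"] nonneg
proof eventually_elim
  case (elim x)
  show ?case
  proof
    assume x: "\<eta> x = 1"
    show "wgrad m p (\<lambda>x. \<eta> x * trunc k f x) x \<le> wgrad_loc m p f x"
      using elim x trunc_eq_level[OF k, of f x] by (cases "\<bar>f x\<bar> < k") auto
  qed
qed

text \<open>On the support of \<open>\<eta>\<close> the function agrees with its product with a second cutoff, and
  the gradient of that product is controlled there by the local gradient of \<open>f\<close>.\<close>

lemma wgrad_truncation_bound: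
  assumes mm: "metric_measure_space m" and f: "f \<in> Sp_loc m p" and k: "0 < k" and \<eta>: "\<eta> \<in> Lip_bs"
    and nonneg: "AE x in m. 0 \<le> wgrad_loc m p f x"
  obtains a b where "0 \<le> a" "0 \<le> b"
    "AE x in m. wgrad m p (\<lambda>x. \<eta> x * trunc k f x) x \<le> indicator {x. \<eta> x \<noteq> 0} x * (a + b * wgrad_loc m p f x)"
proof -
  let ?h = "\<lambda>x. \<eta> x * trunc k f x"
  obtain L where L: "L-lipschitz_on UNIV \<eta>" using \<eta> by (auto simp: Lip_bs_def)
  obtain N where N: "0 \<le> N" "\<And>x. \<bar>\<eta> x\<bar> \<le> N" using Lip_bs_bounded[OF \<eta>] by blast
  fix c :: 'a
  obtain R where R: "\<And>x. \<eta> x \<noteq> 0 \<Longrightarrow> dist c x \<le> R"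
    using Lip_bs_support(1)[OF \<eta>] bounded_any_center[of _ c] by auto
  obtain n where n: "R \<le> real n" using real_arch_simple by blast
  let ?\<theta> = "cutoff c n"
  let ?g = "\<lambda>x. ?\<theta> x * trunc k f x"
  have \<theta>1: "?\<theta> x = 1" if "\<eta> x \<noteq> 0" for x using R[OF that] n by (intro cutoff_eq_1) simp
  have g: "?g \<in> Sp m p" by (rule Sp_locD[OF f k cutoff_Lip_bs])
  have h: "?h \<in> Sp m p" by (rule Sp_locD[OF f k \<eta>])
  have gk: "\<bar>?g x\<bar> \<le> k" for x
  proof -
    have "\<bar>?\<theta> x\<bar> * \<bar>trunc k f x\<bar> \<le> 1 * k"
      by (intro mult_mono trunc_bound k) (auto simp: cutoff_def)
    then show ?thesis by (simp add: abs_mult)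
  qed
  have hg: "?h x = \<eta> x * ?g x" for x using \<theta>1[of x] by (cases "\<eta> x = 0") auto
  \<comment> \<open>The bounds \<open>k\<close> of \<open>?g\<close> and \<open>N\<close> of
    \<open>\<eta>\<close> become the constants of the product rule.\<close>
  have le: "\<bar>?h x - ?h y\<bar> \<le> k * \<bar>\<eta> x - \<eta> y\<bar> + N * \<bar>?g x - ?g y\<bar>" for x y
  proof -
    have "?h x - ?h y = ?g x * (\<eta> x - \<eta> y) + \<eta> y * (?g x - ?g y)" unfolding hg by (simp add: algebra_simps)
    then have "\<bar>?h x - ?h y\<bar> \<le> \<bar>?g x\<bar> * \<bar>\<eta> x - \<eta> y\<bar> + \<bar>\<eta> y\<bar> * \<bar>?g x - ?g y\<bar>"
      by (metis abs_mult abs_triangle_ineq)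
    also have "\<dots> \<le> k * \<bar>\<eta> x - \<eta> y\<bar> + N * \<bar>?g x - ?g y\<bar>"
      by (intro add_mono mult_right_mono gk N(2)) auto
    finally show ?thesis .
  qed
  have "weak_upper_gradient m p ?h (\<lambda>x. k * (if \<eta> x = 0 then 0 else L) + N * wgrad m p ?g x)"
    by (rule wug_dominated[OF Lip_bs_borel[OF \<eta>] Sp_borel[OF g] wug_Lip_bs[OF mm \<eta> L] wgrad_minimal(1)[OF g] _ N(1) le])
      (use k in simp)
  \<comment> \<open>Minimality gives the bound where \<open>\<eta>\<close> is nonzero; on the level
    0 of the product the gradient vanishes, which produces the indicator.\<close>
  from wgrad_minimal(2)[OF h this] wgrad_level[OF h, of 0] wgrad_le_wgrad_loc[OF f k cutoff_Lip_bs nonneg, of c n]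
  have "AE x in m. wgrad m p ?h x \<le> indicator {x. \<eta> x \<noteq> 0} x * (k * L + N * wgrad_loc m p f x)"
  proof eventually_elim
    case (elim x)
    show ?case
    proof (cases "\<eta> x = 0")
      case False
      then have "N * wgrad m p ?g x \<le> N * wgrad_loc m p f x"
        using elim(3) \<theta>1[of x] N(1) by (intro mult_left_mono) auto
      then show ?thesis using elim(1) False by simp
    qed (use elim in simp)
  qed
  then show ?thesis
    using that[of "k * L" N] k N(1) lipschitz_on_nonneg[OF L] by simp
qed

end

section \<open>Transfer to the new exponent\<close>

lemma truncation_Lp:
  assumes m: "sets m = sets borel" and mm: "metric_measure_space m" and p: "1 < r"
    and f: "f \<in> borel_measurable borel" and k: "0 < k" and \<eta>: "\<eta> \<in> Lip_bs"
  shows "(\<lambda>x. \<eta> x * trunc k f x) \<in> Lp m r"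
proof -
  interpret sobolev_setting m r using m p by unfold_locales
  obtain N where N: "0 \<le> N" "\<And>x. \<bar>\<eta> x\<bar> \<le> N" using Lip_bs_bounded[OF \<eta>] by blast
  note f[measurable] Lip_bs_borel[OF \<eta>, measurable]
  show ?thesis
  proof (rule Lp_bound[OF _ indicator_bounded_Lp[OF mm Lip_bs_support(2,1)[OF \<eta>], of "N * k"] p])
    show "(\<lambda>x. \<eta> x * trunc k f x) \<in> borel_measurable m"
      unfolding measurable_m_iff trunc_def by measurable
    have "\<bar>\<eta> x * trunc k f x\<bar> \<le> N * k" for x
      unfolding abs_mult by (intro mult_mono N trunc_bound k) auto
    then show "AE x in m. \<bar>\<eta> x * trunc k f x\<bar> \<le> \<bar>N * k * indicator {x. \<eta> x \<noteq> 0} x\<bar>"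
      by (intro AE_I2) (auto split: split_indicator intro: order_trans[OF _ abs_ge_self])
  qed
qed

theorem theorem4p3:
  fixes m m' :: "'a::polish_space measure"
    and smul :: "('a \<Rightarrow> real) \<Rightarrow> 'v::{real_vector, topological_space} \<Rightarrow> 'v"
    and nrm :: "'v \<Rightarrow> 'a \<Rightarrow> real"
    and d :: "('a \<Rightarrow> real) \<Rightarrow> 'v"
    and f :: "'a \<Rightarrow> real"
    and pbar :: real
  assumes "metric_measure_space m"
    and "p_independent_strong m"
    and "universal_cotangent_module m m' smul nrm d"
    and "f \<in> (\<Union>p\<in>{1<..}. Sp_loc m p)"
    and "1 < pbar"
    and "nrm (d f) \<in> Lp_loc m pbar"
  shows "f \<in> Sp_loc m pbar"
proof -
  interpret universal_cotangent_module m m' smul nrm d by (rule assms(3))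
  obtain p where p: "1 < p" and f: "f \<in> Sp_loc m p" using assms(4) by auto
  have m: "sets m = sets borel" using assms(1) by (simp add: metric_measure_space_def)
  interpret sobolev_setting m p using m p by unfold_locales
  interpret R: sobolev_setting m pbar using m assms(5) by unfold_locales
  have fm: "f \<in> borel_measurable borel" using f by (auto simp: Sp_loc_def)
  let ?D = "nrm (d f)"
  have D: "AE x in m. ?D x = wgrad_loc m p f x" by (rule nrm_d[OF p f])
  have D0: "AE x in m. 0 \<le> wgrad_loc m p f x"
    using D nrm_nonneg[of "d f"] by eventually_elim simp
  \<comment> \<open>The function \<open>G\<close> required by \<open>Sp_loc\<close> for the new
    exponent is \<open>nrm (d f)\<close> itself.\<close>
  have main: "(\<lambda>x. \<eta> x * trunc k f x) \<in> Sp m pbar \<and>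
      (AE x in m. \<eta> x = 1 \<longrightarrow> wgrad m pbar (\<lambda>x. \<eta> x * trunc k f x) x \<le> \<bar>\<eta> x\<bar> * ?D x)"
    if k: "0 < k" and \<eta>: "\<eta> \<in> Lip_bs" for k \<eta>
  proof -
    let ?h = "\<lambda>x. \<eta> x * trunc k f x"
    let ?S = "{x. \<eta> x \<noteq> 0}"
    have hS: "?h \<in> Sp m p" by (rule Sp_locD[OF f k \<eta>])
    have hp: "?h \<in> W1p m p" using hS truncation_Lp[OF m assms(1) p fm k \<eta>] by (simp add: W1p_def)
    obtain a b where ab: "0 \<le> a" "0 \<le> b"
      "AE x in m. wgrad m p ?h x \<le> indicator ?S x * (a + b * wgrad_loc m p f x)"
      using wgrad_truncation_bound[OF assms(1) f k \<eta> D0] by blast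
    have "wgrad m p ?h \<in> Lp m pbar"
    proof (rule Lp_bound[OF _ _ assms(5)])
      show "wgrad m p ?h \<in> borel_measurable m"
        using wug_borel[OF wgrad_minimal(1)[OF hS]] by (simp add: measurable_m_iff)
      have "(\<lambda>x. indicator ?S x * ?D x) \<in> Lp m pbar"
        using assms(6) Lip_bs_support[OF \<eta>] m by (auto simp: Lp_loc_def)
      \<comment> \<open>The first summand is in the class because \<open>?S\<close> is bounded and
        so has finite measure, the second because |df| is locally in the class.\<close>
      then show "(\<lambda>x. a * indicator ?S x + b * (indicator ?S x * ?D x)) \<in> Lp m pbar"
        using Lip_bs_support[OF \<eta>] by (intro Lp_add Lp_cmult indicator_bounded_Lp assms(1,5)) auto
      show "AE x in m. \<bar>wgrad m p ?h x\<bar> \<le> \<bar>a * indicator ?S x + b * (indicator ?S x * ?D x)\<bar>"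
        using ab(3) D wug_nonneg[OF wgrad_minimal(1)[OF hS]]
        by eventually_elim (auto simp: algebra_simps intro: order_trans[OF _ abs_ge_self])
    qed
    \<comment> \<open>Part (c) of the independence hypothesis: the function and its old gradient
      both lie in the new Lebesgue class.\<close>
    then have hq: "?h \<in> W1p m pbar"
      using assms(2) p assms(5) hp truncation_Lp[OF m assms(1) assms(5) fm k \<eta>]
      unfolding p_independent_strong_def by blast
    then have "AE x in m. wgrad m p ?h x = wgrad m pbar ?h x"
      using assms(2) p assms(5) hp unfolding p_independent_strong_def by blast
    \<comment> \<open>The sharp bound is known for the old gradient and passes to the new one by
      part (b); the factor is 1 where \<open>\<eta> x = 1\<close>.\<close>
    then have "AE x in m. \<eta> x = 1 \<longrightarrow> wgrad m pbar ?h x \<le> \<bar>\<eta> x\<bar> * ?D x"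
      using wgrad_le_wgrad_loc[OF f k \<eta> D0] D by eventually_elim auto
    then show ?thesis using hq by (simp add: W1p_def)
  qed
  show ?thesis
    unfolding Sp_loc_def using fm assms(6) nrm_nonneg[of "d f"] main by blast
qed

end
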